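(* Let $d\in[0,n]$, let $f:\mathbb{R}^n\to\mathbb{R}^n$ be continuously differentiable with flow $\varphi^t$, and let $\mathbb{X}\subset\mathbb{R}^n$ satisfy (A1) and (A2) of the context. Then the system $\dot x=f(x)$ is uniformly $d$-contractive on $\mathbb{X}$ if and only if $\mathbf{\Sigma}_d<0$, where $$\mathbf{\Sigma}_d:=\sup_{x\in\mathbb{X}}\limsup_{t\to\infty}\frac1t\ln\omega_d\big[D\varphi^t(x)\big].$$
   Context: For $\dot x=f(x)$, $x(t,a)$ denotes the solution with $x(0,a)=a$, $\varphi^t(a):=x(t,a)$, and $D\varphi^t(x)$ is the Jacobian matrix of $\varphi^t$ at $x$. Assumptions on $\mathbb{X}$: (A1) there is an open set $O\supset\mathbb{X}$ such that $x(t,a)$ is defined for all $t\ge 0$ and all $a\in O$. (A2) $\mathbb{X}$ is compact, equals the closure of its interior, and is positively invariant: $\varphi^t(\mathbb{X})\subset\mathbb{X}$ for all $t>0$. Write $d=d_0+s$ with $d_0=\lfloor d\rfloor$, $s\in[0,1)$. For $A\in\mathbb{R}^{n\times n}$ with singular values $\sigma_1(A)\ge\dots\ge\sigma_n(A)$, $\omega_d(A):=\sigma_1(A)\cdots\sigma_{d_0}(A)\,\sigma_{d_0+1}(A)^s$ (the last factor is dropped if $d=n$; $a^0:=1$ for $a\ge0$). Hausdorff $d$-measure: for compact $K\subset\mathbb{R}^n$ and $\varepsilon>0$, $\mu_{d,\varepsilon}(K):=\inf\sum_i r_i^d$, the infimum being over all coverings of $K$ by finitely many open Euclidean balls of radii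 $r_i\le\varepsilon$; $\mu_d(K):=\lim_{\varepsilon\to0}\mu_{d,\varepsilon}(K)$. The system is uniformly $d$-contractive on $\mathbb{X}$ if for every $\varepsilon\in(0,1)$ there exists $\mathscr{T}(\varepsilon)>0$ such that for every compact $K\subset\mathbb{X}$ with $\mu_d(K)<\infty$: $\mu_d[\varphi^T(K)]\le\varepsilon\,\mu_d(K)$ for all $T\ge\mathscr{T}(\varepsilon)$. *)

theory Defs
  imports "HOL-Analysis.Analysis" "HOL-Computational_Algebra.Computational_Algebra"
begin

section \<open>Autonomous differential equations and their forward flow\<close>

definition continuously_differentiable :: "('a::real_normed_vector \<Rightarrow> 'b::real_normed_vector) \<Rightarrow> bool" where
  "continuously_differentiable f \<longleftrightarrow>
     (\<exists>f' :: 'a \<Rightarrow> 'a \<Rightarrow>\<^sub>L 'b. (\<forall>x. (f has_derivative blinfun_apply (f' x)) (at x)) \<and> continuous_on UNIV f')"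

definition ivp_solution :: "('a::real_normed_vector \<Rightarrow> 'a) \<Rightarrow> 'a \<Rightarrow> real \<Rightarrow> (real \<Rightarrow> 'a) \<Rightarrow> bool" where
  "ivp_solution f a t x \<longleftrightarrow>
     x 0 = a \<and> (\<forall>\<tau>\<in>{0..t}. (x has_vector_derivative f (x \<tau>)) (at \<tau> within {0..t}))"

text \<open>For continuously differentiable \<open>f\<close> any two solutions on \<open>{0..t}\<close> agree there, so for \<open>t \<ge> 0\<close>
  the description below is uniquely satisfied as soon as a solution on \<open>{0..t}\<close> exists.
  Only forward time is considered.\<close>

definition flow :: "('a::real_normed_vector \<Rightarrow> 'a) \<Rightarrow> real \<Rightarrow> 'a \<Rightarrow> 'a" where
  "flow f t a = (THE y. \<exists>x. ivp_solution f a t x \<and> x t = y)"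

definition forward_complete_near :: "('a::real_normed_vector \<Rightarrow> 'a) \<Rightarrow> 'a set \<Rightarrow> bool" where
  "forward_complete_near f X \<longleftrightarrow>
     (\<exists>U. open U \<and> X \<subseteq> U \<and> (\<forall>a\<in>U. \<forall>t\<ge>0. \<exists>x. ivp_solution f a t x))"

definition positively_invariant :: "('a::real_normed_vector \<Rightarrow> 'a) \<Rightarrow> 'a set \<Rightarrow> bool" where
  "positively_invariant f X \<longleftrightarrow> (\<forall>t>0. flow f t ` X \<subseteq> X)"


section \<open>Singular values\<close>

definition charpoly :: "real^'n^'n \<Rightarrow> real poly" where
  "charpoly A = det (\<chi> i j. (if i = j then [:0, 1:] else 0) - [:A $ i $ j:])"

text \<open>The square roots of the eigenvalues of \<open>A\<^sup>T A\<close>, with multiplicity, in decreasing order; the list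
  has length \<open>CARD('n)\<close>, and its entry number \<open>i\<close> (from 0) is \<open>\<sigma>\<close> with index \<open>i + 1\<close>.\<close>

definition singular_values :: "real^'n^'n \<Rightarrow> real list" where
  "singular_values A =
     rev (sorted_list_of_multiset (image_mset sqrt (proots (charpoly (transpose A ** A)))))"

text \<open>The case distinction implements \<open>0\<^sup>0 = 1\<close> (whereas \<open>0 powr 0 = 0\<close>) and drops the last factor
  for \<open>d = CARD('n)\<close>.\<close>

definition omega :: "real \<Rightarrow> real^'n^'n \<Rightarrow> real" where
  "omega d A =
     (\<Prod>i<nat \<lfloor>d\<rfloor>. singular_values A ! i) *
     (if frac d = 0 then 1 else (singular_values A ! nat \<lfloor>d\<rfloor>) powr frac d)"


section \<open>Hausdorff measure by finite coverings with open balls\<close>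

definition ball_covers :: "real \<Rightarrow> 'a::metric_space set \<Rightarrow> ('a \<times> real) set set" where
  "ball_covers e K =
     {C. finite C \<and> (\<forall>(c, r)\<in>C. 0 < r \<and> r \<le> e) \<and> K \<subseteq> (\<Union>(c, r)\<in>C. ball c r)}"

definition hausdorff_pre :: "real \<Rightarrow> real \<Rightarrow> 'a::metric_space set \<Rightarrow> ennreal" where
  "hausdorff_pre d e K = (INF C\<in>ball_covers e K. ennreal (\<Sum>(c, r)\<in>C. r powr d))"

definition hausdorff_measure :: "real \<Rightarrow> 'a::metric_space set \<Rightarrow> ennreal" where
  "hausdorff_measure d K = Lim (at_right 0) (\<lambda>e. hausdorff_pre d e K)"

lemma hausdorff_pre_antimono: "e \<le> e' \<Longrightarrow> hausdorff_pre d e' K \<le> hausdorff_pre d e K"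
  unfolding hausdorff_pre_def
  by (rule INF_superset_mono) (auto simp: ball_covers_def)

lemma hausdorff_pre_tendsto_SUP:
  "((\<lambda>e. hausdorff_pre d e K) \<longlongrightarrow> (SUP e\<in>{0<..}. hausdorff_pre d e K)) (at_right 0)"
proof (rule increasing_tendsto)
  show "\<forall>\<^sub>F e in at_right 0. hausdorff_pre d e K \<le> (SUP e\<in>{0<..}. hausdorff_pre d e K)"
    by (rule eventually_at_rightI[of 0 1]) (auto intro: SUP_upper)
next
  fix x assume "x < (SUP e\<in>{0<..}. hausdorff_pre d e K)"
  then obtain e where e: "e > 0" "x < hausdorff_pre d e K"
    by (auto simp: less_SUP_iff)
  have "x < hausdorff_pre d e' K" if "e' \<in> {0<..<e}" for e'
    using that less_le_trans[OF e(2) hausdorff_pre_antimono[of e' e d K]] by simp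
  then show "\<forall>\<^sub>F e in at_right 0. x < hausdorff_pre d e K"
    by (rule eventually_at_rightI[OF _ e(1)])
qed

lemma hausdorff_measure_eq_SUP: "hausdorff_measure d K = (SUP e\<in>{0<..}. hausdorff_pre d e K)"
  unfolding hausdorff_measure_def
  by (rule tendsto_Lim[OF _ hausdorff_pre_tendsto_SUP]) simp


section \<open>Uniform contraction and the uniform Lyapunov exponent\<close>

definition uniformly_contractive :: "real \<Rightarrow> ('a::real_normed_vector \<Rightarrow> 'a) \<Rightarrow> 'a set \<Rightarrow> bool" where
  "uniformly_contractive d f X \<longleftrightarrow>
     (\<forall>\<epsilon>\<in>{0<..<1::real}. \<exists>T\<^sub>0>0. \<forall>K. compact K \<and> K \<subseteq> X \<and> hausdorff_measure d K < \<infinity> \<longrightarrow>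
        (\<forall>T\<ge>T\<^sub>0. hausdorff_measure d (flow f T ` K) \<le> ennreal \<epsilon> * hausdorff_measure d K))"

text \<open>The supremum is taken in the extended reals, so it is \<open>-\<infinity>\<close> for empty \<open>X\<close>. Under the
  standing assumptions \<open>D\<phi>\<^sup>t(x)\<close> is invertible, so \<open>ln\<close> is applied to positive numbers only.\<close>

definition Sigma_exponent :: "real \<Rightarrow> (real^'n \<Rightarrow> real^'n) \<Rightarrow> (real^'n) set \<Rightarrow> ereal" where
  "Sigma_exponent d f X =
     (SUP x\<in>X. Limsup at_top (\<lambda>t. ereal (1 / t * ln (omega d (jacobian (flow f t) (at x))))))"

end

theory Submission
  imports Defs
begin

text \<open>Write \<open>\<omega>\<close> for the singular value function of dimension \<open>d\<close>, applied to the derivative of the flow map. The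
theorem rests on two estimates with constants that depend only on \<open>d\<close> and on the dimension of the space.

Upper estimate. The flow maps a small ball of radius \<open>r\<close> nearly onto an ellipsoid whose semiaxes are \<open>r\<close>
times the singular values. Cut this ellipsoid into cubes whose side is the last semiaxis that enters
\<open>\<omega>\<close>: up to a constant, the balls around these cubes have total weight \<open>\<omega> * r powr d\<close>. Summing
over a cover shows that the flow multiplies the Hausdorff measure by at most a constant times the
supremum of \<open>\<omega>\<close> (\<open>hausdorff_measure_image_le\<close>).

Lower estimate. For an invertible matrix \<open>A\<close>, place along its right singular vectors a product of unit
intervals and one Cantor set whose dimensions add up to \<open>d\<close>. Counting the points of a fine finite level
in each ball of a cover shows that the image of this set has measure at least a constant times
\<open>\<omega> A\<close>, even when \<open>A\<close> is followed by a map that does not shrink distances much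
(\<open>expanding_test_set\<close>). Near a point, the flow map is its derivative followed by such a map, so a
contraction of all compact sets forces \<open>\<omega>\<close> to be small at interior points of \<open>X\<close>, and then, as
\<open>X\<close> is the closure of its interior, everywhere on \<open>X\<close>.

Measuring the test set of \<open>A ** B\<close> with both estimates gives
\<open>\<omega> (A ** B) \<le> C * \<omega> A * \<omega> B\<close> (\<open>omega_submultiplicative\<close>). The sharp inequality has \<open>C = 1\<close>, but
a constant is harmless: the times involved can be taken so large that \<open>\<omega>\<close> beats it.

From negative exponent to contraction: every point of \<open>X\<close> has a time at which \<open>C * \<omega> \<le> 1 / 2\<close>; by
compactness these times can be chosen in a bounded interval, and chaining them along a trajectory makes \<open>\<omega>\<close>
decay exponentially, uniformly on \<open>X\<close>, so the upper estimate applies. From contraction to negative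
exponent: for all \<open>T\<close> beyond some \<open>T0\<close> the lower estimate gives \<open>C * \<omega> \<le> 1 / 2\<close> at time \<open>T\<close>; every
\<open>t \<ge> T0\<close> is a multiple of some \<open>T\<close> between \<open>T0\<close> and \<open>2 * T0\<close>, which bounds the exponent by
\<open>- ln 2 / (2 * T0)\<close>.

For \<open>d = 0\<close> the measure counts points and \<open>\<omega> = 1\<close>, so both sides hold exactly when \<open>X\<close> is empty.\<close>

section \<open>Gronwall estimates\<close>

lemma nonincreasing_from_start:
  fixes h :: "real \<Rightarrow> real"
  assumes der: "\<And>\<tau>. \<tau> \<in> {0..T} \<Longrightarrow> (h has_real_derivative h' \<tau>) (at \<tau> within {0..T})"
    and le: "\<And>\<tau>. 0 < \<tau> \<Longrightarrow> \<tau> < T \<Longrightarrow> h' \<tau> \<le> 0"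
    and s: "0 \<le> s" "s \<le> T"
  shows "h s \<le> h 0"
proof (cases "s = 0")
  case False
  then have s0: "0 < s" using s by simp
  have "\<exists>x\<in>{0<..<s}. h s - h 0 = (\<lambda>y. h' x * y) (s - 0)"
  proof (rule mvt_simple[OF s0])
    fix x assume x: "0 \<le> x" "x \<le> s"
    then have "(h has_real_derivative h' x) (at x within {0..s})"
      using s by (intro DERIV_subset[OF der]) auto
    then show "(h has_derivative (\<lambda>y. h' x * y)) (at x within {0..s})"
      by (simp add: has_field_derivative_def)
  qed
  then obtain x where x: "0 < x" "x < s" "h s - h 0 = h' x * s" by auto
  moreover have "h' x * s \<le> 0"
    using le[of x] x s s0 by (intro mult_nonpos_nonneg) auto
  ultimately show ?thesis by simp
qed simp

text \<open>The norm is not differentiable at zero, so all Gronwall estimates work with its square. The exponential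
weight absorbs the part of the growth that is linear in the solution, the term \<open>b * \<tau>\<close> the inhomogeneity.\<close>

lemma weighted_norm_derivative:
  fixes w :: "real \<Rightarrow> 'a::real_inner"
  assumes "(w has_vector_derivative w') (at \<tau> within S)"
  shows "((\<lambda>\<tau>. (w \<tau> \<bullet> w \<tau>) * exp (k * \<tau>) + b * \<tau>) has_real_derivative
           (2 * (w \<tau> \<bullet> w') + k * (w \<tau> \<bullet> w \<tau>)) * exp (k * \<tau>) + b) (at \<tau> within S)"
proof -
  have "((\<lambda>\<tau>. w \<tau> \<bullet> w \<tau>) has_derivative (\<lambda>h. w \<tau> \<bullet> (h *\<^sub>R w') + (h *\<^sub>R w') \<bullet> w \<tau>)) (at \<tau> within S)"
    using assms unfolding has_vector_derivative_def by (intro has_derivative_inner)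
  then have "((\<lambda>\<tau>. w \<tau> \<bullet> w \<tau>) has_real_derivative 2 * (w \<tau> \<bullet> w')) (at \<tau> within S)"
    by (rule has_derivative_imp_has_field_derivative) (simp add: inner_commute algebra_simps)
  then show ?thesis
    by (auto intro!: derivative_eq_intros simp: algebra_simps)
qed

text \<open>The rate \<open>2 * L + 1\<close> instead of \<open>2 * L\<close> pays for the estimate \<open>2 * c * n \<le> n\<^sup>2 + c\<^sup>2\<close>. If
\<open>w 0 = 0\<close>, the resulting bound for the norm is proportional to \<open>c\<close>, which is what the linearisation of the
flow needs.\<close>

lemma gronwall_inhomogeneous:
  fixes w :: "real \<Rightarrow> 'a::real_inner"
  assumes der: "\<And>\<tau>. \<tau> \<in> {0..T} \<Longrightarrow> (w has_vector_derivative w' \<tau>) (at \<tau> within {0..T})"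
    and le: "\<And>\<tau>. 0 < \<tau> \<Longrightarrow> \<tau> < T \<Longrightarrow> norm (w' \<tau>) \<le> L * norm (w \<tau>) + c"
    and s: "0 \<le> s" "s \<le> T" and L: "0 \<le> L"
  shows "(norm (w s))\<^sup>2 \<le> ((norm (w 0))\<^sup>2 + c\<^sup>2 * s) * exp ((2 * L + 1) * s)"
proof -
  define k where "k = - (2 * L + 1)"
  have "(w s \<bullet> w s) * exp (k * s) + (- c\<^sup>2) * s \<le> (w 0 \<bullet> w 0) * exp (k * 0) + (- c\<^sup>2) * 0"
  proof (rule nonincreasing_from_start[OF weighted_norm_derivative[OF der] _ s])
    fix \<tau> :: real assume \<tau>: "0 < \<tau>" "\<tau> < T"
    let ?n = "norm (w \<tau>)"
    have "w \<tau> \<bullet> w' \<tau> \<le> ?n * norm (w' \<tau>)" by (rule norm_cauchy_schwarz)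
    also have "\<dots> \<le> ?n * (L * ?n + c)" using le[OF \<tau>] by (intro mult_left_mono) auto
    finally have "2 * (w \<tau> \<bullet> w' \<tau>) + k * (w \<tau> \<bullet> w \<tau>) \<le> c\<^sup>2 - (?n - c)\<^sup>2"
      by (simp add: k_def power2_norm_eq_inner[symmetric] power2_eq_square algebra_simps)
    also have "\<dots> \<le> c\<^sup>2" by simp
    finally have "(2 * (w \<tau> \<bullet> w' \<tau>) + k * (w \<tau> \<bullet> w \<tau>)) * exp (k * \<tau>) \<le> c\<^sup>2 * exp (k * \<tau>)"
      by (intro mult_right_mono) auto
    also have "\<dots> \<le> c\<^sup>2 * 1"
      using \<tau> L by (intro mult_left_mono) (auto simp: k_def intro!: mult_nonpos_nonneg)
    finally show "(2 * (w \<tau> \<bullet> w' \<tau>) + k * (w \<tau> \<bullet> w \<tau>)) * exp (k * \<tau>) + - c\<^sup>2 \<le> 0" by simp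
  qed
  then have "(norm (w s))\<^sup>2 * exp (k * s) \<le> (norm (w 0))\<^sup>2 + c\<^sup>2 * s"
    by (simp add: power2_norm_eq_inner)
  then have *: "(norm (w s))\<^sup>2 * exp (k * s) * exp (- k * s) \<le> ((norm (w 0))\<^sup>2 + c\<^sup>2 * s) * exp (- k * s)"
    by (intro mult_right_mono) auto
  have e: "exp (k * s) * exp (- k * s) = 1" by (simp flip: exp_add)
  have "(norm (w s))\<^sup>2 = (norm (w s))\<^sup>2 * exp (k * s) * exp (- k * s)"
    by (simp only: mult.assoc e mult_1_right)
  also note *
  finally show ?thesis unfolding k_def by (simp only: minus_minus)
qed

lemma gronwall_bounds:
  fixes w :: "real \<Rightarrow> 'a::real_inner"
  assumes der: "\<And>\<tau>. \<tau> \<in> {0..T} \<Longrightarrow> (w has_vector_derivative w' \<tau>) (at \<tau> within {0..T})"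
    and le: "\<And>\<tau>. 0 < \<tau> \<Longrightarrow> \<tau> < T \<Longrightarrow> norm (w' \<tau>) \<le> L * norm (w \<tau>)"
    and s: "0 \<le> s" "s \<le> T"
  shows "norm (w s) \<le> exp (L * s) * norm (w 0)" "exp (- L * s) * norm (w 0) \<le> norm (w s)"
proof -
  have abs: "\<bar>w \<tau> \<bullet> w' \<tau>\<bar> \<le> L * (w \<tau> \<bullet> w \<tau>)" if \<tau>: "0 < \<tau>" "\<tau> < T" for \<tau>
  proof -
    have "\<bar>w \<tau> \<bullet> w' \<tau>\<bar> \<le> norm (w \<tau>) * norm (w' \<tau>)" by (rule Cauchy_Schwarz_ineq2)
    also have "\<dots> \<le> norm (w \<tau>) * (L * norm (w \<tau>))" using le[OF \<tau>] by (intro mult_left_mono) auto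
    finally show ?thesis by (simp add: power2_norm_eq_inner[symmetric] power2_eq_square algebra_simps)
  qed
  have "(w s \<bullet> w s) * exp ((- 2 * L) * s) + 0 * s \<le> (w 0 \<bullet> w 0) * exp ((- 2 * L) * 0) + 0 * 0"
  proof (rule nonincreasing_from_start[OF weighted_norm_derivative[OF der] _ s])
    fix \<tau> :: real assume "0 < \<tau>" "\<tau> < T"
    then have "2 * (w \<tau> \<bullet> w' \<tau>) + - 2 * L * (w \<tau> \<bullet> w \<tau>) \<le> 0"
      using abs[of \<tau>] by (simp add: abs_le_iff)
    then show "(2 * (w \<tau> \<bullet> w' \<tau>) + - 2 * L * (w \<tau> \<bullet> w \<tau>)) * exp (- 2 * L * \<tau>) + 0 \<le> 0"
      by (simp add: mult_le_0_iff)
  qed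
  then have "(norm (w s))\<^sup>2 * exp (- 2 * L * s) \<le> (norm (w 0))\<^sup>2"
    by (simp add: power2_norm_eq_inner)
  moreover have "exp (- 2 * L * s) = (exp (- L * s))\<^sup>2" by (simp flip: exp_double)
  ultimately have "(norm (w s) * exp (- L * s))\<^sup>2 \<le> (norm (w 0))\<^sup>2" by (simp add: power_mult_distrib)
  then have "norm (w s) * exp (- L * s) \<le> norm (w 0)" by (rule power2_le_imp_le) simp
  then show "norm (w s) \<le> exp (L * s) * norm (w 0)"
    by (simp add: exp_minus field_simps)
  have d: "((\<lambda>\<tau>. - ((w \<tau> \<bullet> w \<tau>) * exp (2 * L * \<tau>) + 0 * \<tau>)) has_real_derivative
           - ((2 * (w \<tau> \<bullet> w' \<tau>) + 2 * L * (w \<tau> \<bullet> w \<tau>)) * exp (2 * L * \<tau>) + 0)) (at \<tau> within {0..T})"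
    if "\<tau> \<in> {0..T}" for \<tau>
    by (rule DERIV_minus) (rule weighted_norm_derivative[OF der[OF that]])
  have "- ((w s \<bullet> w s) * exp (2 * L * s) + 0 * s) \<le> - ((w 0 \<bullet> w 0) * exp (2 * L * 0) + 0 * 0)"
  proof (rule nonincreasing_from_start[OF d _ s])
    fix \<tau> :: real assume "0 < \<tau>" "\<tau> < T"
    then have "0 \<le> 2 * (w \<tau> \<bullet> w' \<tau>) + 2 * L * (w \<tau> \<bullet> w \<tau>)"
      using abs[of \<tau>] by (simp add: abs_le_iff)
    then show "- ((2 * (w \<tau> \<bullet> w' \<tau>) + 2 * L * (w \<tau> \<bullet> w \<tau>)) * exp (2 * L * \<tau>) + 0) \<le> 0"
      by simp
  qed
  then have "(norm (w 0))\<^sup>2 \<le> (norm (w s))\<^sup>2 * exp (2 * L * s)"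
    by (simp add: power2_norm_eq_inner)
  moreover have "exp (2 * L * s) = (exp (L * s))\<^sup>2" by (simp add: mult.assoc flip: exp_double)
  ultimately have "(norm (w 0))\<^sup>2 \<le> (norm (w s) * exp (L * s))\<^sup>2" by (simp add: power_mult_distrib)
  then have "norm (w 0) \<le> norm (w s) * exp (L * s)" by (rule power2_le_imp_le) simp
  then show "exp (- L * s) * norm (w 0) \<le> norm (w s)" by (simp add: exp_minus field_simps)
qed

section \<open>Solutions and the flow\<close>

lemma C1_lipschitz_on_ball:
  fixes f :: "'a::euclidean_space \<Rightarrow> 'b::real_normed_vector"
  assumes "continuously_differentiable f"
  obtains L where "0 \<le> L" "\<And>x y. x \<in> cball 0 R \<Longrightarrow> y \<in> cball 0 R \<Longrightarrow> norm (f x - f y) \<le> L * norm (x - y)"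
proof -
  obtain f' :: "'a \<Rightarrow> 'a \<Rightarrow>\<^sub>L 'b" where f': "\<And>x. (f has_derivative blinfun_apply (f' x)) (at x)"
    and cont: "continuous_on UNIV f'"
    using assms unfolding continuously_differentiable_def by blast
  have "compact (f' ` cball 0 R)"
    by (intro compact_continuous_image continuous_on_subset[OF cont]) auto
  then obtain L where L: "\<And>x. x \<in> cball 0 R \<Longrightarrow> norm (f' x) \<le> L"
    using compact_imp_bounded[of "f' ` cball 0 R"] unfolding bounded_iff by blast
  show ?thesis
  proof (rule that[of "max L 0"])
    fix x y :: 'a assume "x \<in> cball 0 R" "y \<in> cball 0 R"
    then show "norm (f x - f y) \<le> max L 0 * norm (x - y)"
      using L by (intro differentiable_bound[OF convex_cball has_derivative_at_withinI[OF f'], of 0 R])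
        (fastforce simp: norm_blinfun.rep_eq[symmetric])+
  qed simp
qed

lemma ivp_solution_continuous:
  "ivp_solution f a t x \<Longrightarrow> continuous_on {0..t} x"
  unfolding ivp_solution_def continuous_on_eq_continuous_within
  using has_vector_derivative_continuous by blast

lemma ivp_solution_difference:
  assumes "ivp_solution f a t x" "ivp_solution f b t y" "\<tau> \<in> {0..t}"
  shows "((\<lambda>\<tau>. y \<tau> - x \<tau>) has_vector_derivative (f (y \<tau>) - f (x \<tau>))) (at \<tau> within {0..t})"
  using assms unfolding ivp_solution_def by (intro has_vector_derivative_diff) auto

text \<open>The two solutions are continuous on a compact interval and hence stay in some ball, on which \<open>f\<close> has a
Lipschitz constant; Gronwall does the rest.\<close>

lemma ivp_solution_unique:
  fixes f :: "'a::euclidean_space \<Rightarrow> 'a"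
  assumes f: "continuously_differentiable f"
    and x: "ivp_solution f a t x" and y: "ivp_solution f a t y" and s: "0 \<le> s" "s \<le> t"
  shows "x s = y s"
proof -
  have "bounded (x ` {0..t} \<union> y ` {0..t})"
    using ivp_solution_continuous[OF x] ivp_solution_continuous[OF y]
    by (auto intro!: compact_imp_bounded compact_continuous_image)
  then obtain R where R: "x ` {0..t} \<union> y ` {0..t} \<subseteq> cball 0 R"
    unfolding bounded_iff by (auto simp: subset_iff)
  obtain L where L: "0 \<le> L" "\<And>x y. x \<in> cball 0 R \<Longrightarrow> y \<in> cball 0 R \<Longrightarrow> norm (f x - f y) \<le> L * norm (x - y)"
    using C1_lipschitz_on_ball[OF f] by metis
  have "norm (y s - x s) \<le> exp (L * s) * norm (y 0 - x 0)"
    using R L by (intro gronwall_bounds(1)[OF ivp_solution_difference[OF x y] _ s]) (auto simp: image_subset_iff)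
  moreover have "x 0 = a" "y 0 = a" using x y by (auto simp: ivp_solution_def)
  ultimately show ?thesis by simp
qed

lemma ivp_solution_restrict:
  "ivp_solution f a t x \<Longrightarrow> s \<le> t \<Longrightarrow> ivp_solution f a s x"
  unfolding ivp_solution_def
  by (auto intro: has_vector_derivative_within_subset[where S="{0..t}"])

lemma flow_eq:
  fixes f :: "'a::euclidean_space \<Rightarrow> 'a"
  assumes f: "continuously_differentiable f"
    and x: "ivp_solution f a t x" and s: "0 \<le> s" "s \<le> t"
  shows "flow f s a = x s"
  unfolding flow_def
proof (rule the_equality)
  show "\<exists>x'. ivp_solution f a s x' \<and> x' s = x s"
    using ivp_solution_restrict[OF x s(2)] by blast
next
  fix y assume "\<exists>x'. ivp_solution f a s x' \<and> x' s = y"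
  then show "y = x s"
    using ivp_solution_unique[OF f _ ivp_solution_restrict[OF x s(2)] s(1) order.refl] by blast
qed

lemma ivp_solution_flow:
  fixes f :: "'a::euclidean_space \<Rightarrow> 'a"
  assumes f: "continuously_differentiable f" and x: "ivp_solution f a t x" and t: "0 \<le> t"
  shows "ivp_solution f a t (\<lambda>s. flow f s a)"
proof -
  have eq: "flow f \<tau> a = x \<tau>" if "\<tau> \<in> {0..t}" for \<tau>
    using flow_eq[OF f x] that by auto
  have "((\<lambda>s. flow f s a) has_vector_derivative f (flow f \<tau> a)) (at \<tau> within {0..t})" if \<tau>: "\<tau> \<in> {0..t}" for \<tau>
  proof -
    have "(x has_vector_derivative f (flow f \<tau> a)) (at \<tau> within {0..t})"
      using x \<tau> unfolding eq[OF \<tau>] ivp_solution_def by blast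
    with \<tau> eq show ?thesis by (rule has_vector_derivative_transform)
  qed
  then show ?thesis using eq[of 0] x t by (auto simp: ivp_solution_def)
qed

lemma ivp_solution_shift:
  assumes x: "ivp_solution f a (s + t) x" and s: "0 \<le> s"
  shows "ivp_solution f (x s) t (\<lambda>\<tau>. x (s + \<tau>))"
proof -
  have "((\<lambda>\<tau>. x (s + \<tau>)) has_vector_derivative f (x (s + \<tau>))) (at \<tau> within {0..t})" if "\<tau> \<in> {0..t}" for \<tau>
  proof -
    have "(x has_vector_derivative f (x (s + \<tau>))) (at (s + \<tau>) within (+) s ` {0..t})"
    proof (rule has_vector_derivative_within_subset)
      show "(x has_vector_derivative f (x (s + \<tau>))) (at (s + \<tau>) within {0..s + t})"
        using x s that by (auto simp: ivp_solution_def)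
      show "(+) s ` {0..t} \<subseteq> {0..s + t}" using s by auto
    qed
    moreover have "((+) s has_vector_derivative 1) (at \<tau> within {0..t})"
      by (auto simp: has_vector_derivative_def intro!: derivative_eq_intros)
    ultimately have "(x \<circ> (+) s has_vector_derivative 1 *\<^sub>R f (x (s + \<tau>))) (at \<tau> within {0..t})"
      by (intro vector_diff_chain_within)
    then show ?thesis by (simp add: o_def)
  qed
  then show ?thesis by (simp add: ivp_solution_def)
qed

lemma flow_flow:
  fixes f :: "'a::euclidean_space \<Rightarrow> 'a"
  assumes f: "continuously_differentiable f" and x: "ivp_solution f a (s + t) x" and s: "0 \<le> s" "0 \<le> t"
  shows "flow f t (flow f s a) = flow f (s + t) a"
  using flow_eq[OF f x, of s] flow_eq[OF f x, of "s + t"] flow_eq[OF f ivp_solution_shift[OF x s(1)], of t] s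
  by simp

section \<open>Trajectories near a compact invariant set\<close>

text \<open>The ball of radius \<open>R\<close> exceeds \<open>X\<close> by a margin of one: solutions that start close to \<open>X\<close> may
leave \<open>X\<close>, and even the set \<open>U\<close> of initial values with global solutions, but for a given time they stay
within the ball, where \<open>L\<close> is a Lipschitz constant of the vector field.\<close>

locale invariant_flow =
  fixes f :: "'a::euclidean_space \<Rightarrow> 'a" and X U :: "'a set" and R L :: real
  assumes f: "continuously_differentiable f"
    and openU: "open U" and XU: "X \<subseteq> U"
    and solutions: "\<And>a t. a \<in> U \<Longrightarrow> 0 \<le> t \<Longrightarrow> \<exists>x. ivp_solution f a t x"
    and compactX: "compact X"
    and invariant: "positively_invariant f X"
    and X_ball: "\<And>x. x \<in> X \<Longrightarrow> norm x \<le> R - 1"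
    and L0: "0 \<le> L"
    and lipschitz: "\<And>x y. norm x \<le> R \<Longrightarrow> norm y \<le> R \<Longrightarrow> norm (f x - f y) \<le> L * norm (x - y)"
begin

abbreviation \<phi> :: "real \<Rightarrow> 'a \<Rightarrow> 'a" where "\<phi> \<equiv> flow f"

lemma flow_solution: "a \<in> U \<Longrightarrow> 0 \<le> t \<Longrightarrow> ivp_solution f a t (\<lambda>s. \<phi> s a)"
  using solutions ivp_solution_flow[OF f] by blast

lemma flow_0: "a \<in> U \<Longrightarrow> \<phi> 0 a = a"
  using flow_solution[of a 0] by (simp add: ivp_solution_def)

lemma flow_add: "a \<in> U \<Longrightarrow> 0 \<le> s \<Longrightarrow> 0 \<le> t \<Longrightarrow> \<phi> (s + t) a = \<phi> t (\<phi> s a)"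
  using flow_flow[OF f flow_solution[of a "s + t"]] by simp

lemma flow_in_X: "a \<in> X \<Longrightarrow> 0 \<le> t \<Longrightarrow> \<phi> t a \<in> X"
  using invariant XU flow_0 by (cases "t = 0") (auto simp: positively_invariant_def image_subset_iff)

definition confined :: "real \<Rightarrow> 'a \<Rightarrow> bool" where
  "confined T b \<longleftrightarrow> b \<in> U \<and> (\<forall>s. 0 \<le> s \<and> s \<le> T \<longrightarrow> norm (\<phi> s b) \<le> R)"

lemma confined_X: "a \<in> X \<Longrightarrow> confined T a"
  using XU X_ball flow_in_X by (fastforce simp: confined_def)

lemma confined_bounds:
  assumes "confined T a" "confined T b" "0 \<le> s" "s \<le> T"
  shows "norm (\<phi> s b - \<phi> s a) \<le> exp (L * s) * norm (b - a)"
    "exp (- L * s) * norm (b - a) \<le> norm (\<phi> s b - \<phi> s a)"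
proof -
  have ab: "a \<in> U" "b \<in> U" "0 \<le> T" using assms by (auto simp: confined_def)
  have le: "norm (f (\<phi> \<tau> b) - f (\<phi> \<tau> a)) \<le> L * norm (\<phi> \<tau> b - \<phi> \<tau> a)" if "0 < \<tau>" "\<tau> < T" for \<tau>
    using assms that by (intro lipschitz) (auto simp: confined_def)
  note diff = ivp_solution_difference[OF flow_solution[OF ab(1,3)] flow_solution[OF ab(2,3)]]
  show "norm (\<phi> s b - \<phi> s a) \<le> exp (L * s) * norm (b - a)"
    using gronwall_bounds(1)[OF diff le assms(3,4)] ab by (simp add: flow_0)
  show "exp (- L * s) * norm (b - a) \<le> norm (\<phi> s b - \<phi> s a)"
    using gronwall_bounds(2)[OF diff le assms(3,4)] ab by (simp add: flow_0)
qed

text \<open>A first exit argument: until the distance from the trajectory of \<open>a\<close> reaches one, both solutions stay in the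
ball, so by Gronwall the distance is at most \<open>exp (L * T) * norm (b - a)\<close>, which is less than one.\<close>

lemma near_X_confined:
  assumes a: "a \<in> X" and b: "b \<in> U" and T: "0 \<le> T" and ab: "norm (b - a) * exp (L * T) < 1"
  shows "confined T b"
proof -
  let ?w = "\<lambda>s. \<phi> s b - \<phi> s a"
  have aU: "a \<in> U" using a XU by auto
  have ca: "norm (\<phi> s a) \<le> R - 1" if "0 \<le> s" for s
    using X_ball flow_in_X a that by auto
  have small: "norm (?w s) < 1" if s: "s \<in> {0..T}" for s
  proof (rule ccontr)
    assume "\<not> norm (?w s) < 1"
    let ?S = "{s \<in> {0..T}. 1 \<le> norm (?w s)}"
    have cont: "continuous_on {0..T} (\<lambda>s. norm (?w s))"
      using ivp_solution_continuous[OF flow_solution[OF aU T]] ivp_solution_continuous[OF flow_solution[OF b T]]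
      by (intro continuous_intros)
    have "closedin (top_of_set {0..T}) ({0..T} \<inter> (\<lambda>s. norm (?w s)) -` {1..})"
      by (rule continuous_closedin_preimage[OF cont]) auto
    moreover have "{0..T} \<inter> (\<lambda>s. norm (?w s)) -` {1..} = ?S" by auto
    ultimately have "compact ?S" by (auto intro: closedin_compact)
    moreover have "?S \<noteq> {}" using s \<open>\<not> norm (?w s) < 1\<close> by auto
    ultimately have "\<exists>e\<in>?S. \<forall>s\<in>?S. e \<le> s" by (rule compact_attains_inf)
    then obtain e where e: "e \<in> ?S" "\<And>s. s \<in> ?S \<Longrightarrow> e \<le> s" by blast
    then have e0: "0 \<le> e" "e \<le> T" by auto
    have "norm (?w e) \<le> exp (L * e) * norm (?w 0)"
    proof (rule gronwall_bounds(1)[OF ivp_solution_difference[OF flow_solution[OF aU e0(1)] flow_solution[OF b e0(1)]]])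
      fix \<tau> assume \<tau>: "0 < \<tau>" "\<tau> < e"
      then have "norm (?w \<tau>) < 1" using e(2)[of \<tau>] e0 by force
      then have "norm (\<phi> \<tau> b) \<le> R"
        using ca[of \<tau>] \<tau> norm_triangle_ineq[of "\<phi> \<tau> a" "?w \<tau>"] by simp
      then show "norm (f (\<phi> \<tau> b) - f (\<phi> \<tau> a)) \<le> L * norm (?w \<tau>)"
        using ca[of \<tau>] \<tau> by (intro lipschitz) auto
    qed (use e0 in auto)
    also have "\<dots> \<le> exp (L * T) * norm (b - a)"
      using e0 L0 aU b by (auto simp: flow_0 intro!: mult_mono mult_left_mono)
    also have "\<dots> < 1" using ab by (simp add: mult.commute)
    finally show False using e(1) by simp
  qed
  have "norm (\<phi> s b) \<le> R" if "0 \<le> s" "s \<le> T" for s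
    using small[of s] ca[of s] that norm_triangle_ineq[of "\<phi> s a" "?w s"] by simp
  with b show ?thesis by (simp add: confined_def)
qed

lemma near_X_confined_uniform:
  assumes T: "0 \<le> T"
  obtains \<delta> where "0 < \<delta>" "\<And>a b. a \<in> X \<Longrightarrow> norm (b - a) < \<delta> \<Longrightarrow> confined T b"
proof -
  obtain \<rho> where \<rho>: "0 < \<rho>" "(\<Union>x\<in>X. ball x \<rho>) \<subseteq> U"
    using compact_subset_open_imp_ball_epsilon_subset[OF compactX openU XU] by metis
  show ?thesis
  proof (rule that[of "min \<rho> (exp (- L * T))"])
    fix a b assume a: "a \<in> X" and ab: "norm (b - a) < min \<rho> (exp (- L * T))"
    then have "b \<in> ball a \<rho>" by (simp add: dist_norm norm_minus_commute)
    then have "b \<in> U" using \<rho> a by blast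
    moreover have "norm (b - a) * exp (L * T) < exp (- L * T) * exp (L * T)"
      using ab by (intro mult_strict_right_mono) auto
    ultimately show "confined T b" using a T by (intro near_X_confined) (auto simp flip: exp_add)
  qed (use \<rho> in auto)
qed

text \<open>This replaces the variational equation, which is never solved. A linear combination of displacements whose
initial values cancel starts at zero and satisfies the linearised equation up to an error that is small by
uniform continuity of the derivative of \<open>f\<close>; hence it stays small.\<close>

lemma displacement_almost_linear:
  assumes T: "0 \<le> T" and \<eta>: "0 < \<eta>"
  obtains \<delta> where "0 < \<delta>"
    "\<And>a u v w \<alpha> \<beta> \<gamma>. \<lbrakk>a \<in> X; norm u < \<delta>; norm v < \<delta>; norm w < \<delta>;
        \<alpha> *\<^sub>R u + \<beta> *\<^sub>R v + \<gamma> *\<^sub>R w = 0\<rbrakk> \<Longrightarrow>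
       norm (\<alpha> *\<^sub>R (\<phi> T (a + u) - \<phi> T a) + \<beta> *\<^sub>R (\<phi> T (a + v) - \<phi> T a) + \<gamma> *\<^sub>R (\<phi> T (a + w) - \<phi> T a))
         \<le> \<eta> * (\<bar>\<alpha>\<bar> * norm u + \<bar>\<beta>\<bar> * norm v + \<bar>\<gamma>\<bar> * norm w)"
proof -
  obtain f' :: "'a \<Rightarrow> 'a \<Rightarrow>\<^sub>L 'a" where f': "\<And>x. (f has_derivative blinfun_apply (f' x)) (at x)"
    and cont: "continuous_on UNIV f'"
    using f unfolding continuously_differentiable_def by blast
  have "compact (f' ` cball 0 R)"
    by (intro compact_continuous_image continuous_on_subset[OF cont]) auto
  then obtain L' where L': "\<And>x. x \<in> cball 0 R \<Longrightarrow> norm (f' x) \<le> L'"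
    using compact_imp_bounded[of "f' ` cball 0 R"] unfolding bounded_iff by blast
  define \<Lambda> where "\<Lambda> = max L' 0"
  define K where "K = sqrt T * exp ((2 * \<Lambda> + 1) * T / 2)"
  have K0: "0 \<le> K" using T by (simp add: K_def)
  have Ksq: "T * exp ((2 * \<Lambda> + 1) * T) = K\<^sup>2"
    using T by (simp add: K_def power_mult_distrib flip: exp_double)
  \<comment> \<open>Gronwall turns an error with factor \<open>c * exp (L * T)\<close> into one with the additional factor \<open>K\<close>; the summand one avoids division by zero for \<open>T = 0\<close>.\<close>
  define c where "c = \<eta> / (K + 1) / exp (L * T)"
  have c0: "0 < c" using \<eta> K0 by (simp add: c_def)
  have cK: "c * exp (L * T) * (K + 1) = \<eta>" using K0 by (simp add: c_def)
  have "uniformly_continuous_on (cball 0 R) f'"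
    by (intro compact_uniformly_continuous continuous_on_subset[OF cont]) auto
  then obtain d where d: "0 < d"
    "\<And>x y. x \<in> cball 0 R \<Longrightarrow> y \<in> cball 0 R \<Longrightarrow> norm (y - x) < d \<Longrightarrow> norm (f' y - f' x) < c"
    using c0 unfolding uniformly_continuous_on_def dist_norm by blast
  have lin: "norm (f y - f x - f' x (y - x)) \<le> c * norm (y - x)"
    if "norm x \<le> R" "norm y \<le> R" "norm (y - x) < d" for x y
  proof -
    have "norm (f y - f x - f' x (y - x)) \<le> norm (y - x) * c"
    proof (rule differentiable_bound_linearization[where S = "closed_segment x y" and f' = "\<lambda>z. f' z" and ?x0.0 = x])
      show "x + t *\<^sub>R (y - x) \<in> closed_segment x y" if "t \<in> {0..1}" for t
        using that by (auto simp: closed_segment_def algebra_simps intro!: exI[of _ t])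
      show "(f has_derivative f' z) (at z within closed_segment x y)" for z
        by (rule has_derivative_at_withinI[OF f'])
      fix z assume z: "z \<in> closed_segment x y"
      have "closed_segment x y \<subseteq> cball 0 R"
        using that by (intro closed_segment_subset) auto
      with z have "z \<in> cball 0 R" by blast
      moreover have "norm (z - x) < d"
        using segment_bound(1)[OF z] that by (simp add: norm_minus_commute)
      ultimately have "norm (f' z - f' x) < c" using d(2) that by simp
      moreover have "blinfun_apply (f' z) - blinfun_apply (f' x) = blinfun_apply (f' z - f' x)"
        by (auto simp: blinfun.diff_left)
      ultimately show "onorm (blinfun_apply (f' z) - blinfun_apply (f' x)) \<le> c"
        by (simp add: norm_blinfun.rep_eq)
    qed simp
    then show ?thesis by (simp add: mult.commute)
  qed
  obtain r where r: "0 < r" "\<And>a b. a \<in> X \<Longrightarrow> norm (b - a) < r \<Longrightarrow> confined T b"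
    using near_X_confined_uniform[OF T] by metis
  define \<delta> where "\<delta> = min r (d / exp (L * T))"
  show ?thesis
  proof (rule that[of \<delta>])
    show "0 < \<delta>" using r d by (simp add: \<delta>_def)
    fix a u v w :: 'a and \<alpha> \<beta> \<gamma> :: real
    assume a: "a \<in> X" and small: "norm u < \<delta>" "norm v < \<delta>" "norm w < \<delta>"
      and zero: "\<alpha> *\<^sub>R u + \<beta> *\<^sub>R v + \<gamma> *\<^sub>R w = 0"
    define D where "D = (\<lambda>h \<tau>. \<phi> \<tau> (a + h) - \<phi> \<tau> a)"
    define D' where "D' = (\<lambda>h \<tau>. f (\<phi> \<tau> (a + h)) - f (\<phi> \<tau> a))"
    have aU: "a \<in> U" using a XU by auto
    have conf: "confined T (a + h)" if "norm h < \<delta>" for h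
      using r(2)[OF a, of "a + h"] that by (simp add: \<delta>_def)
    then have hU: "a + h \<in> U" if "norm h < \<delta>" for h using that by (auto simp: confined_def)
    have der: "(D h has_vector_derivative D' h \<tau>) (at \<tau> within {0..T})"
      if "norm h < \<delta>" "\<tau> \<in> {0..T}" for h \<tau>
      unfolding D_def D'_def
      by (rule ivp_solution_difference[OF flow_solution[OF aU T] flow_solution[OF hU[OF that(1)] T] that(2)])
    have D0: "D h 0 = h" if "norm h < \<delta>" for h
      using flow_0[OF aU] flow_0[OF hU[OF that]] by (simp add: D_def)
    have err: "norm (D' h \<tau> - f' (\<phi> \<tau> a) (D h \<tau>)) \<le> c * exp (L * T) * norm h"
      if h: "norm h < \<delta>" and \<tau>: "0 \<le> \<tau>" "\<tau> \<le> T" for h \<tau>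
    proof -
      have "norm (D h \<tau>) \<le> exp (L * \<tau>) * norm h"
        using confined_bounds(1)[OF confined_X[OF a] conf[OF h] \<tau>] by (simp add: D_def)
      also have "\<dots> \<le> exp (L * T) * norm h"
        using L0 \<tau> by (intro mult_right_mono) (auto intro: mult_left_mono)
      finally have D: "norm (D h \<tau>) \<le> exp (L * T) * norm h" .
      also have "\<dots> < exp (L * T) * (d / exp (L * T))"
        using h by (intro mult_strict_left_mono) (auto simp: \<delta>_def)
      finally have "norm (D h \<tau>) < d" by simp
      then have "norm (D' h \<tau> - f' (\<phi> \<tau> a) (D h \<tau>)) \<le> c * norm (D h \<tau>)"
        unfolding D_def D'_def
        using conf[OF h] confined_X[OF a, of T] \<tau> by (intro lin) (auto simp: confined_def)
      also have "\<dots> \<le> c * (exp (L * T) * norm h)" using D c0 by (intro mult_left_mono) auto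
      finally show ?thesis by (simp add: mult.assoc)
    qed
    define W where "W = (\<lambda>\<tau>. \<alpha> *\<^sub>R D u \<tau> + \<beta> *\<^sub>R D v \<tau> + \<gamma> *\<^sub>R D w \<tau>)"
    define W' where "W' = (\<lambda>\<tau>. \<alpha> *\<^sub>R D' u \<tau> + \<beta> *\<^sub>R D' v \<tau> + \<gamma> *\<^sub>R D' w \<tau>)"
    define N where "N = \<bar>\<alpha>\<bar> * norm u + \<bar>\<beta>\<bar> * norm v + \<bar>\<gamma>\<bar> * norm w"
    have N0: "0 \<le> N" by (simp add: N_def)
    have Wder: "(W has_vector_derivative W' \<tau>) (at \<tau> within {0..T})" if "\<tau> \<in> {0..T}" for \<tau>
      unfolding W_def W'_def
      by (intro has_vector_derivative_add bounded_linear.has_vector_derivative[OF bounded_linear_scaleR_right] der small that)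
    have W0: "W 0 = 0" using zero by (simp add: W_def D0 small)
    have Wle: "norm (W' \<tau>) \<le> \<Lambda> * norm (W \<tau>) + c * exp (L * T) * N" if \<tau>: "0 < \<tau>" "\<tau> < T" for \<tau>
    proof -
      let ?E = "\<lambda>h. D' h \<tau> - f' (\<phi> \<tau> a) (D h \<tau>)"
      have scaled: "norm (k *\<^sub>R ?E h) \<le> \<bar>k\<bar> * (c * exp (L * T) * norm h)" if "norm h < \<delta>" for h k
        using mult_left_mono[OF err[OF that], of \<tau> "\<bar>k\<bar>"] \<tau> by simp
      have "norm (\<phi> \<tau> a) \<le> R" using confined_X[OF a, of T] \<tau> by (auto simp: confined_def)
      then have "norm (f' (\<phi> \<tau> a)) \<le> \<Lambda>" using L'[of "\<phi> \<tau> a"] by (simp add: \<Lambda>_def)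
      then have lin_part: "norm (f' (\<phi> \<tau> a) (W \<tau>)) \<le> \<Lambda> * norm (W \<tau>)"
        by (intro order_trans[OF norm_blinfun] mult_right_mono) auto
      have split: "W' \<tau> = f' (\<phi> \<tau> a) (W \<tau>) + (\<alpha> *\<^sub>R ?E u + \<beta> *\<^sub>R ?E v + \<gamma> *\<^sub>R ?E w)"
        by (simp add: W_def W'_def blinfun.add_right blinfun.scaleR_right algebra_simps)
      have "norm (W' \<tau>) \<le> norm (f' (\<phi> \<tau> a) (W \<tau>)) + (norm (\<alpha> *\<^sub>R ?E u) + norm (\<beta> *\<^sub>R ?E v) + norm (\<gamma> *\<^sub>R ?E w))"
        unfolding split by (intro norm_triangle_le add_mono order.refl norm_triangle_ineq)
      also have "\<dots> \<le> \<Lambda> * norm (W \<tau>) + (\<bar>\<alpha>\<bar> * (c * exp (L * T) * norm u) + \<bar>\<beta>\<bar> * (c * exp (L * T) * norm v)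
          + \<bar>\<gamma>\<bar> * (c * exp (L * T) * norm w))"
        using lin_part scaled[OF small(1), of \<alpha>] scaled[OF small(2), of \<beta>] scaled[OF small(3), of \<gamma>]
        by linarith
      finally show ?thesis by (simp add: N_def algebra_simps)
    qed
    have "(norm (W T))\<^sup>2 \<le> ((norm (W 0))\<^sup>2 + (c * exp (L * T) * N)\<^sup>2 * T) * exp ((2 * \<Lambda> + 1) * T)"
      by (rule gronwall_inhomogeneous[OF Wder Wle]) (use T in \<open>auto simp: \<Lambda>_def\<close>)
    also have "\<dots> = (c * exp (L * T) * N)\<^sup>2 * (T * exp ((2 * \<Lambda> + 1) * T))"
      by (simp add: W0)
    also have "\<dots> = (c * exp (L * T) * N * K)\<^sup>2" by (simp only: Ksq power_mult_distrib)
    finally have "norm (W T) \<le> c * exp (L * T) * N * K"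
      by (rule power2_le_imp_le) (intro mult_nonneg_nonneg less_imp_le[OF c0] N0 K0 exp_ge_zero)
    also have "\<dots> \<le> c * exp (L * T) * N * (K + 1)"
      by (intro mult_left_mono mult_nonneg_nonneg less_imp_le[OF c0] N0 exp_ge_zero) simp
    also have "\<dots> = c * exp (L * T) * (K + 1) * N" by (simp only: mult_ac)
    also have "\<dots> = \<eta> * N" by (simp only: cK)
    finally show "norm (\<alpha> *\<^sub>R (\<phi> T (a + u) - \<phi> T a) + \<beta> *\<^sub>R (\<phi> T (a + v) - \<phi> T a) + \<gamma> *\<^sub>R (\<phi> T (a + w) - \<phi> T a))
         \<le> \<eta> * (\<bar>\<alpha>\<bar> * norm u + \<bar>\<beta>\<bar> * norm v + \<bar>\<gamma>\<bar> * norm w)"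
      by (simp only: W_def D_def N_def)
  qed
qed

end

section \<open>Derivatives from almost linear displacements\<close>

text \<open>Combinations of three vectors cover at once homogeneity, additivity and the comparison of two difference
quotients in the same direction.\<close>

definition almost_linear :: "real \<Rightarrow> real \<Rightarrow> ('a::real_normed_vector \<Rightarrow> 'b::real_normed_vector) \<Rightarrow> bool" where
  "almost_linear \<eta> \<delta> g \<longleftrightarrow> (\<forall>u v w \<alpha> \<beta> \<gamma>. norm u < \<delta> \<and> norm v < \<delta> \<and> norm w < \<delta> \<and>
     \<alpha> *\<^sub>R u + \<beta> *\<^sub>R v + \<gamma> *\<^sub>R w = 0 \<longrightarrow>
     norm (\<alpha> *\<^sub>R g u + \<beta> *\<^sub>R g v + \<gamma> *\<^sub>R g w) \<le> \<eta> * (\<bar>\<alpha>\<bar> * norm u + \<bar>\<beta>\<bar> * norm v + \<bar>\<gamma>\<bar> * norm w))"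

lemma zero_if_below_all_multiples:
  fixes x :: "'a::real_normed_vector"
  assumes "\<And>\<eta>. 0 < \<eta> \<Longrightarrow> norm x \<le> \<eta> * N"
  shows "x = 0"
proof (rule ccontr)
  assume "x \<noteq> 0"
  then have p: "0 < norm x" by simp
  have N: "0 < N" using assms[of 1] p by linarith
  have "norm x \<le> norm x / (2 * N) * N" using assms[of "norm x / (2 * N)"] p N by simp
  then show False using p N by simp
qed

text \<open>\<open>A v\<close> is the limit of the difference quotients \<open>n * g (v / n)\<close>. They form a Cauchy sequence, and the limit is
linear, by almost linearity itself. The approximation error is controlled by the same \<open>\<eta>\<close> and \<open>\<delta>\<close> as the
almost linearity, so a uniform choice of these for many maps \<open>g\<close> gives uniform differentiability.\<close>

lemma almost_linear_approximation:
  fixes g :: "'a::real_normed_vector \<Rightarrow> 'b::banach"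
  assumes al: "\<And>\<eta>. 0 < \<eta> \<Longrightarrow> \<exists>\<delta>>0. almost_linear \<eta> \<delta> g"
  obtains A where "linear A"
    "\<And>\<eta> \<delta> v. \<lbrakk>0 < \<delta>; almost_linear \<eta> \<delta> g; norm v < \<delta>\<rbrakk> \<Longrightarrow> norm (g v - A v) \<le> \<eta> * (2 * norm v)"
proof -
  define q where "q = (\<lambda>n v. real (Suc n) *\<^sub>R g ((1 / real (Suc n)) *\<^sub>R v))"
  have step: "norm (q n v - q m v) \<le> \<eta> * (2 * norm v)"
    if "almost_linear \<eta> \<delta> g" "norm v < \<delta> * real (Suc n)" "norm v < \<delta> * real (Suc m)" "0 < \<delta>" for \<eta> \<delta> n m v
  proof -
    have "norm ((1 / real (Suc n)) *\<^sub>R v) < \<delta>" "norm ((1 / real (Suc m)) *\<^sub>R v) < \<delta>"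
      using that by (simp_all add: divide_simps mult.commute)
    moreover have "real (Suc n) *\<^sub>R (1 / real (Suc n)) *\<^sub>R v + (- real (Suc m)) *\<^sub>R (1 / real (Suc m)) *\<^sub>R v + 0 *\<^sub>R 0 = 0"
      by (simp del: of_nat_Suc)
    ultimately have "norm (real (Suc n) *\<^sub>R g ((1 / real (Suc n)) *\<^sub>R v) + (- real (Suc m)) *\<^sub>R g ((1 / real (Suc m)) *\<^sub>R v) + 0 *\<^sub>R g 0)
      \<le> \<eta> * (\<bar>real (Suc n)\<bar> * norm ((1 / real (Suc n)) *\<^sub>R v) + \<bar>- real (Suc m)\<bar> * norm ((1 / real (Suc m)) *\<^sub>R v) + \<bar>0\<bar> * norm (0::'a))"
      using that(1,4) unfolding almost_linear_def by (metis norm_zero)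
    then show ?thesis by (simp add: q_def del: of_nat_Suc)
  qed
  have large: "\<exists>N. \<forall>n\<ge>N. norm v < \<delta> * real (Suc n)" if "0 < \<delta>" for v :: 'a and \<delta> :: real
  proof -
    obtain N where "norm v / \<delta> < real N" using reals_Archimedean2 by blast
    then have N: "norm v < \<delta> * real N" using that by (simp add: field_simps)
    have "norm v < \<delta> * real (Suc n)" if "N \<le> n" for n
    proof -
      have "\<delta> * real N \<le> \<delta> * real (Suc n)" using \<open>0 < \<delta>\<close> that by (intro mult_left_mono) auto
      with N show ?thesis by linarith
    qed
    then show ?thesis by blast
  qed
  have "Cauchy (\<lambda>n. q n v)" for v
  proof (rule CauchyI)
    fix e :: real assume e: "0 < e"
    define \<eta> where "\<eta> = e / (2 * norm v + 1)"
    have "0 < 2 * norm v + 1" by (intro add_nonneg_pos) auto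
    then have \<eta>: "0 < \<eta>" "\<eta> * (2 * norm v) < e" using e by (simp_all add: \<eta>_def field_simps)
    obtain \<delta> where \<delta>: "0 < \<delta>" "almost_linear \<eta> \<delta> g" using al[OF \<eta>(1)] by auto
    obtain N where "\<forall>n\<ge>N. norm v < \<delta> * real (Suc n)" using large[OF \<delta>(1)] by blast
    then have "\<forall>m\<ge>N. \<forall>n\<ge>N. norm (q m v - q n v) < e"
      using step[OF \<delta>(2) _ _ \<delta>(1)] \<eta>(2) by (meson le_less_trans)
    then show "\<exists>M. \<forall>m\<ge>M. \<forall>n\<ge>M. norm (q m v - q n v) < e" by blast
  qed
  then have "\<forall>v. \<exists>l. (\<lambda>n. q n v) \<longlonglongrightarrow> l"
    using Cauchy_convergent convergent_def by blast
  then obtain A where A: "\<And>v. (\<lambda>n. q n v) \<longlonglongrightarrow> A v" by metis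
  have combination: "\<alpha> *\<^sub>R A u + \<beta> *\<^sub>R A v + \<gamma> *\<^sub>R A w = 0"
    if zero: "\<alpha> *\<^sub>R u + \<beta> *\<^sub>R v + \<gamma> *\<^sub>R w = 0" for u v w \<alpha> \<beta> \<gamma>
  proof (rule zero_if_below_all_multiples)
    fix \<eta> :: real assume "0 < \<eta>"
    then obtain \<delta> where \<delta>: "0 < \<delta>" "almost_linear \<eta> \<delta> g" using al by blast
    let ?N = "\<bar>\<alpha>\<bar> * norm u + \<bar>\<beta>\<bar> * norm v + \<bar>\<gamma>\<bar> * norm w"
    obtain N1 N2 N3 where N: "\<forall>n\<ge>N1. norm u < \<delta> * real (Suc n)" "\<forall>n\<ge>N2. norm v < \<delta> * real (Suc n)"
      "\<forall>n\<ge>N3. norm w < \<delta> * real (Suc n)" using large[OF \<delta>(1)] by metis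
    have "norm (\<alpha> *\<^sub>R q n u + \<beta> *\<^sub>R q n v + \<gamma> *\<^sub>R q n w) \<le> \<eta> * ?N"
      if n: "max N1 (max N2 N3) \<le> n" for n
    proof -
      let ?c = "real (Suc n)"
      have c: "0 < ?c" by simp
      have "norm ((1 / ?c) *\<^sub>R u) < \<delta>" "norm ((1 / ?c) *\<^sub>R v) < \<delta>" "norm ((1 / ?c) *\<^sub>R w) < \<delta>"
        using N n by (simp_all add: divide_simps mult.commute)
      moreover have "(\<alpha> * ?c) *\<^sub>R (1 / ?c) *\<^sub>R u + (\<beta> * ?c) *\<^sub>R (1 / ?c) *\<^sub>R v + (\<gamma> * ?c) *\<^sub>R (1 / ?c) *\<^sub>R w = 0"
        using zero by (simp del: of_nat_Suc)
      ultimately have "norm ((\<alpha> * ?c) *\<^sub>R g ((1 / ?c) *\<^sub>R u) + (\<beta> * ?c) *\<^sub>R g ((1 / ?c) *\<^sub>R v) + (\<gamma> * ?c) *\<^sub>R g ((1 / ?c) *\<^sub>R w))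
        \<le> \<eta> * (\<bar>\<alpha> * ?c\<bar> * norm ((1 / ?c) *\<^sub>R u) + \<bar>\<beta> * ?c\<bar> * norm ((1 / ?c) *\<^sub>R v) + \<bar>\<gamma> * ?c\<bar> * norm ((1 / ?c) *\<^sub>R w))"
        using \<delta>(2) unfolding almost_linear_def by blast
      then show ?thesis by (simp add: q_def abs_mult del: of_nat_Suc)
    qed
    moreover have "(\<lambda>n. norm (\<alpha> *\<^sub>R q n u + \<beta> *\<^sub>R q n v + \<gamma> *\<^sub>R q n w)) \<longlonglongrightarrow> norm (\<alpha> *\<^sub>R A u + \<beta> *\<^sub>R A v + \<gamma> *\<^sub>R A w)"
      by (intro tendsto_intros A)
    ultimately show "norm (\<alpha> *\<^sub>R A u + \<beta> *\<^sub>R A v + \<gamma> *\<^sub>R A w) \<le> \<eta> * ?N"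
      by (meson LIMSEQ_le_const2)
  qed
  show ?thesis
  proof (rule that[of A])
    show "linear A"
    proof (rule linearI)
      show "A (u + v) = A u + A v" for u v
        using combination[of 1 "u + v" "- 1" u "- 1" v] by (simp add: algebra_simps)
      show "A (c *\<^sub>R u) = c *\<^sub>R A u" for c u
        using combination[of 1 "c *\<^sub>R u" "- c" u 0 0] by (simp add: algebra_simps)
    qed
  next
    fix \<eta> \<delta> :: real and v :: 'a
    assume \<delta>: "0 < \<delta>" "almost_linear \<eta> \<delta> g" and v: "norm v < \<delta>"
    obtain N where "\<forall>n\<ge>N. norm v < \<delta> * real (Suc n)" using large[OF \<delta>(1)] by blast
    then have "\<forall>n\<ge>N. norm (q 0 v - q n v) \<le> \<eta> * (2 * norm v)"
      using step[OF \<delta>(2) _ _ \<delta>(1), of v 0] v by auto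
    moreover have "(\<lambda>n. norm (q 0 v - q n v)) \<longlonglongrightarrow> norm (q 0 v - A v)"
      by (intro tendsto_intros A)
    ultimately have "norm (q 0 v - A v) \<le> \<eta> * (2 * norm v)"
      by (meson LIMSEQ_le_const2)
    then show "norm (g v - A v) \<le> \<eta> * (2 * norm v)" by (simp add: q_def)
  qed
qed

context invariant_flow
begin

abbreviation D :: "real \<Rightarrow> 'a \<Rightarrow> 'a \<Rightarrow> 'a" where
  "D T a \<equiv> frechet_derivative (\<phi> T) (at a)"

lemma flow_derivative:
  assumes T: "0 \<le> T"
  shows flow_has_derivative: "\<And>a. a \<in> X \<Longrightarrow> (\<phi> T has_derivative D T a) (at a)"
    and flow_uniform_expansion: "\<And>\<eta>. 0 < \<eta> \<Longrightarrow>
      \<exists>\<delta>>0. \<forall>a\<in>X. \<forall>h. norm h < \<delta> \<longrightarrow> norm (\<phi> T (a + h) - \<phi> T a - D T a h) \<le> \<eta> * norm h"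
proof -
  define g where "g = (\<lambda>a h. \<phi> T (a + h) - \<phi> T a)"
  have al: "\<exists>\<delta>>0. \<forall>a\<in>X. almost_linear \<eta> \<delta> (g a)" if \<eta>: "0 < \<eta>" for \<eta>
    using displacement_almost_linear[OF T \<eta>] unfolding almost_linear_def g_def by metis
  have "\<exists>A. linear A \<and> (\<forall>\<eta> \<delta> v. 0 < \<delta> \<and> almost_linear \<eta> \<delta> (g a) \<and> norm v < \<delta> \<longrightarrow> norm (g a v - A v) \<le> \<eta> * (2 * norm v))"
    if a: "a \<in> X" for a
  proof -
    have "\<exists>\<delta>>0. almost_linear \<eta> \<delta> (g a)" if "0 < \<eta>" for \<eta> using al[OF that] a by blast
    then show ?thesis by (rule almost_linear_approximation[of "g a"]) blast+
  qed
  then obtain A where A: "\<And>a. a \<in> X \<Longrightarrow> linear (A a)"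
    "\<And>a \<eta> \<delta> v. a \<in> X \<Longrightarrow> 0 < \<delta> \<Longrightarrow> almost_linear \<eta> \<delta> (g a) \<Longrightarrow> norm v < \<delta> \<Longrightarrow> norm (g a v - A a v) \<le> \<eta> * (2 * norm v)"
    by metis
  have uniform: "\<exists>\<delta>>0. \<forall>a\<in>X. \<forall>h. norm h < \<delta> \<longrightarrow> norm (\<phi> T (a + h) - \<phi> T a - A a h) \<le> \<eta> * norm h"
    if \<eta>: "0 < \<eta>" for \<eta>
  proof -
    have "0 < \<eta> / 2" using \<eta> by simp
    then obtain \<delta> where \<delta>: "0 < \<delta>" "\<forall>a\<in>X. almost_linear (\<eta> / 2) \<delta> (g a)" using al by blast
    have "norm (\<phi> T (a + h) - \<phi> T a - A a h) \<le> \<eta> * norm h" if "a \<in> X" "norm h < \<delta>" for a h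
      using A(2)[OF that(1) \<delta>(1) \<delta>(2)[rule_format, OF that(1)] that(2)] by (simp add: g_def)
    with \<delta>(1) show ?thesis by blast
  qed
  have der: "(\<phi> T has_derivative A a) (at a)" if a: "a \<in> X" for a
    unfolding has_derivative_at_alt
  proof (intro conjI allI impI)
    show "bounded_linear (A a)" using A(1)[OF a] by (rule linear_conv_bounded_linear[THEN iffD1])
    fix e :: real assume "0 < e"
    then obtain \<delta> where \<delta>: "0 < \<delta>" "\<forall>a\<in>X. \<forall>h. norm h < \<delta> \<longrightarrow> norm (\<phi> T (a + h) - \<phi> T a - A a h) \<le> e * norm h"
      using uniform by blast
    have "norm (\<phi> T y - \<phi> T a - A a (y - a)) \<le> e * norm (y - a)" if "norm (y - a) < \<delta>" for y
      using \<delta>(2)[rule_format, OF a that] by simp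
    with \<delta>(1) show "\<exists>d>0. \<forall>y. norm (y - a) < d \<longrightarrow> norm (\<phi> T y - \<phi> T a - A a (y - a)) \<le> e * norm (y - a)"
      by blast
  qed
  have eq: "D T a = A a" if "a \<in> X" for a
    using frechet_derivative_at[OF der[OF that]] by simp
  show "(\<phi> T has_derivative D T a) (at a)" if "a \<in> X" for a
    using der[OF that] eq[OF that] by simp
  show "\<exists>\<delta>>0. \<forall>a\<in>X. \<forall>h. norm h < \<delta> \<longrightarrow> norm (\<phi> T (a + h) - \<phi> T a - D T a h) \<le> \<eta> * norm h"
    if "0 < \<eta>" for \<eta>
    using uniform[OF that] by (simp add: eq)
qed

lemma linear_D: "0 \<le> T \<Longrightarrow> a \<in> X \<Longrightarrow> linear (D T a)"
  using flow_has_derivative has_derivative_linear by blast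

text \<open>Infinitesimal form of the two-sided distance estimate \<open>confined_bounds\<close>. The lower bound makes the derivative
invertible.\<close>

lemma D_bounds:
  assumes T: "0 \<le> T" and a: "a \<in> X"
  shows "norm (D T a v) \<le> exp (L * T) * norm v" "exp (- L * T) * norm v \<le> norm (D T a v)"
proof -
  have main: "norm (D T a v) \<le> (exp (L * T) + \<eta>) * norm v \<and> (exp (- L * T) - \<eta>) * norm v \<le> norm (D T a v)"
    if \<eta>: "0 < \<eta>" for \<eta>
  proof -
    obtain d1 where d1: "0 < d1" "\<forall>a\<in>X. \<forall>h. norm h < d1 \<longrightarrow> norm (\<phi> T (a + h) - \<phi> T a - D T a h) \<le> \<eta> * norm h"
      using flow_uniform_expansion[OF T \<eta>] by blast
    obtain d2 where d2: "0 < d2" "\<And>a b. a \<in> X \<Longrightarrow> norm (b - a) < d2 \<Longrightarrow> confined T b"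
      using near_X_confined_uniform[OF T] by metis
    define t where "t = min d1 d2 / (norm v + 1)"
    have v1: "0 < norm v + 1" by (intro add_nonneg_pos) auto
    then have t: "0 < t" using d1 d2 by (simp add: t_def)
    have "t * norm v < t * (norm v + 1)" using t by simp
    also have "\<dots> = min d1 d2" using v1 by (simp add: t_def)
    finally have tv: "norm (t *\<^sub>R v) < min d1 d2" using t by simp
    let ?g = "\<phi> T (a + t *\<^sub>R v) - \<phi> T a"
    have "norm (?g - D T a (t *\<^sub>R v)) \<le> \<eta> * norm (t *\<^sub>R v)" 
      using d1(2)[rule_format, OF a, of "t *\<^sub>R v"] tv by simp
    then have 1: "norm (?g - t *\<^sub>R D T a v) \<le> t * (\<eta> * norm v)"
      using t by (simp add: linear_cmul[OF linear_D[OF T a]] mult.left_commute)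
    have c: "confined T (a + t *\<^sub>R v)" using d2(2)[OF a] tv by simp
    have 2: "norm ?g \<le> t * (exp (L * T) * norm v)" "t * (exp (- L * T) * norm v) \<le> norm ?g"
      using confined_bounds[OF confined_X[OF a] c T order.refl] t by (simp_all add: mult.left_commute)
    have "t * norm (D T a v) \<le> t * ((exp (L * T) + \<eta>) * norm v)"
      using norm_triangle_ineq2[of "t *\<^sub>R D T a v" ?g] 1 2(1) t
      by (simp add: norm_minus_commute algebra_simps)
    moreover have "t * ((exp (- L * T) - \<eta>) * norm v) \<le> t * norm (D T a v)"
      using norm_triangle_ineq2[of ?g "t *\<^sub>R D T a v"] 1 2(2) t by (simp add: algebra_simps)
    ultimately show ?thesis using t by simp
  qed
  show "norm (D T a v) \<le> exp (L * T) * norm v"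
  proof (rule field_le_epsilon)
    fix e :: real assume e: "0 < e"
    have v1: "0 < norm v + 1" by (intro add_nonneg_pos) auto
    have "e / (norm v + 1) * norm v \<le> e" using e v1 by (simp add: field_simps)
    then show "norm (D T a v) \<le> exp (L * T) * norm v + e"
      using main[of "e / (norm v + 1)"] e v1 by (simp add: distrib_right)
  qed
  show "exp (- L * T) * norm v \<le> norm (D T a v)"
  proof (rule field_le_epsilon)
    fix e :: real assume e: "0 < e"
    have v1: "0 < norm v + 1" by (intro add_nonneg_pos) auto
    have "e / (norm v + 1) * norm v \<le> e" using e v1 by (simp add: field_simps)
    then show "exp (- L * T) * norm v \<le> norm (D T a v) + e"
      using main[of "e / (norm v + 1)"] e v1 by (simp add: left_diff_distrib)
  qed
qed

text \<open>By the uniform expansion, \<open>D T a\<close> is within \<open>\<eta> / 4\<close> of the difference quotients of \<open>\<phi> T\<close> at \<open>a\<close> with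
displacements of a fixed length \<open>r\<close>, and these depend continuously on \<open>a\<close>.\<close>

lemma D_uniformly_continuous:
  assumes T: "0 \<le> T" and \<eta>: "0 < \<eta>"
  obtains \<delta> where "0 < \<delta>" "\<And>a b v. \<lbrakk>a \<in> X; b \<in> X; norm (b - a) < \<delta>\<rbrakk> \<Longrightarrow> norm (D T b v - D T a v) \<le> \<eta> * norm v"
proof -
  have "0 < \<eta> / 4" using \<eta> by simp
  then obtain d1 where d1: "0 < d1" "\<forall>a\<in>X. \<forall>h. norm h < d1 \<longrightarrow> norm (\<phi> T (a + h) - \<phi> T a - D T a h) \<le> \<eta> / 4 * norm h"
    using flow_uniform_expansion[OF T] by blast
  obtain d2 where d2: "0 < d2" "\<And>a b. a \<in> X \<Longrightarrow> norm (b - a) < d2 \<Longrightarrow> confined T b"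
    using near_X_confined_uniform[OF T] by metis
  define r where "r = min d1 d2 / 2"
  have r: "0 < r" "r < d1" "r < d2" using d1 d2 by (auto simp: r_def)
  have four: "norm (p - q + x - y) \<le> norm p + norm q + norm x + norm y" for p q x y :: 'a
    using norm_triangle_ineq4[of "p - q + x" y] norm_triangle_ineq[of "p - q" x] norm_triangle_ineq4[of p q]
    by linarith
  show ?thesis
  proof (rule that[of "\<eta> * r / (4 * exp (L * T))"])
    show "0 < \<eta> * r / (4 * exp (L * T))" using \<eta> r by simp
    fix a b v assume a: "a \<in> X" and b: "b \<in> X" and ab: "norm (b - a) < \<eta> * r / (4 * exp (L * T))"
    show "norm (D T b v - D T a v) \<le> \<eta> * norm v"
    proof (cases "v = 0")
      case True
      then show ?thesis using linear_0[OF linear_D[OF T]] a b by simp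
    next
      case False
      define c where "c = r / norm v"
      have c: "0 < c" "norm (c *\<^sub>R v) = r" using False r by (auto simp: c_def)
      let ?h = "c *\<^sub>R v"
      have "confined T (a + ?h)" "confined T (b + ?h)"
        using d2(2)[OF a, of "a + ?h"] d2(2)[OF b, of "b + ?h"] c(2) r by simp_all
      then have "norm (\<phi> T (b + ?h) - \<phi> T (a + ?h)) \<le> exp (L * T) * norm (b - a)"
        using confined_bounds(1)[OF _ _ T order.refl, of "a + ?h" "b + ?h"] by simp
      moreover have "norm (\<phi> T b - \<phi> T a) \<le> exp (L * T) * norm (b - a)"
        using confined_bounds(1)[OF confined_X[OF a] confined_X[OF b] T order.refl] .
      moreover have "exp (L * T) * norm (b - a) \<le> \<eta> / 4 * r"
        using mult_left_mono[OF less_imp_le[OF ab], of "exp (L * T)"] by simp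
      moreover have "norm (\<phi> T (a + ?h) - \<phi> T a - D T a ?h) \<le> \<eta> / 4 * r"
        "norm (\<phi> T (b + ?h) - \<phi> T b - D T b ?h) \<le> \<eta> / 4 * r"
        using d1(2)[rule_format, OF a, of ?h] d1(2)[rule_format, OF b, of ?h] c(2) r by simp_all
      moreover have split: "D T b ?h - D T a ?h = (\<phi> T (b + ?h) - \<phi> T (a + ?h)) - (\<phi> T b - \<phi> T a)
          + (\<phi> T (a + ?h) - \<phi> T a - D T a ?h) - (\<phi> T (b + ?h) - \<phi> T b - D T b ?h)"
        by simp
      have "norm (D T b ?h - D T a ?h) \<le> norm (\<phi> T (b + ?h) - \<phi> T (a + ?h)) + norm (\<phi> T b - \<phi> T a)
          + norm (\<phi> T (a + ?h) - \<phi> T a - D T a ?h) + norm (\<phi> T (b + ?h) - \<phi> T b - D T b ?h)"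
        unfolding split by (rule four)
      ultimately have "norm (D T b ?h - D T a ?h) \<le> \<eta> * r" by linarith
      moreover have "D T b ?h - D T a ?h = c *\<^sub>R (D T b v - D T a v)"
        using linear_cmul[OF linear_D[OF T]] a b by (simp add: scaleR_right_diff_distrib)
      ultimately have "c * norm (D T b v - D T a v) \<le> c * (\<eta> * norm v)"
        using c False by (simp add: c_def mult.commute)
      then show ?thesis using c by simp
    qed
  qed
qed

lemma D_cocycle:
  assumes s: "0 \<le> s" and t: "0 \<le> t" and a: "a \<in> X"
  shows "D (s + t) a = D t (\<phi> s a) \<circ> D s a"
proof -
  have "(\<phi> t \<circ> \<phi> s has_derivative D t (\<phi> s a) \<circ> D s a) (at a)"
    using flow_has_derivative[OF s a] flow_has_derivative[OF t flow_in_X[OF a s]] by (rule diff_chain_at)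
  then have "(\<phi> (s + t) has_derivative D t (\<phi> s a) \<circ> D s a) (at a)"
  proof (rule has_derivative_transform_within_open[OF _ openU])
    show "a \<in> U" using a XU by auto
    show "(\<phi> t \<circ> \<phi> s) b = \<phi> (s + t) b" if "b \<in> U" for b
      using flow_add[OF that s t] by simp
  qed
  then show ?thesis by (rule frechet_derivative_at[symmetric])
qed

end

section \<open>Orthonormal frames and the singular value decomposition\<close>

text \<open>Frames are indexed by natural numbers and not by \<open>'n\<close>, so that their vectors can follow the decreasing order
of the singular values.\<close>

definition orthonormal_frame :: "(nat \<Rightarrow> real^'n) \<Rightarrow> bool" where
  "orthonormal_frame u \<longleftrightarrow> (\<forall>i<CARD('n). \<forall>j<CARD('n). u i \<bullet> u j = (if i = j then 1 else 0))"

lemma frame_expansion: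
  fixes u :: "nat \<Rightarrow> real^'n"
  assumes u: "orthonormal_frame u"
  shows "(\<Sum>i<CARD('n). (x \<bullet> u i) *\<^sub>R u i) = x"
proof -
  let ?B = "u ` {..<CARD('n)}"
  have inj: "inj_on u {..<CARD('n)}"
    using u unfolding orthonormal_frame_def inj_on_def by (metis lessThan_iff zero_neq_one)
  have po: "pairwise orthogonal ?B"
    using u unfolding orthonormal_frame_def pairwise_def orthogonal_def by fastforce
  have one: "norm b = 1" if "b \<in> ?B" for b
    using that u by (auto simp: orthonormal_frame_def norm_eq_sqrt_inner)
  then have "0 \<notin> ?B" by force
  then have "independent ?B" using po by (rule pairwise_orthogonal_independent[rotated])
  then have "UNIV \<subseteq> span ?B"
    by (rule card_ge_dim_independent[rotated]) (simp_all add: card_image[OF inj])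
  then have "(\<Sum>b\<in>?B. (x \<bullet> b) *\<^sub>R b) = x"
    using orthonormal_basis_expand[OF po one] by auto
  then show ?thesis by (simp add: sum.reindex[OF inj])
qed

lemma frame_norm_le:
  fixes u :: "nat \<Rightarrow> real^'n"
  assumes u: "orthonormal_frame u"
  shows "norm x \<le> (\<Sum>i<CARD('n). \<bar>x \<bullet> u i\<bar>)"
proof -
  have "norm (\<Sum>i<CARD('n). (x \<bullet> u i) *\<^sub>R u i) \<le> (\<Sum>i<CARD('n). norm ((x \<bullet> u i) *\<^sub>R u i))"
    by (rule norm_sum)
  also have "\<dots> = (\<Sum>i<CARD('n). \<bar>x \<bullet> u i\<bar>)"
    using u by (intro sum.cong) (auto simp: orthonormal_frame_def norm_eq_sqrt_inner)
  finally show ?thesis by (simp add: frame_expansion[OF u])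
qed

lemma frame_norm: "orthonormal_frame (u :: nat \<Rightarrow> real^'n) \<Longrightarrow> i < CARD('n) \<Longrightarrow> norm (u i) = 1"
  by (simp add: orthonormal_frame_def norm_eq_sqrt_inner)

lemma frame_coordinate:
  fixes u :: "nat \<Rightarrow> real^'n"
  assumes u: "orthonormal_frame u" and "j < CARD('n)" "k \<le> CARD('n)"
  shows "(\<Sum>i<k. c i *\<^sub>R u i) \<bullet> u j = (if j < k then c j else 0)"
proof -
  have "(\<Sum>i<k. c i *\<^sub>R u i) \<bullet> u j = (\<Sum>i<k. c i * (u i \<bullet> u j))"
    by (simp add: inner_sum_left)
  also have "\<dots> = (\<Sum>i<k. if i = j then c i else 0)"
    using assms by (intro sum.cong) (auto simp: orthonormal_frame_def)
  finally show ?thesis by simp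
qed

text \<open>Spectral theorem. A maximiser \<open>e\<close> of the quadratic form on the unit sphere of the orthogonal complement \<open>S\<close> of
the eigenvectors found so far is the next one: \<open>S\<close> is invariant, and the quadratic form could be increased in
the direction \<open>M *v e - m *\<^sub>R e\<close> if this vector of \<open>S\<close> were not zero.\<close>

lemma symmetric_eigenvectors:
  fixes M :: "real^'n^'n"
  assumes sym: "\<And>x y. x \<bullet> (M *v y) = (M *v x) \<bullet> y"
  shows "k \<le> CARD('n) \<Longrightarrow> \<exists>v \<mu>. (\<forall>i<k. \<forall>j<k. v i \<bullet> v j = (if i = j then 1 else 0)) \<and> (\<forall>i<k. M *v v i = \<mu> i *\<^sub>R v i)"
proof (induction k)
  case (Suc k)
  then obtain v \<mu> where v: "\<And>i j. i < k \<Longrightarrow> j < k \<Longrightarrow> v i \<bullet> v j = (if i = j then 1 else 0)"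
    and \<mu>: "\<And>i. i < k \<Longrightarrow> M *v v i = \<mu> i *\<^sub>R v i" by auto
  define S where "S = {x. \<forall>i<k. x \<bullet> v i = 0}"
  have "dim (v ` {..<k}) \<le> card (v ` {..<k})" by (rule dim_le_card') simp
  also have "\<dots> \<le> k" using card_image_le[of "{..<k}" v] by simp
  also have "\<dots> < DIM(real^'n)" using Suc.prems by simp
  finally obtain x where x: "x \<noteq> 0" "\<And>y. y \<in> span (v ` {..<k}) \<Longrightarrow> orthogonal x y"
    using orthogonal_to_subspace_exists by blast
  have xS: "x \<in> S" using x(2) span_base[of _ "v ` {..<k}"] by (auto simp: S_def orthogonal_def)
  have Sscale: "c *\<^sub>R y \<in> S" if "y \<in> S" for c y using that by (simp add: S_def)
  have Sadd: "y + z \<in> S" if "y \<in> S" "z \<in> S" for y z using that by (simp add: S_def inner_add_left)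
  have "closed (\<Inter>i\<in>{..<k}. {x. v i \<bullet> x = 0})" by (intro closed_INT ballI closed_hyperplane)
  also have "(\<Inter>i\<in>{..<k}. {x. v i \<bullet> x = 0}) = S" by (auto simp: S_def inner_commute)
  finally have comp: "compact (sphere 0 1 \<inter> S)" by (simp add: compact_Int_closed)
  have "(1 / norm x) *\<^sub>R x \<in> sphere 0 1 \<inter> S"
    using Sscale[OF xS, of "1 / norm x"] x(1) by simp
  then have ne: "sphere 0 1 \<inter> S \<noteq> {}" by blast
  have "continuous_on (sphere 0 1 \<inter> S) (\<lambda>x. x \<bullet> (M *v x))"
    by (intro continuous_intros matrix_vector_mult_linear_continuous_on)
  then have "\<exists>e\<in>sphere 0 1 \<inter> S. \<forall>y\<in>sphere 0 1 \<inter> S. y \<bullet> (M *v y) \<le> e \<bullet> (M *v e)"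
    by (rule continuous_attains_sup[OF comp ne])
  then obtain e where e: "norm e = 1" "e \<in> S"
    and max1: "\<And>y. norm y = 1 \<Longrightarrow> y \<in> S \<Longrightarrow> y \<bullet> (M *v y) \<le> e \<bullet> (M *v e)" by auto
  define m where "m = e \<bullet> (M *v e)"
  have max: "y \<bullet> (M *v y) \<le> m * (y \<bullet> y)" if y: "y \<in> S" for y
  proof (cases "y = 0")
    case False
    let ?z = "(1 / norm y) *\<^sub>R y"
    have "?z \<bullet> (M *v ?z) \<le> m" using max1[of ?z] Sscale[OF y] False by (simp add: m_def)
    then have "(y \<bullet> (M *v y)) / (norm y)\<^sup>2 \<le> m"
      by (simp add: scaleR_matrix_vector_assoc[symmetric] matrix_vector_mult_scaleR power2_eq_square)
    then show ?thesis using False by (simp add: power2_norm_eq_inner divide_le_eq)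
  qed simp
  let ?w = "M *v e - m *\<^sub>R e"
  have wS: "?w \<in> S"
  proof -
    have "(M *v e) \<bullet> v i = 0" if "i < k" for i
      using e(2) that by (simp add: sym[symmetric] \<mu> S_def)
    then show ?thesis using e(2) by (simp add: S_def inner_diff_left)
  qed
  have ee: "e \<bullet> e = 1" using e(1) by (simp add: norm_eq_sqrt_inner)
  have "?w = 0"
  proof (rule ccontr)
    assume "?w \<noteq> 0"
    define g where "g = ?w \<bullet> ?w"
    have g: "0 < g" using \<open>?w \<noteq> 0\<close> by (simp add: g_def)
    define C where "C = m * g - ?w \<bullet> (M *v ?w)"
    \<comment> \<open>For small \<open>t > 0\<close> the gain \<open>2 * t * g\<close> of first order outweighs the term \<open>t\<^sup>2 * C\<close>.\<close>
    define t where "t = g / (\<bar>C\<bar> + 1)"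
    have t: "0 < t" using g by (simp add: t_def)
    have *: "(e + t *\<^sub>R ?w) \<bullet> (M *v (e + t *\<^sub>R ?w)) \<le> m * ((e + t *\<^sub>R ?w) \<bullet> (e + t *\<^sub>R ?w))"
      by (rule max[OF Sadd[OF e(2) Sscale[OF wS]]])
    have lhs: "(e + t *\<^sub>R z) \<bullet> (M *v (e + t *\<^sub>R z)) = m + 2 * t * (z \<bullet> (M *v e)) + t\<^sup>2 * (z \<bullet> (M *v z))" for z
      using sym[of e z]
      by (simp add: matrix_vector_right_distrib matrix_vector_mult_scaleR inner_add_left inner_add_right m_def
          inner_commute power2_eq_square algebra_simps)
    have rhs: "(e + t *\<^sub>R z) \<bullet> (e + t *\<^sub>R z) = 1 + 2 * t * (z \<bullet> e) + t\<^sup>2 * (z \<bullet> z)" for z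
      by (simp add: inner_add_left inner_add_right ee inner_commute power2_eq_square algebra_simps)
    have gw: "g = ?w \<bullet> (M *v e) - m * (?w \<bullet> e)" by (simp add: g_def inner_diff_right)
    have "2 * t * (?w \<bullet> (M *v e)) + t\<^sup>2 * (?w \<bullet> (M *v ?w)) \<le> m * (2 * t * (?w \<bullet> e)) + m * (t\<^sup>2 * g)"
      using * unfolding lhs rhs g_def by (simp add: algebra_simps)
    then have "t * (2 * g) \<le> t * (t * C)"
      unfolding C_def by (subst (1) gw) (simp add: power2_eq_square algebra_simps)
    then have "2 * g \<le> t * C" using t by simp
    also have "\<dots> \<le> t * (\<bar>C\<bar> + 1)" using t by (intro mult_left_mono) auto
    also have "\<dots> = g" by (simp add: t_def)
    finally show False using g by simp
  qed
  then have eig: "M *v e = m *\<^sub>R e" by simp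
  have orth: "e \<bullet> v i = 0" "v i \<bullet> e = 0" if "i < k" for i
    using e(2) that by (auto simp: S_def inner_commute)
  let ?v = "v(k := e)" and ?\<mu> = "\<mu>(k := m)"
  have "(\<forall>i<Suc k. \<forall>j<Suc k. ?v i \<bullet> ?v j = (if i = j then 1 else 0)) \<and> (\<forall>i<Suc k. M *v ?v i = ?\<mu> i *\<^sub>R ?v i)"
    using v \<mu> eig orth ee by (auto simp: less_Suc_eq)
  then show ?case by blast
qed simp

text \<open>The frame vectors, as columns of a matrix \<open>P\<close>, diagonalise \<open>M\<close>. The determinant is computed after
evaluation at each real \<open>x\<close>, and polynomials with the same values are equal.\<close>

lemma charpoly_eigenframe:
  fixes M :: "real^'n^'n"
  assumes v: "orthonormal_frame v" and \<mu>: "\<And>i. i < CARD('n) \<Longrightarrow> M *v v i = \<mu> i *\<^sub>R v i"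
  shows "charpoly M = (\<Prod>i<CARD('n). [:- \<mu> i, 1:])"
proof -
  obtain h :: "'n \<Rightarrow> nat" where h: "bij_betw h UNIV {..<CARD('n)}"
    using ex_bij_betw_finite_nat[of "UNIV :: 'n set"] by (auto simp: atLeast0LessThan)
  have hl: "h a < CARD('n)" for a using h by (auto simp: bij_betw_def)
  have heq: "h a = h b \<longleftrightarrow> a = b" for a b using h by (auto simp: bij_betw_def inj_on_def)
  define P :: "real^'n^'n" where "P = (\<chi> a b. v (h b) $ a)"
  have "transpose P ** P = mat 1"
  proof -
    have "(\<Sum>c\<in>UNIV. v (h a) $ c * v (h b) $ c) = (if a = b then 1 else 0)" for a b
      using v hl heq by (simp add: orthonormal_frame_def inner_vec_def)
    then show ?thesis by (simp add: matrix_matrix_mult_def transpose_def P_def mat_def vec_eq_iff)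
  qed
  then have "det P * det P = 1" by (metis det_I det_mul det_transpose)
  then have detP: "det P \<noteq> 0" by auto
  have det: "det ((\<chi> i j. (if i = j then x else 0) - M $ i $ j) :: real^'n^'n) = (\<Prod>i<CARD('n). x - \<mu> i)" for x
  proof -
    let ?N = "(\<chi> i j. (if i = j then x else 0) - M $ i $ j) :: real^'n^'n"
    let ?D = "(\<chi> a b. if a = b then x - \<mu> (h b) else 0) :: real^'n^'n"
    have "(?N ** P) $ a $ b = (P ** ?D) $ a $ b" for a b
    proof -
      have "(?N ** P) $ a $ b = (\<Sum>c\<in>UNIV. ((if a = c then x else 0) - M $ a $ c) * v (h b) $ c)"
        by (simp add: matrix_matrix_mult_def P_def)
      also have "\<dots> = x * v (h b) $ a - (M *v v (h b)) $ a"
        by (simp add: matrix_vector_mult_def left_diff_distrib sum_subtractf if_distrib[of "\<lambda>y. y * _"] cong: if_cong)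
      also have "\<dots> = P $ a $ b * (x - \<mu> (h b))"
        using \<mu>[OF hl] by (simp add: P_def algebra_simps)
      also have "\<dots> = (P ** ?D) $ a $ b"
        by (simp add: matrix_matrix_mult_def if_distrib[of "\<lambda>y. _ * y"] cong: if_cong)
      finally show ?thesis .
    qed
    then have "?N ** P = P ** ?D" by (simp add: vec_eq_iff)
    then have "det (?N ** P) = det (P ** ?D)" by (rule arg_cong)
    then have "det ?N * det P = det P * det ?D" by (simp only: det_mul)
    then have "det ?N = det ?D" using detP by simp
    also have "\<dots> = (\<Prod>a\<in>UNIV. x - \<mu> (h a))" by (subst det_diagonal) auto
    also have "\<dots> = (\<Prod>i<CARD('n). x - \<mu> i)" by (rule prod.reindex_bij_betw[OF h])
    finally show ?thesis .
  qed
  have "poly (charpoly M) x = poly (\<Prod>i<CARD('n). [:- \<mu> i, 1:]) x" for x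
  proof -
    have "poly (charpoly M) x = det ((\<chi> i j. (if i = j then x else 0) - M $ i $ j) :: real^'n^'n)"
      unfolding charpoly_def det_def
      by (auto simp: poly_sum poly_prod intro!: sum.cong prod.cong)
    then show ?thesis by (simp add: det poly_prod)
  qed
  then have "poly (charpoly M) = poly (\<Prod>i<CARD('n). [:- \<mu> i, 1:])" by (rule ext)
  then show ?thesis by (simp only: poly_eq_poly_eq_iff)
qed

lemma proots_linear_factors:
  fixes \<mu> :: "nat \<Rightarrow> real"
  shows "proots (\<Prod>i<k. [:- \<mu> i, 1:]) = mset (map \<mu> [0..<k])"
proof (induction k)
  case (Suc k)
  have "(\<Prod>i<k. [:- \<mu> i, 1:]) \<noteq> 0" by (simp add: prod_zero_iff)
  then show ?case using Suc by (simp add: proots_mult lessThan_Suc mult.commute del: mult_pCons_left mult_pCons_right)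
qed simp

lemma inner_gram: "(A *v x) \<bullet> (A *v y) = ((transpose A ** A) *v x) \<bullet> y" for A :: "real^'n^'n"
  by (metis dot_lmul_matrix matrix_vector_mul_assoc transpose_matrix_vector)

text \<open>\<open>A\<close> maps an orthonormal eigenframe of \<open>transpose A ** A\<close> to orthogonal vectors whose squared lengths are the
eigenvalues. As \<open>A\<close> is injective, these images can be normalised and form the second frame. The permutation
\<open>\<pi>\<close> sorts the eigenvalues.\<close>

lemma singular_value_decomposition:
  fixes A :: "real^'n^'n"
  assumes inj: "\<And>x. x \<noteq> 0 \<Longrightarrow> A *v x \<noteq> 0"
  obtains v u where "orthonormal_frame v" "orthonormal_frame u"
    "\<And>i. i < CARD('n) \<Longrightarrow> A *v v i = (singular_values A ! i) *\<^sub>R u i"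
    "\<And>i. i < CARD('n) \<Longrightarrow> 0 < singular_values A ! i"
    "\<And>i j. i \<le> j \<Longrightarrow> j < CARD('n) \<Longrightarrow> singular_values A ! j \<le> singular_values A ! i"
proof -
  let ?M = "transpose A ** A" and ?\<sigma> = "\<lambda>i. singular_values A ! i"
  have "x \<bullet> (?M *v y) = (?M *v x) \<bullet> y" for x y
    by (metis inner_commute inner_gram)
  from symmetric_eigenvectors[OF this order.refl]
  obtain w \<mu> where w: "orthonormal_frame w" and \<mu>: "\<And>i. i < CARD('n) \<Longrightarrow> ?M *v w i = \<mu> i *\<^sub>R w i"
    unfolding orthonormal_frame_def by blast
  have Aw: "(A *v w i) \<bullet> (A *v w j) = (if i = j then \<mu> i else 0)" if "i < CARD('n)" "j < CARD('n)" for i j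
    using that w by (simp add: inner_gram \<mu> orthonormal_frame_def)
  define xs where "xs = map (\<lambda>i. sqrt (\<mu> i)) [0..<CARD('n)]"
  have "charpoly ?M = (\<Prod>i<CARD('n). [:- \<mu> i, 1:])"
    by (rule charpoly_eigenframe[OF w]) (rule \<mu>)
  then have "image_mset sqrt (proots (charpoly ?M)) = mset xs"
    by (simp only: proots_linear_factors mset_map[symmetric] xs_def map_map o_def)
  then have sv: "singular_values A = rev (sort xs)"
    by (simp add: singular_values_def sorted_list_of_multiset_mset)
  then obtain \<pi> where \<pi>: "\<pi> permutes {..<CARD('n)}" "permute_list \<pi> xs = singular_values A"
    by (metis mset_eq_permutation mset_rev mset_sort xs_def length_map length_upt diff_zero)
  have \<pi>l: "\<pi> i < CARD('n)" if "i < CARD('n)" for i using permutes_in_image[OF \<pi>(1)] that by auto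
  have \<sigma>: "?\<sigma> i = sqrt (\<mu> (\<pi> i))" if "i < CARD('n)" for i
    using permute_list_nth[of \<pi> xs i] \<pi> \<pi>l[OF that] that by (simp add: xs_def)
  have \<mu>0: "0 < \<mu> i" if "i < CARD('n)" for i
  proof -
    have "w i \<noteq> 0" using frame_norm[OF w that] by auto
    then show ?thesis using Aw[OF that that] inj[of "w i"] by (metis inner_gt_zero_iff)
  qed
  show ?thesis
  proof (rule that[of "w \<circ> \<pi>" "\<lambda>i. (1 / ?\<sigma> i) *\<^sub>R (A *v w (\<pi> i))"])
    have inj: "\<pi> i = \<pi> j \<longleftrightarrow> i = j" for i j using permutes_inj[OF \<pi>(1)] by (auto dest: injD)
    show "orthonormal_frame (w \<circ> \<pi>)"
      using w \<pi>l inj by (auto simp: orthonormal_frame_def)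
    show "orthonormal_frame (\<lambda>i. (1 / ?\<sigma> i) *\<^sub>R (A *v w (\<pi> i)))"
      unfolding orthonormal_frame_def
    proof (intro allI impI)
      fix i j assume "i < CARD('n)" "j < CARD('n)"
      then show "(1 / ?\<sigma> i) *\<^sub>R (A *v w (\<pi> i)) \<bullet> (1 / ?\<sigma> j) *\<^sub>R (A *v w (\<pi> j)) = (if i = j then 1 else 0)"
        using Aw[OF \<pi>l \<pi>l, of i j] \<mu>0[OF \<pi>l, of i] inj by (cases "i = j") (simp_all add: \<sigma>)
    qed
    show "0 < ?\<sigma> i" if "i < CARD('n)" for i using \<sigma> \<mu>0 \<pi>l that by simp
    then show "A *v (w \<circ> \<pi>) i = ?\<sigma> i *\<^sub>R ((1 / ?\<sigma> i) *\<^sub>R (A *v w (\<pi> i)))" if "i < CARD('n)" for i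
      using that by (simp add: less_imp_neq[symmetric])
    show "?\<sigma> j \<le> ?\<sigma> i" if "i \<le> j" "j < CARD('n)" for i j
      using that unfolding sv by (simp add: rev_nth xs_def sorted_nth_mono)
  qed
qed

lemma svd_coordinate:
  fixes A :: "real^'n^'n"
  assumes v: "orthonormal_frame v" and u: "orthonormal_frame u"
    and A: "\<And>i. i < CARD('n) \<Longrightarrow> A *v v i = \<sigma> i *\<^sub>R u i" and i: "i < CARD('n)"
  shows "(A *v z) \<bullet> u i = \<sigma> i * (z \<bullet> v i)"
proof -
  have "A *v (\<Sum>j<CARD('n). (z \<bullet> v j) *\<^sub>R v j) = (\<Sum>j<CARD('n). (z \<bullet> v j) *\<^sub>R (A *v v j))"
    by (simp add: linear_sum[OF matrix_vector_mul_linear] matrix_vector_mult_scaleR)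
  also have "\<dots> = (\<Sum>j<CARD('n). ((z \<bullet> v j) * \<sigma> j) *\<^sub>R u j)"
    by (intro sum.cong) (auto simp: A)
  finally have "A *v z = (\<Sum>j<CARD('n). ((z \<bullet> v j) * \<sigma> j) *\<^sub>R u j)"
    by (simp only: frame_expansion[OF v])
  then show ?thesis using frame_coordinate[OF u i order.refl] i by simp
qed

text \<open>Writing \<open>d\<close> as \<open>p + s\<close> with \<open>0 < s \<le> 1\<close>, instead of \<open>0 \<le> s < 1\<close>, removes the case distinction: for an
integer \<open>d\<close> the last full factor becomes the power with exponent one, and \<open>p\<close> is always a valid index, also
for \<open>d = CARD('n)\<close>.\<close>

lemma omega_eq:
  assumes "real p < d" "d \<le> real p + 1" "0 \<le> singular_values A ! p"
  shows "omega d A = (\<Prod>i<p. singular_values A ! i) * singular_values A ! p powr (d - real p)"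
proof (cases "d = real p + 1")
  case True
  then have "\<lfloor>d\<rfloor> = int (Suc p)" "frac d = 0" by (simp_all add: frac_def)
  then show ?thesis using True assms(3) by (simp add: omega_def nat_add_distrib)
next
  case False
  then have "\<lfloor>d\<rfloor> = int p" using assms by (intro floor_unique) auto
  then show ?thesis using assms(1) by (simp add: omega_def frac_def)
qed

section \<open>Hausdorff measure of images: upper bound\<close>

abbreviation cover_weight :: "real \<Rightarrow> ('a \<times> real) set \<Rightarrow> real" where
  "cover_weight d C \<equiv> (\<Sum>(c, r)\<in>C. r powr d)"

lemma cover_of_family:
  assumes "finite I" "\<And>i. i \<in> I \<Longrightarrow> 0 < r i \<and> r i \<le> e" "K \<subseteq> (\<Union>i\<in>I. ball (c i) (r i))"
  shows "\<exists>C\<in>ball_covers e K. cover_weight d C \<le> (\<Sum>i\<in>I. r i powr d)"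
proof
  let ?C = "(\<lambda>i. (c i, r i)) ` I"
  show "?C \<in> ball_covers e K" using assms by (fastforce simp: ball_covers_def)
  show "cover_weight d ?C \<le> (\<Sum>i\<in>I. r i powr d)"
    using sum_image_le[OF assms(1), of "\<lambda>(c, r). r powr d" "\<lambda>i. (c i, r i)"] by (simp add: o_def)
qed

lemma cover_of_covers:
  assumes "finite I" "\<And>i. i \<in> I \<Longrightarrow> \<exists>C\<in>ball_covers e (S i). cover_weight d C \<le> b i"
  shows "\<exists>C\<in>ball_covers e (\<Union>i\<in>I. S i). cover_weight d C \<le> (\<Sum>i\<in>I. b i)"
proof -
  obtain C where C: "\<And>i. i \<in> I \<Longrightarrow> C i \<in> ball_covers e (S i)" "\<And>i. i \<in> I \<Longrightarrow> cover_weight d (C i) \<le> b i"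
    using assms(2) by metis
  have fin: "finite (C i)" if "i \<in> I" for i using C(1)[OF that] by (simp add: ball_covers_def)
  have pos: "0 < r \<and> r \<le> e" if "i \<in> I" "(c, r) \<in> C i" for i c r
    using C(1)[OF that(1)] that(2) by (auto simp: ball_covers_def)
  have S: "x \<in> (\<Union>(c, r)\<in>C i. ball c r)" if "i \<in> I" "x \<in> S i" for i x
    using C(1)[OF that(1)] that(2) unfolding ball_covers_def by blast
  let ?C = "snd ` (SIGMA i:I. C i)"
  have "?C \<in> ball_covers e (\<Union>i\<in>I. S i)"
    unfolding ball_covers_def
  proof (intro CollectI conjI)
    show "finite ?C" using assms(1) fin by auto
    show "\<forall>(c, r)\<in>?C. 0 < r \<and> r \<le> e" using pos by auto
    show "(\<Union>i\<in>I. S i) \<subseteq> (\<Union>(c, r)\<in>?C. ball c r)" using S by force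
  qed
  moreover have "cover_weight d ?C \<le> (\<Sum>i\<in>I. b i)"
  proof -
    have "cover_weight d ?C \<le> sum ((\<lambda>(c, r). r powr d) \<circ> snd) (SIGMA i:I. C i)"
      using assms(1) fin by (intro sum_image_le) auto
    also have "\<dots> = (\<Sum>i\<in>I. cover_weight d (C i))"
      using assms(1) fin by (simp add: sum.Sigma o_def case_prod_beta)
    also have "\<dots> \<le> (\<Sum>i\<in>I. b i)" using C(2) by (rule sum_mono)
    finally show ?thesis .
  qed
  ultimately show ?thesis by blast
qed

lemma ball_covers_subset: "C \<in> ball_covers e T \<Longrightarrow> S \<subseteq> T \<Longrightarrow> C \<in> ball_covers e S"
  unfolding ball_covers_def by blast

lemma hausdorff_pre_le: "C \<in> ball_covers e K \<Longrightarrow> hausdorff_pre d e K \<le> ennreal (cover_weight d C)"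
  unfolding hausdorff_pre_def by (rule INF_lower)

text \<open>Multiplication by a positive factor commutes with the infimum over covers, because it has an inverse.\<close>

lemma le_cmult_hausdorff_pre:
  assumes b: "0 < b" and le: "\<And>C. C \<in> ball_covers e K \<Longrightarrow> x \<le> ennreal b * ennreal (cover_weight d C)"
  shows "x \<le> ennreal b * hausdorff_pre d e K"
proof -
  have inv: "ennreal (1 / b) * ennreal b = 1"
    using b by (simp add: ennreal_mult[symmetric] ennreal_1[symmetric] del: ennreal_1)
  have "ennreal (1 / b) * x \<le> hausdorff_pre d e K"
    unfolding hausdorff_pre_def
  proof (rule INF_greatest)
    fix C assume "C \<in> ball_covers e K"
    from mult_left_mono[OF le[OF this], of "ennreal (1 / b)"]
    show "ennreal (1 / b) * x \<le> ennreal (cover_weight d C)"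
      by (simp add: mult.assoc[symmetric] inv)
  qed
  from mult_left_mono[OF this, of "ennreal b"] show ?thesis
    by (simp add: mult.assoc[symmetric] mult.commute[of "ennreal b"] inv)
qed

text \<open>The centres are all points whose frame coordinates, relative to \<open>x0\<close>, belong to the sets \<open>F i\<close>. An error of at
most \<open>l\<close> in each coordinate is an error of at most \<open>CARD('n) * l\<close> in the norm; doubling this makes the
inequality strict, as open balls require.\<close>

lemma frame_grid_cover:
  fixes u :: "nat \<Rightarrow> real^'n" and S :: "(real^'n) set"
  assumes u: "orthonormal_frame u" and l: "0 < l" and fin: "\<And>i. i < CARD('n) \<Longrightarrow> finite (F i)"
    and F: "\<And>x i. x \<in> S \<Longrightarrow> i < CARD('n) \<Longrightarrow> \<exists>c\<in>F i. \<bar>(x - x0) \<bullet> u i - c\<bar> \<le> l"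
    and e: "2 * real CARD('n) * l \<le> e"
  shows "\<exists>C\<in>ball_covers e S. cover_weight d C \<le> (\<Prod>i<CARD('n). real (card (F i))) * (2 * real CARD('n) * l) powr d"
proof -
  let ?R = "2 * real CARD('n) * l"
  let ?I = "PiE {..<CARD('n)} F"
  let ?c = "\<lambda>q. x0 + (\<Sum>i<CARD('n). q i *\<^sub>R u i)"
  have R: "0 < ?R" using l by simp
  have "S \<subseteq> (\<Union>q\<in>?I. ball (?c q) ?R)"
  proof
    fix x assume "x \<in> S"
    then obtain q where q: "\<And>i. i < CARD('n) \<Longrightarrow> q i \<in> F i" "\<And>i. i < CARD('n) \<Longrightarrow> \<bar>(x - x0) \<bullet> u i - q i\<bar> \<le> l"
      using F by metis
    define q' where "q' = restrict q {..<CARD('n)}"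
    have "norm (x - ?c q') \<le> (\<Sum>i<CARD('n). \<bar>(x - ?c q') \<bullet> u i\<bar>)" by (rule frame_norm_le[OF u])
    also have "\<dots> \<le> (\<Sum>i<CARD('n). l)"
    proof (rule sum_mono)
      fix i assume "i \<in> {..<CARD('n)}"
      then have i: "i < CARD('n)" by simp
      have "(x - ?c q') \<bullet> u i = (x - x0) \<bullet> u i - q i"
        using frame_coordinate[OF u i order.refl, of q'] i by (simp add: inner_diff_left inner_add_left q'_def)
      then show "\<bar>(x - ?c q') \<bullet> u i\<bar> \<le> l" using q(2)[OF i] by simp
    qed
    also have "\<dots> < ?R" using l by simp
    finally have "x \<in> ball (?c q') ?R" by (simp add: dist_norm norm_minus_commute)
    moreover have "q' \<in> ?I" using q(1) by (auto simp: q'_def)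
    ultimately show "x \<in> (\<Union>q\<in>?I. ball (?c q) ?R)" by blast
  qed
  moreover have "finite ?I" using fin by (intro finite_PiE) auto
  ultimately have "\<exists>C\<in>ball_covers e S. cover_weight d C \<le> (\<Sum>q\<in>?I. ?R powr d)"
    using R e by (intro cover_of_family[where r = "\<lambda>_. ?R" and c = ?c]) simp_all
  then show ?thesis by (simp add: card_PiE)
qed

lemma interval_grid:
  assumes l: "0 < l" and q: "1 \<le> q"
  shows "\<exists>F. finite F \<and> real (card F) \<le> 5 * q \<and> (\<forall>z. \<bar>z\<bar> \<le> q * l \<longrightarrow> (\<exists>c\<in>F. \<bar>z - c\<bar> \<le> l))"
proof (intro exI conjI allI impI)
  let ?F = "(\<lambda>j. real_of_int j * l) ` {-\<lceil>q\<rceil>..\<lceil>q\<rceil>}"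
  show "finite ?F" by simp
  have "card ?F \<le> card {-\<lceil>q\<rceil>..\<lceil>q\<rceil>}" by (rule card_image_le) simp
  also have "card {-\<lceil>q\<rceil>..\<lceil>q\<rceil>} = nat (2 * \<lceil>q\<rceil> + 1)"
    by (simp only: card_atLeastAtMost_int diff_minus_eq_add mult_2)
  finally have "real (card ?F) \<le> real (nat (2 * \<lceil>q\<rceil> + 1))" by (simp only: of_nat_le_iff)
  also have "\<dots> = real_of_int (2 * \<lceil>q\<rceil> + 1)"
  proof -
    have "0 \<le> 2 * \<lceil>q\<rceil> + 1" using q by linarith
    then show ?thesis by (rule of_nat_nat)
  qed
  also have "\<dots> \<le> 5 * q" using q of_int_ceiling_le_add_one[of q] by linarith
  finally show "real (card ?F) \<le> 5 * q" .
  fix z assume z: "\<bar>z\<bar> \<le> q * l"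
  have "\<bar>z / l\<bar> \<le> q" using z l by (simp add: field_simps)
  then have "- \<lceil>q\<rceil> \<le> \<lfloor>z / l\<rfloor>" "\<lfloor>z / l\<rfloor> \<le> \<lceil>q\<rceil>" by linarith+
  then have "\<lfloor>z / l\<rfloor> \<in> {-\<lceil>q\<rceil>..\<lceil>q\<rceil>}" by simp
  moreover have "\<bar>z - real_of_int \<lfloor>z / l\<rfloor> * l\<bar> \<le> l"
  proof -
    have "z - real_of_int \<lfloor>z / l\<rfloor> * l = (z / l - real_of_int \<lfloor>z / l\<rfloor>) * l" using l by (simp add: field_simps)
    moreover have "\<bar>z / l - real_of_int \<lfloor>z / l\<rfloor>\<bar> \<le> 1" by linarith
    ultimately show ?thesis using l by (simp add: abs_mult)
  qed
  ultimately show "\<exists>c\<in>?F. \<bar>z - c\<bar> \<le> l" by blast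
qed

text \<open>Each of the at most \<open>n\<close> long directions of the ellipsoid contributes a factor \<open>5\<close> to the number of cubes, and
\<open>8 * n\<close> is the ratio between the radius of the covering balls and \<open>r\<close> times the singular value of index \<open>p\<close>.\<close>

definition ellipsoid_const :: "real \<Rightarrow> nat \<Rightarrow> real" where
  "ellipsoid_const d n = 5 ^ n * (8 * real n) powr d"

lemma ellipsoid_const_pos: "0 < n \<Longrightarrow> 0 < ellipsoid_const d n"
  by (simp add: ellipsoid_const_def)

lemma index_of_dimension:
  fixes d :: real
  assumes "0 < d" "d \<le> real n"
  obtains p where "p < n" "real p < d" "d \<le> real p + 1"
proof (rule that[of "nat (\<lceil>d\<rceil> - 1)"])
  have "1 \<le> \<lceil>d\<rceil>" using assms by linarith
  moreover have "\<lceil>d\<rceil> \<le> int n" using assms by linarith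
  ultimately show "nat (\<lceil>d\<rceil> - 1) < n" "real (nat (\<lceil>d\<rceil> - 1)) < d" "d \<le> real (nat (\<lceil>d\<rceil> - 1)) + 1"
    by (auto simp: of_nat_nat) linarith+
qed

text \<open>In the direction \<open>u i\<close> the image of \<open>S\<close> extends over \<open>4 * r\<close> times the singular value of index \<open>i\<close>: one half
comes from the linear part, and the other dominates the linearisation error because no singular value is smaller
than \<open>\<kappa>\<close>. The mesh is the extent in the direction of index \<open>p\<close>. Directions of index \<open>p\<close> or more then need a
single grid point, and each \<open>i < p\<close> needs a number proportional to the quotient of the singular values, so
the weight is the product that defines \<open>omega\<close>.\<close>

lemma ellipsoid_cover:
  fixes A :: "real^'n^'n" and S :: "(real^'n) set"
  assumes d: "0 < d" "d \<le> real CARD('n)" and \<kappa>: "0 < \<kappa>" and r: "0 < r"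
    and A: "\<And>z. \<kappa> * norm z \<le> norm (A *v z)" "\<And>z. norm (A *v z) \<le> M * norm z"
    and S: "\<And>y. y \<in> S \<Longrightarrow> norm (y - x) \<le> 2 * r"
      "\<And>y. y \<in> S \<Longrightarrow> norm (g y - g x - A *v (y - x)) \<le> \<kappa> * (2 * r)"
    and e: "8 * real CARD('n) * r * M \<le> e"
  shows "\<exists>C\<in>ball_covers e (g ` S). cover_weight d C \<le> ellipsoid_const d CARD('n) * omega d A * r powr d"
proof -
  let ?n = "CARD('n)" and ?\<sigma> = "\<lambda>i. singular_values A ! i"
  obtain p where p: "p < ?n" "real p < d" "d \<le> real p + 1" using index_of_dimension[OF d] .
  have "A *v z \<noteq> 0" if "z \<noteq> 0" for z
  proof -
    have "0 < \<kappa> * norm z" using \<kappa> that by simp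
    with A(1)[of z] show ?thesis by auto
  qed
  then obtain v u where v: "orthonormal_frame v" and u: "orthonormal_frame u"
    and Av: "\<And>i. i < ?n \<Longrightarrow> A *v v i = ?\<sigma> i *\<^sub>R u i" and pos: "\<And>i. i < ?n \<Longrightarrow> 0 < ?\<sigma> i"
    and mono: "\<And>i j. i \<le> j \<Longrightarrow> j < ?n \<Longrightarrow> ?\<sigma> j \<le> ?\<sigma> i"
    by (rule singular_value_decomposition[of A]) blast+
  have \<sigma>\<kappa>: "\<kappa> \<le> ?\<sigma> i" "?\<sigma> i \<le> M" if "i < ?n" for i
    using A(1)[of "v i"] A(2)[of "v i"] pos[OF that] by (simp_all add: Av that frame_norm[OF v] frame_norm[OF u])
  define l where "l = 4 * r * ?\<sigma> p"
  have l: "0 < l" using r pos[OF p(1)] by (simp add: l_def)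
  have coord: "\<bar>(g y - g x) \<bullet> u i\<bar> \<le> 4 * r * ?\<sigma> i" if y: "y \<in> S" and i: "i < ?n" for y i
  proof -
    have "(g y - g x) \<bullet> u i = (A *v (y - x)) \<bullet> u i + (g y - g x - A *v (y - x)) \<bullet> u i"
      by (simp add: inner_diff_left)
    moreover have "\<bar>(A *v (y - x)) \<bullet> u i\<bar> \<le> ?\<sigma> i * (2 * r)"
    proof -
      have "\<bar>(y - x) \<bullet> v i\<bar> \<le> norm (y - x) * norm (v i)" by (rule Cauchy_Schwarz_ineq2)
      also have "\<dots> \<le> 2 * r" using S(1)[OF y] by (simp add: frame_norm[OF v i])
      finally show ?thesis
        using pos[OF i] by (simp add: svd_coordinate[OF v u Av i] abs_mult)
    qed
    moreover have "\<bar>(g y - g x - A *v (y - x)) \<bullet> u i\<bar> \<le> \<kappa> * (2 * r)"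
      using Cauchy_Schwarz_ineq2[of "g y - g x - A *v (y - x)" "u i"] S(2)[OF y] by (simp add: frame_norm[OF u i])
    moreover have "\<kappa> * (2 * r) \<le> ?\<sigma> i * (2 * r)" using \<sigma>\<kappa>(1)[OF i] r by (intro mult_right_mono) auto
    ultimately have "\<bar>(g y - g x) \<bullet> u i\<bar> \<le> ?\<sigma> i * (2 * r) + ?\<sigma> i * (2 * r)" by linarith
    then show ?thesis by (simp add: algebra_simps)
  qed
  have "\<exists>F. finite F \<and> real (card F) \<le> (if i < p then 5 * (?\<sigma> i / ?\<sigma> p) else 1) \<and>
      (\<forall>z. \<bar>z\<bar> \<le> 4 * r * ?\<sigma> i \<longrightarrow> (\<exists>c\<in>F. \<bar>z - c\<bar> \<le> l))" if i: "i < ?n" for i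
  proof (cases "i < p")
    case True
    then have "1 \<le> ?\<sigma> i / ?\<sigma> p" using mono[of i p] p pos[OF p(1)] by simp
    moreover have "?\<sigma> i / ?\<sigma> p * l = 4 * r * ?\<sigma> i" using pos[OF p(1)] by (simp add: l_def)
    ultimately show ?thesis using interval_grid[OF l, of "?\<sigma> i / ?\<sigma> p"] True by simp
  next
    case False
    then have "4 * r * ?\<sigma> i \<le> l" using mono[of p i] i r by (simp add: l_def)
    with False show ?thesis by (intro exI[of _ "{0}"]) auto
  qed
  then obtain F where F: "\<And>i. i < ?n \<Longrightarrow> finite (F i)"
    "\<And>i. i < ?n \<Longrightarrow> real (card (F i)) \<le> (if i < p then 5 * (?\<sigma> i / ?\<sigma> p) else 1)"
    "\<And>i z. i < ?n \<Longrightarrow> \<bar>z\<bar> \<le> 4 * r * ?\<sigma> i \<Longrightarrow> \<exists>c\<in>F i. \<bar>z - c\<bar> \<le> l"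
    by metis
  have R: "2 * real ?n * l = 8 * real ?n * r * ?\<sigma> p" by (simp add: l_def)
  have "8 * real ?n * r * ?\<sigma> p \<le> 8 * real ?n * r * M" using \<sigma>\<kappa>(2)[OF p(1)] r by (intro mult_left_mono) auto
  then have "2 * real ?n * l \<le> e" unfolding R using e by (rule order_trans)
  then have "\<exists>C\<in>ball_covers e (g ` S). cover_weight d C \<le> (\<Prod>i<?n. real (card (F i))) * (2 * real ?n * l) powr d"
    using F(1) F(3)[OF _ coord] by (intro frame_grid_cover[OF u l, where ?x0.0 = "g x"]) auto
  moreover have "(\<Prod>i<?n. real (card (F i))) * (2 * real ?n * l) powr d \<le> ellipsoid_const d ?n * omega d A * r powr d"
  proof -
    have "(\<Prod>i<?n. real (card (F i))) \<le> (\<Prod>i<?n. if i < p then 5 * (?\<sigma> i / ?\<sigma> p) else 1)"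
      using F(2) by (intro prod_mono) auto
    also have "\<dots> = (\<Prod>i<p. 5 * (?\<sigma> i / ?\<sigma> p))"
      using p(1) by (intro prod.mono_neutral_cong_right) auto
    also have "\<dots> = 5 ^ p * ((\<Prod>i<p. ?\<sigma> i) / ?\<sigma> p ^ p)"
      by (simp add: prod.distrib prod_dividef)
    also have "\<dots> \<le> 5 ^ ?n * ((\<Prod>i<p. ?\<sigma> i) / ?\<sigma> p ^ p)"
      using p(1) pos by (intro mult_right_mono power_increasing divide_nonneg_nonneg prod_nonneg zero_le_power)
        (auto intro: less_imp_le)
    finally have "(\<Prod>i<?n. real (card (F i))) * (2 * real ?n * l) powr d
        \<le> 5 ^ ?n * ((\<Prod>i<p. ?\<sigma> i) / ?\<sigma> p ^ p) * (2 * real ?n * l) powr d"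
      by (rule mult_right_mono) simp
    also have "\<dots> = ellipsoid_const d ?n * omega d A * r powr d"
    proof -
      have "?\<sigma> p powr d = ?\<sigma> p powr (d - real p) * ?\<sigma> p powr real p" by (simp flip: powr_add)
      then have "(2 * real ?n * l) powr d = (8 * real ?n) powr d * r powr d * (?\<sigma> p powr (d - real p) * ?\<sigma> p ^ p)"
        unfolding R using r pos[OF p(1)] by (simp add: powr_mult powr_realpow)
      then show ?thesis
        using pos[OF p(1)] unfolding omega_eq[OF p(2,3) less_imp_le[OF pos[OF p(1)]]] ellipsoid_const_def by simp
    qed
    finally show ?thesis .
  qed
  ultimately show ?thesis by (meson order_trans)
qed

text \<open>Each ball of a cover of \<open>K\<close> that meets \<open>K\<close> lies in a ball of twice the radius around a point of \<open>K\<close>; its image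
is covered by \<open>ellipsoid_cover\<close>, with the expansion of \<open>g\<close> at this point.\<close>

lemma hausdorff_measure_image_le:
  fixes g :: "real^'n \<Rightarrow> real^'n" and A :: "real^'n \<Rightarrow> real^'n^'n"
  assumes d: "0 < d" "d \<le> real CARD('n)" and \<kappa>: "0 < \<kappa>" and M: "0 < M" and w: "0 < w"
    and A: "\<And>x z. x \<in> K \<Longrightarrow> \<kappa> * norm z \<le> norm (A x *v z)" "\<And>x z. x \<in> K \<Longrightarrow> norm (A x *v z) \<le> M * norm z"
    and g: "\<exists>\<delta>>0. \<forall>x\<in>K. \<forall>y\<in>K. norm (y - x) < \<delta> \<longrightarrow> norm (g y - g x - A x *v (y - x)) \<le> \<kappa> * norm (y - x)"
    and \<omega>: "\<And>x. x \<in> K \<Longrightarrow> omega d (A x) \<le> w"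
  shows "hausdorff_measure d (g ` K) \<le> ennreal (ellipsoid_const d CARD('n) * w) * hausdorff_measure d K"
  unfolding hausdorff_measure_eq_SUP[of d "g ` K"]
proof (rule SUP_least)
  let ?n = "CARD('n)"
  fix e :: real assume "e \<in> {0<..}"
  then have e: "0 < e" by simp
  obtain \<delta> where \<delta>: "0 < \<delta>" "\<And>x y. x \<in> K \<Longrightarrow> y \<in> K \<Longrightarrow> norm (y - x) < \<delta> \<Longrightarrow> norm (g y - g x - A x *v (y - x)) \<le> \<kappa> * norm (y - x)"
    using g by blast
  define e' where "e' = min (e / (8 * real ?n * M)) (\<delta> / 2)"
  have e': "0 < e'" using e M \<delta> by (simp add: e'_def)
  let ?B = "ellipsoid_const d ?n * w"
  have B: "0 < ?B" using w ellipsoid_const_pos[of ?n d] by simp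
  have "hausdorff_pre d e (g ` K) \<le> ennreal ?B * hausdorff_pre d e' K"
  proof (rule le_cmult_hausdorff_pre[OF B])
    fix C assume C: "C \<in> ball_covers e' K"
    then have fin: "finite C" and rad: "\<And>c r. (c, r) \<in> C \<Longrightarrow> 0 < r \<and> r \<le> e'"
      and K: "K \<subseteq> (\<Union>(c, r)\<in>C. ball c r)" by (auto simp: ball_covers_def)
    let ?S = "\<lambda>(c, r). g ` (K \<inter> ball c r)"
    have "\<exists>D\<in>ball_covers e (?S i). cover_weight d D \<le> ?B * (case i of (c, r) \<Rightarrow> r powr d)" if "i \<in> C" for i
    proof -
      obtain c r where i: "i = (c, r)" by (cases i)
      then have r: "0 < r" "r \<le> e'" using rad that by auto
      show ?thesis
      proof (cases "K \<inter> ball c r = {}")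
        case True
        then have "{} \<in> ball_covers e (?S i)" by (simp add: i ball_covers_def)
        moreover have "cover_weight d {} \<le> ?B * (case i of (c, r) \<Rightarrow> r powr d)" using B i by simp
        ultimately show ?thesis by blast
      next
        case False
        then obtain x where x: "x \<in> K" "dist c x < r" by auto
        have near: "norm (y - x) < 2 * r" if "y \<in> K \<inter> ball c r" for y
          using x(2) that dist_triangle[of y x c] by (simp add: dist_norm norm_minus_commute)
        have "\<exists>D\<in>ball_covers e (g ` (K \<inter> ball c r)). cover_weight d D \<le> ellipsoid_const d ?n * omega d (A x) * r powr d"
        proof (rule ellipsoid_cover[OF d \<kappa> r(1) A[OF x(1)]])
          fix y assume y: "y \<in> K \<inter> ball c r"
          then show "norm (y - x) \<le> 2 * r" using near by (simp add: less_imp_le)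
          have "norm (y - x) < \<delta>" using near[OF y] r(2) by (simp add: e'_def)
          then have "norm (g y - g x - A x *v (y - x)) \<le> \<kappa> * norm (y - x)" using \<delta>(2) x(1) y by simp
          also have "\<dots> \<le> \<kappa> * (2 * r)" using near[OF y] \<kappa> by (intro mult_left_mono) auto
          finally show "norm (g y - g x - A x *v (y - x)) \<le> \<kappa> * (2 * r)" .
        next
          have "r \<le> e / (8 * real ?n * M)" using r(2) by (simp add: e'_def)
          then show "8 * real ?n * r * M \<le> e" using M by (simp add: field_simps)
        qed
        moreover have "ellipsoid_const d ?n * omega d (A x) * r powr d \<le> ?B * r powr d"
          using \<omega>[OF x(1)] ellipsoid_const_pos[of ?n d] by (intro mult_right_mono mult_left_mono) auto
        ultimately show ?thesis unfolding i by (auto intro: order_trans)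
      qed
    qed
    then obtain D where D: "D \<in> ball_covers e (\<Union>i\<in>C. ?S i)" "cover_weight d D \<le> (\<Sum>i\<in>C. ?B * (case i of (c, r) \<Rightarrow> r powr d))"
      using cover_of_covers[OF fin, of e ?S d "\<lambda>i. ?B * (case i of (c, r) \<Rightarrow> r powr d)"] by blast
    have "g ` K \<subseteq> (\<Union>i\<in>C. ?S i)" using K by fastforce
    then have "D \<in> ball_covers e (g ` K)" using D(1) ball_covers_subset by blast
    then have "hausdorff_pre d e (g ` K) \<le> ennreal (cover_weight d D)" by (rule hausdorff_pre_le)
    also have "\<dots> \<le> ennreal (?B * cover_weight d C)"
      using D(2) by (intro ennreal_leI) (simp add: sum_distrib_left)
    also have "\<dots> = ennreal ?B * ennreal (cover_weight d C)" using B by (simp add: ennreal_mult' less_imp_le)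
    finally show "hausdorff_pre d e (g ` K) \<le> ennreal ?B * ennreal (cover_weight d C)" .
  qed
  also have "\<dots> \<le> ennreal ?B * hausdorff_measure d K"
    unfolding hausdorff_measure_eq_SUP using e' by (intro mult_left_mono SUP_upper) auto
  finally show "hausdorff_pre d e (g ` K) \<le> ennreal ?B * hausdorff_measure d K" .
qed

section \<open>Cantor sets\<close>

text \<open>The numbers \<open>j < 2 ^ N\<close> are read as binary addresses of length \<open>N\<close>: \<open>cantor \<theta> N j\<close> is the left end of the
\<open>j\<close>-th interval, of length \<open>\<theta> ^ N\<close>, at level \<open>N\<close> of the construction of the Cantor set with ratio \<open>\<theta>\<close>.
Dropping the last digit of the address leads to the parent interval.\<close>

fun cantor :: "real \<Rightarrow> nat \<Rightarrow> nat \<Rightarrow> real" where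
  "cantor \<theta> 0 j = 0"
| "cantor \<theta> (Suc N) j = cantor \<theta> N (j div 2) + (if odd j then (1 - \<theta>) * \<theta> ^ N else 0)"

lemma cantor_prefix:
  assumes \<theta>: "0 < \<theta>" "\<theta> \<le> 1" and "M \<le> N"
  shows "cantor \<theta> M (j div 2 ^ (N - M)) \<le> cantor \<theta> N j \<and>
    cantor \<theta> N j \<le> cantor \<theta> M (j div 2 ^ (N - M)) + \<theta> ^ M - \<theta> ^ N"
  using \<open>M \<le> N\<close>
proof (induction N arbitrary: j rule: dec_induct)
  case (step N)
  have eq: "j div 2 ^ (Suc N - M) = (j div 2) div 2 ^ (N - M)"
    using step.hyps by (simp add: Suc_diff_le div_mult2_eq)
  have "0 \<le> (1 - \<theta>) * \<theta> ^ N" using \<theta> by simp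
  moreover have "(1 - \<theta>) * \<theta> ^ N = \<theta> ^ N - \<theta> ^ Suc N" by (simp add: algebra_simps)
  ultimately show ?case using step.IH[of "j div 2"] by (auto simp: eq)
qed simp

lemma cantor_unit:
  assumes "0 < \<theta>" "\<theta> \<le> 1"
  shows "0 \<le> cantor \<theta> N j \<and> cantor \<theta> N j \<le> 1"
proof -
  have "0 \<le> cantor \<theta> N j \<and> cantor \<theta> N j \<le> 1 - \<theta> ^ N"
    using cantor_prefix[OF assms, of 0 N j] by simp
  moreover have "0 < \<theta> ^ N" using assms(1) by (rule zero_less_power)
  ultimately show ?thesis by linarith
qed

lemma cantor_step:
  assumes \<theta>: "0 < \<theta>" "\<theta> \<le> 1 / 2"
  shows "Suc j < 2 ^ N \<Longrightarrow> \<theta> ^ N \<le> cantor \<theta> N (Suc j) - cantor \<theta> N j"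
proof (induction N arbitrary: j)
  case (Suc N)
  show ?case
  proof (cases "even j")
    case True
    then have "cantor \<theta> (Suc N) (Suc j) - cantor \<theta> (Suc N) j = (1 - \<theta>) * \<theta> ^ N" by simp
    moreover have "\<theta> * \<theta> ^ N \<le> (1 - \<theta>) * \<theta> ^ N" using \<theta> by (intro mult_right_mono) auto
    ultimately show ?thesis by simp
  next
    case False
    then obtain i where i: "j = Suc (2 * i)" by (metis oddE Suc_eq_plus1)
    then have "\<theta> ^ N \<le> cantor \<theta> N (Suc i) - cantor \<theta> N i" using Suc by auto
    then show ?thesis by (simp add: i algebra_simps)
  qed
qed simp

lemma cantor_spread:
  assumes \<theta>: "0 < \<theta>" "\<theta> \<le> 1 / 2"
  shows "i + k < 2 ^ N \<Longrightarrow> real k * \<theta> ^ N \<le> cantor \<theta> N (i + k) - cantor \<theta> N i"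
proof (induction k)
  case (Suc k)
  then show ?case using cantor_step[OF \<theta>, of "i + k" N] by (simp add: algebra_simps)
qed simp

lemma cantor_refine: "cantor \<theta> (N + k) (j * 2 ^ k) = cantor \<theta> N j"
  by (induction k) (auto simp: mult.assoc[symmetric])

lemma cantor_level_approximation:
  assumes \<theta>: "0 < \<theta>" "\<theta> \<le> 1" and j: "j < 2 ^ M"
  shows "\<exists>i<2 ^ N. \<bar>cantor \<theta> M j - cantor \<theta> N i\<bar> \<le> \<theta> ^ N"
proof (cases "N \<le> M")
  case True
  have "j < 2 ^ N * 2 ^ (M - N)" using j True by (simp flip: power_add)
  then have "j div 2 ^ (M - N) < 2 ^ N" by (simp add: less_mult_imp_div_less)
  moreover have "\<bar>cantor \<theta> M j - cantor \<theta> N (j div 2 ^ (M - N))\<bar> \<le> \<theta> ^ N"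
    using cantor_prefix[OF \<theta> True, of j] zero_less_power[OF \<theta>(1), of M] by linarith
  ultimately show ?thesis by blast
next
  case False
  then have "M + (N - M) = N" by simp
  then have "cantor \<theta> N (j * 2 ^ (N - M)) = cantor \<theta> M j" using cantor_refine[of \<theta> M "N - M" j] by simp
  moreover have "j * 2 ^ (N - M) < 2 ^ M * 2 ^ (N - M)" using j by simp
  then have "j * 2 ^ (N - M) < 2 ^ N" using False by (simp flip: power_add)
  ultimately show ?thesis using \<theta> by (intro exI[of _ "j * 2 ^ (N - M)"]) simp
qed

text \<open>The ratio for which the Cantor set has similarity dimension \<open>s\<close>. For \<open>s = 1\<close> it is \<open>1 / 2\<close>, and the Cantor set
is the unit interval.\<close>

definition cantor_ratio :: "real \<Rightarrow> real" where
  "cantor_ratio s = 2 powr (- 1 / s)"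

lemma cantor_ratio:
  assumes "0 < s" "s \<le> 1"
  shows "0 < cantor_ratio s" "cantor_ratio s \<le> 1 / 2" "cantor_ratio s powr s = 1 / 2"
proof -
  have "2 powr (- 1 / s) \<le> 2 powr (- 1 :: real)" using assms by (intro powr_mono) (auto simp: field_simps)
  then show "cantor_ratio s \<le> 1 / 2" by (simp add: cantor_ratio_def powr_minus)
  have "- 1 / s * s = - 1" using assms by simp
  then show "cantor_ratio s powr s = 1 / 2"
    by (simp only: cantor_ratio_def powr_powr) (simp add: powr_minus)
qed (simp add: cantor_ratio_def)

lemma cantor_ratio_power:
  assumes "0 < s" "s \<le> 1"
  shows "(cantor_ratio s ^ N) powr s = (1 / 2) ^ N"
proof -
  have "(cantor_ratio s ^ N) powr s = (cantor_ratio s powr s) ^ N"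
    using cantor_ratio(1)[OF assms] by (simp add: powr_realpow[symmetric] powr_powr mult.commute)
  then show ?thesis using cantor_ratio(3)[OF assms] by simp
qed

lemma power_crossing:
  fixes \<theta> R :: real
  assumes "0 < \<theta>" "\<theta> < 1" "0 < R" "R < 1"
  obtains M where "\<theta> ^ Suc M \<le> R" "R < \<theta> ^ M"
proof -
  obtain n where n: "\<theta> ^ n \<le> R" using real_arch_pow_inv[OF assms(3,2)] by (auto intro: less_imp_le)
  define k where "k = (LEAST k. \<theta> ^ k \<le> R)"
  have k: "\<theta> ^ k \<le> R" unfolding k_def by (rule LeastI[of _ n]) (rule n)
  have "k \<noteq> 0"
  proof
    assume "k = 0"
    with k have "1 \<le> R" by simp
    with assms(4) show False by simp
  qed
  then obtain M where M: "k = Suc M" by (metis not0_implies_Suc)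
  then have "\<not> \<theta> ^ M \<le> R" using not_less_Least[of M "\<lambda>k. \<theta> ^ k \<le> R"] by (simp add: k_def)
  then show ?thesis using that[of M] k M by simp
qed

text \<open>The mass distribution principle in discrete form. For the level \<open>M\<close> whose interval length just exceeds \<open>R\<close>, the
points of \<open>S\<close> lie in at most two neighbouring intervals of level \<open>M\<close>, because the points of other intervals are
farther apart than \<open>R\<close>. Such an interval contains \<open>2 ^ (N - M)\<close> points of level \<open>N\<close>, and
\<open>(1 / 2) ^ M\<close> is comparable to \<open>R powr s\<close>.\<close>

lemma cantor_clustered_card:
  assumes s: "0 < s" "s \<le> 1" and S: "S \<subseteq> {..<2 ^ N}"
    and close: "\<And>i j. i \<in> S \<Longrightarrow> j \<in> S \<Longrightarrow> \<bar>cantor (cantor_ratio s) N i - cantor (cantor_ratio s) N j\<bar> \<le> R"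
    and R: "cantor_ratio s ^ N \<le> R"
  shows "real (card S) \<le> 4 * 2 ^ N * R powr s"
proof -
  let ?l = "cantor_ratio s"
  note l = cantor_ratio[OF s]
  have fin: "finite S" using S by (rule finite_subset) simp
  have R0: "0 < R" using R zero_less_power[OF l(1), of N] by linarith
  show ?thesis
  proof (cases "1 \<le> R")
    case True
    then have "1 \<le> R powr s" using s by (simp add: ge_one_powr_ge_zero)
    moreover have "card S \<le> 2 ^ N" using card_mono[OF _ S] by simp
    then have "real (card S) \<le> real (2 ^ N)" by (simp only: of_nat_le_iff)
    then have "real (card S) \<le> 2 ^ N" by (simp only: of_nat_power of_nat_numeral)
    then have "real (card S) \<le> 4 * 2 ^ N" using zero_le_power[of "2::real" N] by linarith
    ultimately show ?thesis
      using mult_mono[of "real (card S)" "4 * 2 ^ N" 1 "R powr s"] by simp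
  next
    case False
    then obtain M where M: "?l ^ Suc M \<le> R" "R < ?l ^ M"
      using power_crossing[of ?l R] l R0 by auto
    have MN: "M \<le> N"
    proof (rule ccontr)
      assume "\<not> M \<le> N"
      then have "?l ^ M \<le> ?l ^ N" using l by (intro power_decreasing) auto
      with M(2) R show False by linarith
    qed
    show ?thesis
    proof (cases "S = {}")
      case True
      then show ?thesis by simp
    next
      case ne: False
      define m where "m = Min S"
      have m: "m \<in> S" "\<And>j. j \<in> S \<Longrightarrow> m \<le> j" using ne fin by (auto simp: m_def)
      let ?b = "2 ^ (N - M) :: nat"
      have gap: "\<exists>k. a = b + k \<and> 2 \<le> k" if "\<not> a \<le> b + 1" for a b :: nat
        using that by (intro exI[of _ "a - b"]) auto
      have "j div ?b \<le> m div ?b + 1" if j: "j \<in> S" for j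
      proof (rule ccontr)
        assume "\<not> j div ?b \<le> m div ?b + 1"
        then obtain k where k: "j div ?b = m div ?b + k" "2 \<le> k" using gap by blast
        have "j < 2 ^ M * ?b" using S j MN by (auto simp flip: power_add)
        then have "j div ?b < 2 ^ M" by (simp add: less_mult_imp_div_less)
        then have "real k * ?l ^ M \<le> cantor ?l M (j div ?b) - cantor ?l M (m div ?b)"
          using cantor_spread[OF l(1,2), of "m div ?b" k M] by (simp add: k(1))
        moreover have "2 * ?l ^ M \<le> real k * ?l ^ M" using k(2) l by (intro mult_right_mono) auto
        moreover have "cantor ?l M (j div ?b) \<le> cantor ?l N j"
          "cantor ?l N m \<le> cantor ?l M (m div ?b) + ?l ^ M - ?l ^ N"
          using cantor_prefix[OF l(1) _ MN] l(2) by auto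
        moreover have "\<bar>cantor ?l N j - cantor ?l N m\<bar> \<le> R" by (rule close[OF j m(1)])
        ultimately show False using M(2) zero_less_power[OF l(1), of N] by linarith
      qed
      then have "S \<subseteq> {m div ?b * ?b ..< (m div ?b + 2) * ?b}"
      proof (intro subsetI)
        fix j assume le: "\<And>j. j \<in> S \<Longrightarrow> j div ?b \<le> m div ?b + 1" and j: "j \<in> S"
        have "m div ?b * ?b \<le> m" by simp
        also have "\<dots> \<le> j" by (rule m(2)[OF j])
        finally have "m div ?b * ?b \<le> j" .
        moreover have "j < (j div ?b + 1) * ?b" by (simp add: dividend_less_div_times)
        moreover have "(j div ?b + 1) * ?b \<le> (m div ?b + 2) * ?b" using le[OF j] by (intro mult_right_mono) auto
        ultimately show "j \<in> {m div ?b * ?b ..< (m div ?b + 2) * ?b}" by simp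
      qed
      then have "card S \<le> card {m div ?b * ?b ..< (m div ?b + 2) * ?b}" by (rule card_mono[rotated]) simp
      also have "\<dots> = 2 * ?b" by (simp add: algebra_simps)
      finally have "real (card S) \<le> real (2 * ?b)" by (simp only: of_nat_le_iff)
      also have "\<dots> = 4 * 2 ^ N * (1 / 2) ^ Suc M"
      proof -
        have "(2::real) ^ N = 2 ^ M * 2 ^ (N - M)" using MN by (simp flip: power_add)
        then show ?thesis by (simp add: power_one_over)
      qed
      also have "\<dots> \<le> 4 * 2 ^ N * R powr s"
      proof (rule mult_left_mono)
        have "(?l ^ Suc M) powr s \<le> R powr s" using M(1) l s by (intro powr_mono2) auto
        then show "(1 / 2) ^ Suc M \<le> R powr s" by (simp only: cantor_ratio_power[OF s])
      qed simp
      finally show ?thesis .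
    qed
  qed
qed

section \<open>Products of Cantor sets as test sets\<close>

definition cantor_point :: "(nat \<Rightarrow> real^'n) \<Rightarrow> nat \<Rightarrow> (nat \<Rightarrow> real) \<Rightarrow> (nat \<Rightarrow> nat) \<Rightarrow> (nat \<Rightarrow> nat) \<Rightarrow> real^'n" where
  "cantor_point v k s N j = (\<Sum>i<k. cantor (cantor_ratio (s i)) (N i) (j i) *\<^sub>R v i)"

text \<open>Levels may differ between coordinates: the ratios differ, and a cover by balls of a given size needs intervals of
about the same length in all coordinates.\<close>

definition cantor_product :: "(nat \<Rightarrow> real^'n) \<Rightarrow> nat \<Rightarrow> (nat \<Rightarrow> real) \<Rightarrow> (real^'n) set" where
  "cantor_product v k s = closure {cantor_point v k s N j | N j. \<forall>i<k. j i < 2 ^ N i}"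

lemma cantor_product_bounded:
  fixes v :: "nat \<Rightarrow> real^'n"
  assumes v: "orthonormal_frame v" and k: "k \<le> CARD('n)" and s: "\<And>i. i < k \<Longrightarrow> 0 < s i \<and> s i \<le> 1"
  shows "compact (cantor_product v k s)" "cantor_product v k s \<subseteq> cball 0 (real CARD('n))"
proof -
  have "norm (cantor_point v k s N j) \<le> real CARD('n)" for N j
  proof -
    have "norm (cantor_point v k s N j) \<le> (\<Sum>i<k. norm (cantor (cantor_ratio (s i)) (N i) (j i) *\<^sub>R v i))"
      unfolding cantor_point_def by (rule norm_sum)
    also have "\<dots> \<le> (\<Sum>i<k. 1)"
    proof (rule sum_mono)
      fix i assume "i \<in> {..<k}"
      then have i: "i < k" by simp
      have "cantor_ratio (s i) \<le> 1" using cantor_ratio(2)[of "s i"] s[OF i] by simp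
      then show "norm (cantor (cantor_ratio (s i)) (N i) (j i) *\<^sub>R v i) \<le> 1"
        using cantor_unit[of "cantor_ratio (s i)"] cantor_ratio(1)[of "s i"] s[OF i] frame_norm[OF v, of i] i k by simp
    qed
    finally show ?thesis using k by simp
  qed
  then show sub: "cantor_product v k s \<subseteq> cball 0 (real CARD('n))"
    unfolding cantor_product_def by (intro closure_minimal) auto
  show "compact (cantor_product v k s)"
    using bounded_subset[OF bounded_cball sub] by (simp add: compact_eq_bounded_closed cantor_product_def)
qed

text \<open>It is enough to check the points of finite level, since the condition is closed: each coordinate lies in a finite
union of closed intervals.\<close>

lemma cantor_product_coordinates:
  fixes v :: "nat \<Rightarrow> real^'n"
  assumes v: "orthonormal_frame v" and k: "k \<le> CARD('n)" and s: "\<And>i. i < k \<Longrightarrow> 0 < s i \<and> s i \<le> 1"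
    and r: "0 < r" and N: "\<And>i. i < k \<Longrightarrow> cantor_ratio (s i) ^ N i \<le> r"
    and y: "y \<in> cantor_product v k s" and i: "i < CARD('n)"
  shows "\<exists>c\<in>(if i < k then cantor (cantor_ratio (s i)) (N i) ` {..<2 ^ N i} else {0}). \<bar>y \<bullet> v i - c\<bar> \<le> r"
proof -
  let ?F = "if i < k then cantor (cantor_ratio (s i)) (N i) ` {..<2 ^ N i} else {0}"
  let ?T = "\<Union>c\<in>?F. {y. \<bar>y \<bullet> v i - c\<bar> \<le> r}"
  have "closed {y. \<bar>y \<bullet> v i - c\<bar> \<le> r}" for c
    by (intro closed_Collect_le continuous_intros)
  then have "closed ?T" by (intro closed_UN) auto
  moreover have "{cantor_point v k s M j | M j. \<forall>i<k. j i < 2 ^ M i} \<subseteq> ?T"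
  proof
    fix z assume "z \<in> {cantor_point v k s M j | M j. \<forall>i<k. j i < 2 ^ M i}"
    then obtain M j where z: "z = cantor_point v k s M j" and j: "\<forall>i<k. j i < 2 ^ M i" by blast
    have coord: "cantor_point v k s M j \<bullet> v i = (if i < k then cantor (cantor_ratio (s i)) (M i) (j i) else 0)"
      unfolding cantor_point_def by (rule frame_coordinate[OF v i k])
    have "\<exists>c\<in>?F. \<bar>cantor_point v k s M j \<bullet> v i - c\<bar> \<le> r"
    proof (cases "i < k")
      case True
      have "cantor_ratio (s i) \<le> 1" using cantor_ratio(2)[of "s i"] s[OF True] by simp
      then obtain l where "l < 2 ^ N i"
        "\<bar>cantor (cantor_ratio (s i)) (M i) (j i) - cantor (cantor_ratio (s i)) (N i) l\<bar> \<le> cantor_ratio (s i) ^ N i"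
        using cantor_level_approximation[of "cantor_ratio (s i)" "j i" "M i" "N i"] cantor_ratio(1)[of "s i"] s[OF True] j True by auto
      then show ?thesis using True N[OF True] by (auto simp: coord intro!: bexI[of _ l])
    qed (use r in \<open>simp add: coord\<close>)
    then show "z \<in> ?T" unfolding z by blast
  qed
  ultimately have "cantor_product v k s \<subseteq> ?T" unfolding cantor_product_def by (rule closure_minimal[rotated])
  with y show ?thesis by blast
qed

text \<open>At scale \<open>r\<close> the coordinate of index \<open>i\<close> needs about \<open>r powr (- s i)\<close> grid points, so about \<open>r powr (- d)\<close>
balls of radius proportional to \<open>\<delta> * r\<close> cover the scaled set, for arbitrarily small \<open>r\<close>.\<close>

lemma cantor_product_measure_le:
  fixes v :: "nat \<Rightarrow> real^'n"
  assumes v: "orthonormal_frame v" and k: "k \<le> CARD('n)" and s: "\<And>i. i < k \<Longrightarrow> 0 < s i \<and> s i \<le> 1"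
    and d: "d = (\<Sum>i<k. s i)" and \<delta>: "0 < \<delta>"
  shows "hausdorff_measure d ((\<lambda>y. x0 + \<delta> *\<^sub>R y) ` cantor_product v k s)
    \<le> ennreal (2 ^ CARD('n) * (2 * real CARD('n)) powr d * \<delta> powr d)"
  unfolding hausdorff_measure_eq_SUP
proof (rule SUP_least)
  let ?n = "CARD('n)" and ?l = "\<lambda>i. cantor_ratio (s i)"
  fix e :: real assume "e \<in> {0<..}"
  then have e: "0 < e" by simp
  \<comment> \<open>\<open>r < 1\<close> guarantees that each coordinate needs a level of at least one.\<close>
  define r where "r = min (1 / 2) (e / (2 * real ?n * \<delta>))"
  have r: "0 < r" "r < 1" using e \<delta> by (auto simp: r_def)
  have "r \<le> e / (2 * real ?n * \<delta>)" by (simp add: r_def)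
  then have re: "2 * real ?n * (\<delta> * r) \<le> e" using \<delta> by (simp add: field_simps)
  have "\<exists>N. ?l i ^ N \<le> r \<and> 2 ^ N \<le> 2 * r powr (- s i)" if i: "i < k" for i
  proof -
    have si: "0 < s i" "s i \<le> 1" using s[OF i] by auto
    obtain M where M: "?l i ^ Suc M \<le> r" "r < ?l i ^ M"
      using power_crossing[of "?l i" r] cantor_ratio[OF si] r by auto
    have "r powr s i \<le> (?l i ^ M) powr s i" using M(2) r si by (intro powr_mono2) auto
    then have "r powr s i \<le> (1 / 2) ^ M" by (simp only: cantor_ratio_power[OF si])
    then have "2 ^ M * r powr s i \<le> 1" by (simp add: field_simps)
    then have "2 ^ M \<le> r powr (- s i)" using r by (simp add: powr_minus field_simps)
    with M(1) show ?thesis by (intro exI[of _ "Suc M"]) simp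
  qed
  then obtain N where N: "\<And>i. i < k \<Longrightarrow> ?l i ^ N i \<le> r" "\<And>i. i < k \<Longrightarrow> 2 ^ N i \<le> 2 * r powr (- s i)"
    by metis
  define F where "F = (\<lambda>i. if i < k then cantor (?l i) (N i) ` {..<2 ^ N i} else {0})"
  have "\<exists>C\<in>ball_covers e ((\<lambda>y. x0 + \<delta> *\<^sub>R y) ` cantor_product v k s).
      cover_weight d C \<le> (\<Prod>i<?n. real (card ((\<lambda>c. \<delta> * c) ` F i))) * (2 * real ?n * (\<delta> * r)) powr d"
  proof (rule frame_grid_cover[OF v _ _ _ re, where ?x0.0 = x0])
    show "0 < \<delta> * r" using \<delta> r by simp
    show "finite ((\<lambda>c. \<delta> * c) ` F i)" for i by (simp add: F_def)
    fix x i assume "x \<in> (\<lambda>y. x0 + \<delta> *\<^sub>R y) ` cantor_product v k s" and i: "i < ?n"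
    then obtain y where y: "y \<in> cantor_product v k s" "x = x0 + \<delta> *\<^sub>R y" by blast
    obtain c where c: "c \<in> F i" "\<bar>y \<bullet> v i - c\<bar> \<le> r"
      using cantor_product_coordinates[OF v k s r(1) N(1) y(1) i] unfolding F_def by blast
    have "(x - x0) \<bullet> v i - \<delta> * c = \<delta> * (y \<bullet> v i - c)" by (simp add: y(2) algebra_simps)
    then have "\<bar>(x - x0) \<bullet> v i - \<delta> * c\<bar> \<le> \<delta> * r" using c(2) \<delta> by (simp add: abs_mult)
    with c(1) show "\<exists>c\<in>(\<lambda>c. \<delta> * c) ` F i. \<bar>(x - x0) \<bullet> v i - c\<bar> \<le> \<delta> * r" by blast
  qed
  then obtain C where C: "C \<in> ball_covers e ((\<lambda>y. x0 + \<delta> *\<^sub>R y) ` cantor_product v k s)"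
    "cover_weight d C \<le> (\<Prod>i<?n. real (card ((\<lambda>c. \<delta> * c) ` F i))) * (2 * real ?n * (\<delta> * r)) powr d" by blast
  have "(\<Prod>i<?n. real (card ((\<lambda>c. \<delta> * c) ` F i))) \<le> (\<Prod>i<?n. if i < k then 2 * r powr (- s i) else 1)"
  proof (intro prod_mono conjI)
    fix i assume "i \<in> {..<?n}"
    have "card ((\<lambda>c. \<delta> * c) ` F i) \<le> card (F i)" by (rule card_image_le) (simp add: F_def)
    also have "\<dots> \<le> (if i < k then 2 ^ N i else 1)"
      using card_image_le[of "{..<2 ^ N i}" "cantor (?l i) (N i)"] by (simp add: F_def)
    finally have "real (card ((\<lambda>c. \<delta> * c) ` F i)) \<le> real (if i < k then 2 ^ N i else 1)" by (simp only: of_nat_le_iff)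
    also have "\<dots> \<le> (if i < k then 2 * r powr (- s i) else 1)" using N(2)[of i] by simp
    finally show "real (card ((\<lambda>c. \<delta> * c) ` F i)) \<le> (if i < k then 2 * r powr (- s i) else 1)" .
  qed simp
  also have "\<dots> = (\<Prod>i<k. 2 * r powr (- s i))"
    using k by (intro prod.mono_neutral_cong_right) auto
  also have "\<dots> = 2 ^ k * r powr (- d)"
    using r by (simp add: prod.distrib d powr_sum[symmetric] sum_negf[symmetric])
  also have "\<dots> \<le> 2 ^ ?n * r powr (- d)" using k by (intro mult_right_mono power_increasing) auto
  finally have "cover_weight d C \<le> 2 ^ ?n * r powr (- d) * (2 * real ?n * (\<delta> * r)) powr d"
    using C(2) by (meson mult_right_mono order_trans powr_ge_zero)
  also have "\<dots> = 2 ^ ?n * (2 * real ?n) powr d * \<delta> powr d"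
    using r \<delta> by (simp add: powr_mult powr_minus field_simps)
  finally have "ennreal (cover_weight d C) \<le> ennreal (2 ^ ?n * (2 * real ?n) powr d * \<delta> powr d)" by (rule ennreal_leI)
  with hausdorff_pre_le[OF C(1)]
  show "hausdorff_pre d e ((\<lambda>y. x0 + \<delta> *\<^sub>R y) ` cantor_product v k s)
      \<le> ennreal (2 ^ ?n * (2 * real ?n) powr d * \<delta> powr d)" by (rule order_trans)
qed

text \<open>For a finite cover of the image choose a level \<open>N\<close> so fine that \<open>cantor_clustered_card\<close> applies to all its
balls. Points whose images lie in one ball of radius \<open>r\<close> differ by at most \<open>2 * r / \<tau> i\<close> in each coordinate,
so such a ball accounts for a fraction of at most a constant times \<open>r powr d\<close> over the product of the
\<open>\<tau> i powr s i\<close> of all level \<open>N\<close> points. The fractions add up to at least one.\<close>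

lemma cantor_product_image_measure_ge:
  fixes v :: "nat \<Rightarrow> real^'n" and G :: "real^'n \<Rightarrow> 'b::metric_space"
  assumes v: "orthonormal_frame v" and k: "k \<le> CARD('n)" and s: "\<And>i. i < k \<Longrightarrow> 0 < s i \<and> s i \<le> 1"
    and d: "d = (\<Sum>i<k. s i)" and \<tau>: "\<And>i. i < k \<Longrightarrow> 0 < \<tau> i"
    and G: "\<And>y z i. \<lbrakk>y \<in> cantor_product v k s; z \<in> cantor_product v k s; i < k\<rbrakk> \<Longrightarrow>
        \<tau> i * \<bar>(y - z) \<bullet> v i\<bar> \<le> dist (G y) (G z)"
  shows "ennreal ((\<Prod>i<k. \<tau> i powr s i) / (4 ^ k * 2 powr d)) \<le> hausdorff_measure d (G ` cantor_product v k s)"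
proof -
  let ?K = "cantor_product v k s" and ?l = "\<lambda>i. cantor_ratio (s i)"
  have "0 < \<tau> i powr s i" if "i < k" for i using \<tau>[OF that] by simp
  then have P0: "0 < (\<Prod>i<k. \<tau> i powr s i)" by (intro prod_pos) auto
  have "ennreal ((\<Prod>i<k. \<tau> i powr s i) / (4 ^ k * 2 powr d)) \<le> hausdorff_pre d 1 (G ` ?K)"
    unfolding hausdorff_pre_def
  proof (rule INF_greatest)
    fix C assume "C \<in> ball_covers 1 (G ` ?K)"
    then have fin: "finite C" and rad: "\<And>c r. (c, r) \<in> C \<Longrightarrow> 0 < r" and cov: "G ` ?K \<subseteq> (\<Union>(c, r)\<in>C. ball c r)"
      by (auto simp: ball_covers_def)
    have "\<forall>\<^sub>F N in sequentially. \<forall>c\<in>C. \<forall>i\<in>{..<k}. ?l i ^ N \<le> 2 * snd c / \<tau> i"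
    proof (intro eventually_ball_finite fin ballI finite_lessThan)
      fix c i assume c: "c \<in> C" and i: "i \<in> {..<k}"
      have "(\<lambda>N. ?l i ^ N) \<longlonglongrightarrow> 0"
        using cantor_ratio[of "s i"] s[of i] i by (intro LIMSEQ_power_zero) auto
      moreover have "0 < 2 * snd c / \<tau> i" using rad[of "fst c" "snd c"] c \<tau>[of i] i by simp
      ultimately have "\<forall>\<^sub>F N in sequentially. ?l i ^ N < 2 * snd c / \<tau> i" by (rule order_tendstoD(2))
      then show "\<forall>\<^sub>F N in sequentially. ?l i ^ N \<le> 2 * snd c / \<tau> i" by (rule eventually_mono) simp
    qed
    then obtain N where N: "\<And>c i. c \<in> C \<Longrightarrow> i < k \<Longrightarrow> ?l i ^ N \<le> 2 * snd c / \<tau> i"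
      by (auto simp: eventually_sequentially)
    define J where "J = PiE {..<k} (\<lambda>_. {..<2 ^ N :: nat})"
    define pt where "pt = cantor_point v k s (\<lambda>_. N)"
    have finJ: "finite J" by (simp add: J_def finite_PiE)
    have ptK: "pt j \<in> ?K" if "j \<in> J" for j
      unfolding pt_def cantor_product_def
      by (rule subsetD[OF closure_subset]) (use that in \<open>auto simp: J_def\<close>)
    have coord: "pt j \<bullet> v i = cantor (?l i) N (j i)" if "i < k" for i j
      unfolding pt_def cantor_point_def using frame_coordinate[OF v, of i k] k that by simp
    define B where "B = (\<lambda>c. {j \<in> J. G (pt j) \<in> ball (fst c) (snd c)})"
    have cardB: "real (card (B c)) \<le> (\<Prod>i<k. 4 * 2 ^ N * (2 * snd c / \<tau> i) powr s i)" if c: "c \<in> C" for c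
    proof -
      have "B c \<subseteq> PiE {..<k} (\<lambda>i. (\<lambda>j. j i) ` B c)" by (auto simp: B_def J_def PiE_iff extensional_def)
      then have "card (B c) \<le> card (PiE {..<k} (\<lambda>i. (\<lambda>j. j i) ` B c))"
        using finJ by (intro card_mono finite_PiE) (auto simp: B_def)
      also have "\<dots> = (\<Prod>i<k. card ((\<lambda>j. j i) ` B c))" by (simp add: card_PiE)
      finally have "real (card (B c)) \<le> real (\<Prod>i<k. card ((\<lambda>j. j i) ` B c))" by (simp only: of_nat_le_iff)
      also have "\<dots> = (\<Prod>i<k. real (card ((\<lambda>j. j i) ` B c)))" by simp
      also have "\<dots> \<le> (\<Prod>i<k. 4 * 2 ^ N * (2 * snd c / \<tau> i) powr s i)"
      proof (intro prod_mono conjI)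
        fix i assume "i \<in> {..<k}"
        then have i: "i < k" by simp
        show "real (card ((\<lambda>j. j i) ` B c)) \<le> 4 * 2 ^ N * (2 * snd c / \<tau> i) powr s i"
        proof (rule cantor_clustered_card)
          show "0 < s i" "s i \<le> 1" using s[OF i] by auto
          show "(\<lambda>j. j i) ` B c \<subseteq> {..<2 ^ N}" using i by (auto simp: B_def J_def PiE_iff)
          show "?l i ^ N \<le> 2 * snd c / \<tau> i" by (rule N[OF c i])
          fix a b assume "a \<in> (\<lambda>j. j i) ` B c" "b \<in> (\<lambda>j. j i) ` B c"
          then obtain j j' where j: "j \<in> B c" "a = j i" and j': "j' \<in> B c" "b = j' i" by blast
          have "\<tau> i * \<bar>(pt j - pt j') \<bullet> v i\<bar> \<le> dist (G (pt j)) (G (pt j'))"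
            using j j' i ptK by (intro G) (auto simp: B_def)
          also have "\<dots> \<le> dist (fst c) (G (pt j)) + dist (fst c) (G (pt j'))"
            by (rule dist_triangle3)
          also have "\<dots> \<le> 2 * snd c" using j(1) j'(1) by (simp add: B_def)
          finally show "\<bar>cantor (?l i) N a - cantor (?l i) N b\<bar> \<le> 2 * snd c / \<tau> i"
            using \<tau>[OF i] by (simp add: inner_diff_left coord[OF i] j(2) j'(2) field_simps)
        qed
      qed simp
      finally show ?thesis .
    qed
    have prod_eq: "(\<Prod>i<k. 4 * 2 ^ N * (2 * r / \<tau> i) powr s i)
        = (2 ^ N) ^ k * (4 ^ k * 2 powr d / (\<Prod>i<k. \<tau> i powr s i)) * r powr d" if r: "0 < r" for r
    proof -
      have "(\<Prod>i<k. 4 * 2 ^ N * (2 * r / \<tau> i) powr s i) = (\<Prod>i<k. 4 * 2 ^ N * ((2 * r) powr s i / \<tau> i powr s i))"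
        using \<tau> r by (intro prod.cong) (auto simp: powr_divide less_imp_le)
      also have "\<dots> = (4 * 2 ^ N) ^ k * ((\<Prod>i<k. (2 * r) powr s i) / (\<Prod>i<k. \<tau> i powr s i))"
        by (simp add: prod.distrib prod_dividef)
      also have "(\<Prod>i<k. (2 * r) powr s i) = (2 * r) powr d" using r by (simp add: d powr_sum)
      also have "(2 * r) powr d = 2 powr d * r powr d" using r by (simp add: powr_mult)
      finally show ?thesis by (simp add: power_mult_distrib)
    qed
    have "J \<subseteq> (\<Union>c\<in>C. B c)"
    proof
      fix j assume j: "j \<in> J"
      then have "G (pt j) \<in> (\<Union>(c, r)\<in>C. ball c r)" using ptK cov by blast
      then show "j \<in> (\<Union>c\<in>C. B c)" using j by (force simp: B_def)
    qed
    then have "card J \<le> card (\<Union>c\<in>C. B c)" using fin finJ by (intro card_mono) (auto simp: B_def)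
    also have "\<dots> \<le> (\<Sum>c\<in>C. card (B c))" by (rule card_UN_le[OF fin])
    finally have "real (card J) \<le> real (\<Sum>c\<in>C. card (B c))" by (simp only: of_nat_le_iff)
    also have "\<dots> = (\<Sum>c\<in>C. real (card (B c)))" by simp
    also have "\<dots> \<le> (\<Sum>c\<in>C. \<Prod>i<k. 4 * 2 ^ N * (2 * snd c / \<tau> i) powr s i)" using cardB by (rule sum_mono)
    also have "\<dots> = (\<Sum>c\<in>C. (2 ^ N) ^ k * (4 ^ k * 2 powr d / (\<Prod>i<k. \<tau> i powr s i)) * snd c powr d)"
      using rad by (intro sum.cong prod_eq) force+
    also have "\<dots> = (2 ^ N) ^ k * (4 ^ k * 2 powr d / (\<Prod>i<k. \<tau> i powr s i)) * cover_weight d C"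
      by (simp add: sum_distrib_left case_prod_beta)
    also have "real (card J) = (2 ^ N) ^ k" by (simp add: J_def card_PiE)
    finally have "(2 ^ N) ^ k * 1 \<le> (2 ^ N) ^ k * (4 ^ k * 2 powr d / (\<Prod>i<k. \<tau> i powr s i) * cover_weight d C)"
      by (simp only: mult_1_right mult.assoc)
    then have "1 \<le> 4 ^ k * 2 powr d / (\<Prod>i<k. \<tau> i powr s i) * cover_weight d C"
      by (rule mult_left_le_imp_le) simp
    then have "(\<Prod>i<k. \<tau> i powr s i) / (4 ^ k * 2 powr d) \<le> cover_weight d C"
      using P0 by (simp add: field_simps)
    then show "ennreal ((\<Prod>i<k. \<tau> i powr s i) / (4 ^ k * 2 powr d)) \<le> ennreal (cover_weight d C)" by (rule ennreal_leI)
  qed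
  also have "\<dots> \<le> hausdorff_measure d (G ` ?K)"
    unfolding hausdorff_measure_eq_SUP by (rule SUP_upper) simp
  finally show ?thesis .
qed

section \<open>The singular value function\<close>

lemma mat_bounded_below:
  fixes A :: "real^'n^'n"
  assumes "inj ((*v) A)"
  obtains \<kappa> where "0 < \<kappa>" "\<And>z. \<kappa> * norm z \<le> norm (A *v z)"
  using linear_inj_bounded_below_pos[OF matrix_vector_mul_linear assms] by blast

lemma mat_bounded_above:
  fixes A :: "real^'n^'n"
  obtains M where "0 < M" "\<And>z. norm (A *v z) \<le> M * norm z"
  using linear_bounded_pos[OF matrix_vector_mul_linear[of A]] by blast

lemma mat_inj_zero: "inj ((*v) A) \<Longrightarrow> z \<noteq> 0 \<Longrightarrow> A *v z \<noteq> 0" for A :: "real^'n^'n"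
  using linear_injective_0[OF matrix_vector_mul_linear[of A]] by blast

lemma singular_values_pos:
  fixes A :: "real^'n^'n"
  assumes "inj ((*v) A)" "i < CARD('n)"
  shows "0 < singular_values A ! i"
  by (rule singular_value_decomposition[OF mat_inj_zero[OF assms(1)]]) (use assms(2) in blast)+

lemma omega_pos:
  fixes A :: "real^'n^'n"
  assumes d: "0 < d" "d \<le> real CARD('n)" and A: "inj ((*v) A)"
  shows "0 < omega d A"
proof -
  obtain p where p: "p < CARD('n)" "real p < d" "d \<le> real p + 1" using index_of_dimension[OF d] .
  have pos: "0 < singular_values A ! i" if "i \<le> p" for i using singular_values_pos[OF A] p(1) that by simp
  then have "0 < (\<Prod>i<p. singular_values A ! i)" by (intro prod_pos) auto
  then show ?thesis unfolding omega_eq[OF p(2,3) less_imp_le[OF pos[OF order.refl]]] using pos[of p] by simp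
qed

lemma omega_le:
  fixes A :: "real^'n^'n"
  assumes d: "0 < d" "d \<le> real CARD('n)" and A: "inj ((*v) A)" and M: "\<And>z. norm (A *v z) \<le> M * norm z"
  shows "omega d A \<le> M powr d"
proof -
  let ?\<sigma> = "\<lambda>i. singular_values A ! i"
  obtain p where p: "p < CARD('n)" "real p < d" "d \<le> real p + 1" using index_of_dimension[OF d] .
  obtain v u where v: "orthonormal_frame v" and u: "orthonormal_frame u"
    and Av: "\<And>i. i < CARD('n) \<Longrightarrow> A *v v i = ?\<sigma> i *\<^sub>R u i"
    by (rule singular_value_decomposition[OF mat_inj_zero[OF A]]) blast+
  have pos: "0 < ?\<sigma> i" if "i < CARD('n)" for i using singular_values_pos[OF A that] .
  have le: "?\<sigma> i \<le> M" if "i < CARD('n)" for i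
    using M[of "v i"] pos[OF that] by (simp add: Av that frame_norm[OF v] frame_norm[OF u])
  have "0 < M" using le[OF p(1)] pos[OF p(1)] by linarith
  have "(\<Prod>i<p. ?\<sigma> i) \<le> (\<Prod>i<p. M)" using le pos p(1) by (intro prod_mono) (auto intro: less_imp_le)
  moreover have "?\<sigma> p powr (d - real p) \<le> M powr (d - real p)"
    using le[OF p(1)] pos[OF p(1)] p(2) by (intro powr_mono2) auto
  ultimately have "omega d A \<le> M ^ p * M powr (d - real p)"
    unfolding omega_eq[OF p(2,3) less_imp_le[OF pos[OF p(1)]]] using \<open>0 < M\<close> by (intro mult_mono) auto
  also have "\<dots> = M powr d" using \<open>0 < M\<close> by (simp add: powr_realpow[symmetric] powr_add[symmetric])
  finally show ?thesis .
qed

definition test_set_const :: "real \<Rightarrow> nat \<Rightarrow> real" where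
  "test_set_const d n = 2 ^ n * (2 * real n) powr d"

definition expansion_const :: "real \<Rightarrow> nat \<Rightarrow> real" where
  "expansion_const d n = 4 ^ n * 2 powr d"

lemma consts_pos:
  shows "0 < n \<Longrightarrow> 0 < test_set_const d n" and "0 < expansion_const d n"
  by (simp_all add: test_set_const_def expansion_const_def)

text \<open>The Cantor product has factors of dimension one along the first \<open>p\<close> right singular vectors and one factor of
dimension \<open>d - p\<close> along the next. Then \<open>A\<close> expands the coordinate of index \<open>i\<close> by the singular value of the
same index, and the product in \<open>cantor_product_image_measure_ge\<close> becomes \<open>omega d A\<close>.\<close>

lemma expanding_test_set:
  fixes A :: "real^'n^'n"
  assumes d: "0 < d" "d \<le> real CARD('n)" and A: "inj ((*v) A)"
  obtains K where "compact K" "K \<subseteq> cball 0 (real CARD('n))"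
    "\<forall>x0 \<delta>. 0 < \<delta> \<longrightarrow>
      hausdorff_measure d ((\<lambda>y. x0 + \<delta> *\<^sub>R y) ` K) \<le> ennreal (test_set_const d CARD('n) * \<delta> powr d)"
    "\<forall>(G :: real^'n \<Rightarrow> real^'n) \<rho>. 0 < \<rho> \<longrightarrow>
      (\<forall>y\<in>K. \<forall>z\<in>K. \<rho> * norm (A *v (y - z)) \<le> dist (G y) (G z)) \<longrightarrow>
      ennreal (\<rho> powr d * omega d A / expansion_const d CARD('n)) \<le> hausdorff_measure d (G ` K)"
proof -
  let ?n = "CARD('n)" and ?\<sigma> = "\<lambda>i. singular_values A ! i"
  obtain p where p: "p < ?n" "real p < d" "d \<le> real p + 1" using index_of_dimension[OF d] .
  obtain v u where v: "orthonormal_frame v" and u: "orthonormal_frame u"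
    and Av: "\<And>i. i < ?n \<Longrightarrow> A *v v i = ?\<sigma> i *\<^sub>R u i"
    by (rule singular_value_decomposition[OF mat_inj_zero[OF A]]) blast+
  have pos: "0 < ?\<sigma> i" if "i < ?n" for i using singular_values_pos[OF A that] .
  define s where "s = (\<lambda>i. if i < p then 1 else d - real p)"
  have s: "0 < s i \<and> s i \<le> 1" if "i < Suc p" for i using p by (simp add: s_def)
  have ds: "d = (\<Sum>i<Suc p. s i)" by (simp add: s_def)
  have k: "Suc p \<le> ?n" using p(1) by simp
  let ?K = "cantor_product v (Suc p) s"
  show ?thesis
  proof (rule that[of ?K])
    show "compact ?K" "?K \<subseteq> cball 0 (real ?n)" using cantor_product_bounded[OF v k s] by auto
    show "\<forall>x0 \<delta>. 0 < \<delta> \<longrightarrow>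
        hausdorff_measure d ((\<lambda>y. x0 + \<delta> *\<^sub>R y) ` ?K) \<le> ennreal (test_set_const d ?n * \<delta> powr d)"
      unfolding test_set_const_def using cantor_product_measure_le[OF v k s ds] by blast
  next
    show "\<forall>(G :: real^'n \<Rightarrow> real^'n) \<rho>. 0 < \<rho> \<longrightarrow>
      (\<forall>y\<in>?K. \<forall>z\<in>?K. \<rho> * norm (A *v (y - z)) \<le> dist (G y) (G z)) \<longrightarrow>
      ennreal (\<rho> powr d * omega d A / expansion_const d CARD('n)) \<le> hausdorff_measure d (G ` ?K)"
    proof (intro allI impI)
      fix G :: "real^'n \<Rightarrow> real^'n" and \<rho> :: real
      assume \<rho>: "0 < \<rho>" and G: "\<forall>y\<in>?K. \<forall>z\<in>?K. \<rho> * norm (A *v (y - z)) \<le> dist (G y) (G z)"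
      have "ennreal ((\<Prod>i<Suc p. (\<rho> * ?\<sigma> i) powr s i) / (4 ^ Suc p * 2 powr d)) \<le> hausdorff_measure d (G ` ?K)"
      proof (rule cantor_product_image_measure_ge[OF v k s ds])
        show "0 < \<rho> * ?\<sigma> i" if "i < Suc p" for i using pos[of i] \<rho> that k by simp
        fix y z i assume y: "y \<in> ?K" and z: "z \<in> ?K" and "i < Suc p"
        then have i: "i < ?n" using k by simp
        have "\<bar>(A *v (y - z)) \<bullet> u i\<bar> \<le> norm (A *v (y - z)) * norm (u i)" by (rule Cauchy_Schwarz_ineq2)
        then have "?\<sigma> i * \<bar>(y - z) \<bullet> v i\<bar> \<le> norm (A *v (y - z))"
          using pos[OF i] by (simp add: svd_coordinate[OF v u Av i] abs_mult frame_norm[OF u i])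
        then have "\<rho> * (?\<sigma> i * \<bar>(y - z) \<bullet> v i\<bar>) \<le> \<rho> * norm (A *v (y - z))"
          using \<rho> by (intro mult_left_mono) auto
        with G[rule_format, OF y z] show "\<rho> * ?\<sigma> i * \<bar>(y - z) \<bullet> v i\<bar> \<le> dist (G y) (G z)" by (simp only: mult.assoc)
      qed
      moreover have "\<rho> powr d * omega d A / expansion_const d ?n \<le> (\<Prod>i<Suc p. (\<rho> * ?\<sigma> i) powr s i) / (4 ^ Suc p * 2 powr d)"
      proof -
        have "(\<Prod>i<p. (\<rho> * ?\<sigma> i) powr s i) = (\<Prod>i<p. \<rho> * ?\<sigma> i)"
        proof (rule prod.cong)
          fix i assume "i \<in> {..<p}"
          then have "i < p" "0 < ?\<sigma> i" using pos[of i] p(1) by auto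
          then show "(\<rho> * ?\<sigma> i) powr s i = \<rho> * ?\<sigma> i" using \<rho> by (simp add: s_def)
        qed simp
        moreover have "(\<rho> * ?\<sigma> p) powr s p = \<rho> powr (d - real p) * ?\<sigma> p powr (d - real p)"
          using \<rho> pos[OF p(1)] by (simp add: s_def powr_mult)
        moreover have "\<rho> ^ p * \<rho> powr (d - real p) = \<rho> powr d"
          using \<rho> by (simp add: powr_realpow[symmetric] powr_add[symmetric])
        ultimately have eq: "(\<Prod>i<Suc p. (\<rho> * ?\<sigma> i) powr s i) = \<rho> powr d * omega d A"
          unfolding omega_eq[OF p(2,3) less_imp_le[OF pos[OF p(1)]]]
          by (simp add: prod.distrib mult_ac flip: \<open>\<rho> ^ p * \<rho> powr (d - real p) = \<rho> powr d\<close>)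
        have "4 ^ Suc p \<le> (4::real) ^ ?n" using k by (rule power_increasing) simp
        then have "4 ^ Suc p * 2 powr d \<le> expansion_const d ?n"
          unfolding expansion_const_def by (rule mult_right_mono) simp
        then show ?thesis
          unfolding eq using omega_pos[OF d A] \<rho> by (intro divide_left_mono) (auto intro!: mult_pos_pos simp: consts_pos)
      qed
      ultimately show "ennreal (\<rho> powr d * omega d A / expansion_const d ?n) \<le> hausdorff_measure d (G ` ?K)"
        using ennreal_leI order_trans by blast
    qed
  qed
qed

lemma linear_image_measure_le:
  fixes A :: "real^'n^'n"
  assumes d: "0 < d" "d \<le> real CARD('n)" and A: "inj ((*v) A)"
  shows "hausdorff_measure d ((*v) A ` K) \<le> ennreal (ellipsoid_const d CARD('n) * omega d A) * hausdorff_measure d K"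
proof -
  obtain \<kappa> where \<kappa>: "0 < \<kappa>" "\<And>z. \<kappa> * norm z \<le> norm (A *v z)" using mat_bounded_below[OF A] by blast
  obtain M where M: "0 < M" "\<And>z. norm (A *v z) \<le> M * norm z" using mat_bounded_above[of A] by blast
  show ?thesis
  proof (rule hausdorff_measure_image_le[OF d \<kappa>(1) M(1) omega_pos[OF d A], where A = "\<lambda>_. A"])
    show "\<exists>\<delta>>0. \<forall>x\<in>K. \<forall>y\<in>K. norm (y - x) < \<delta> \<longrightarrow> norm (A *v y - A *v x - A *v (y - x)) \<le> \<kappa> * norm (y - x)"
      using \<kappa>(1) by (intro exI[of _ 1]) (auto simp: matrix_vector_mult_diff_distrib)
  qed (use \<kappa> M in auto)
qed

definition submult_const :: "real \<Rightarrow> nat \<Rightarrow> real" where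
  "submult_const d n = expansion_const d n * (ellipsoid_const d n)\<^sup>2 * test_set_const d n"

lemma submult_const_pos: "0 < n \<Longrightarrow> 0 < submult_const d n"
  unfolding submult_const_def by (intro mult_pos_pos zero_less_power consts_pos ellipsoid_const_pos)

text \<open>The test set of \<open>A ** B\<close> has an image of measure at least proportional to \<open>omega d (A ** B)\<close>, whereas mapping
it first by \<open>B\<close> and then by \<open>A\<close> multiplies its measure at most by a constant times \<open>omega d A * omega d B\<close>.\<close>

lemma omega_submultiplicative:
  fixes A B :: "real^'n^'n"
  assumes d: "0 < d" "d \<le> real CARD('n)" and A: "inj ((*v) A)" and B: "inj ((*v) B)"
  shows "omega d (A ** B) \<le> submult_const d CARD('n) * omega d A * omega d B"
proof -
  let ?n = "CARD('n)"
  let ?E = "ellipsoid_const d ?n"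
  have comp: "(*v) (A ** B) = (*v) A \<circ> (*v) B" by (auto simp: matrix_vector_mul_assoc)
  have AB: "inj ((*v) (A ** B))" unfolding comp by (rule inj_compose[OF A B])
  have E: "0 < ?E" by (simp add: ellipsoid_const_pos)
  have \<omega>: "0 < omega d A" "0 < omega d B" using omega_pos[OF d] A B by auto
  obtain K :: "(real^'n) set" where
    K: "\<forall>x0 \<delta>. 0 < \<delta> \<longrightarrow> hausdorff_measure d ((\<lambda>y. x0 + \<delta> *\<^sub>R y) ` K) \<le> ennreal (test_set_const d ?n * \<delta> powr d)"
    and G: "\<forall>(G :: real^'n \<Rightarrow> real^'n) \<rho>. 0 < \<rho> \<longrightarrow>
      (\<forall>y\<in>K. \<forall>z\<in>K. \<rho> * norm ((A ** B) *v (y - z)) \<le> dist (G y) (G z)) \<longrightarrow>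
      ennreal (\<rho> powr d * omega d (A ** B) / expansion_const d ?n) \<le> hausdorff_measure d (G ` K)"
    by (rule expanding_test_set[OF d AB])
  have "ennreal (1 powr d * omega d (A ** B) / expansion_const d ?n) \<le> hausdorff_measure d ((*v) (A ** B) ` K)"
    by (rule G[rule_format]) (simp_all add: dist_norm matrix_vector_mult_diff_distrib)
  also have "\<dots> = hausdorff_measure d ((*v) A ` (*v) B ` K)" by (simp only: comp image_comp)
  also have "\<dots> \<le> ennreal (?E * omega d A) * hausdorff_measure d ((*v) B ` K)"
    by (rule linear_image_measure_le[OF d A])
  also have "\<dots> \<le> ennreal (?E * omega d A) * (ennreal (?E * omega d B) * hausdorff_measure d K)"
    by (intro mult_left_mono linear_image_measure_le[OF d B]) simp
  also have "\<dots> \<le> ennreal (?E * omega d A) * (ennreal (?E * omega d B) * ennreal (test_set_const d ?n))"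
    using K[rule_format, of 1 0] by (intro mult_left_mono) auto
  also have "\<dots> = ennreal (?E * omega d A * (?E * omega d B * test_set_const d ?n))"
    using E \<omega> consts_pos(1)[of ?n d] by (simp add: ennreal_mult[symmetric] less_imp_le)
  finally have "omega d (A ** B) / expansion_const d ?n \<le> ?E * omega d A * (?E * omega d B * test_set_const d ?n)"
    using E \<omega> consts_pos(1)[of ?n d] by (subst (asm) ennreal_le_iff) (auto intro!: mult_nonneg_nonneg)
  then show ?thesis
    using consts_pos(2)[of d ?n] by (simp add: submult_const_def power2_eq_square field_simps)
qed

text \<open>Write \<open>B\<close> as \<open>(B ** A') ** A\<close> with the inverse \<open>A'\<close> of \<open>A\<close>. Closeness makes \<open>B ** A'\<close> a matrix that expands
by at most two. This one-sided comparison takes the place of continuity of \<open>omega\<close>.\<close>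

lemma omega_perturbation:
  fixes A B :: "real^'n^'n"
  assumes d: "0 < d" "d \<le> real CARD('n)" and \<kappa>: "0 < \<kappa>"
    and A: "\<And>z. \<kappa> * norm z \<le> norm (A *v z)" and B: "inj ((*v) B)"
    and close: "\<And>z. norm (B *v z - A *v z) \<le> \<kappa> * norm z"
  shows "omega d B \<le> submult_const d CARD('n) * 2 powr d * omega d A"
proof -
  have A0: "z = 0" if "A *v z = 0" for z using A[of z] \<kappa> that by (simp add: mult_le_0_iff)
  have injA: "inj ((*v) A)" using A0 linear_injective_0[OF matrix_vector_mul_linear[of A]] by blast
  then obtain A' where A': "A' ** A = mat 1" using matrix_left_invertible_injective[of A] by blast
  then have AA': "A ** A' = mat 1" by (simp add: matrix_left_right_inverse)
  have AA'z: "A *v (A' *v z) = z" for z by (simp add: matrix_vector_mul_assoc AA')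
  have "inj ((*v) A')" using AA'z by (metis injI)
  then have injE: "inj ((*v) (B ** A'))"
    using B inj_compose[of "(*v) B" "(*v) A'"] by (simp add: o_def matrix_vector_mul_assoc)
  have eq: "(B ** A') ** A = B" by (simp add: matrix_mul_assoc[symmetric] A')
  have E: "norm ((B ** A') *v z) \<le> 2 * norm z" for z
  proof -
    let ?y = "A' *v z"
    have "norm (B *v ?y) \<le> norm (A *v ?y) + norm (B *v ?y - A *v ?y)"
      using norm_triangle_ineq[of "A *v ?y" "B *v ?y - A *v ?y"] by simp
    also have "\<dots> \<le> norm z + norm z"
      using close[of ?y] A[of ?y] by (simp add: AA'z)
    finally show ?thesis by (simp add: matrix_vector_mul_assoc)
  qed
  have "omega d B \<le> submult_const d CARD('n) * omega d (B ** A') * omega d A"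
    using omega_submultiplicative[OF d injE injA] by (simp add: eq)
  also have "\<dots> \<le> submult_const d CARD('n) * 2 powr d * omega d A"
    using omega_le[OF d injE E] submult_const_pos[of "CARD('n)" d] omega_pos[OF d injA]
    by (intro mult_right_mono mult_left_mono) auto
  finally show ?thesis .
qed

section \<open>The linearised flow\<close>

locale euclidean_flow = invariant_flow f X U R L
  for f :: "real^'n \<Rightarrow> real^'n" and X U :: "(real^'n) set" and R L :: real +
  fixes d :: real
  assumes d: "0 < d" "d \<le> real CARD('n)"
begin

abbreviation J :: "real \<Rightarrow> real^'n \<Rightarrow> real^'n^'n" where
  "J T x \<equiv> jacobian (\<phi> T) (at x)"

lemma J_apply:
  assumes "0 \<le> T" "x \<in> X"
  shows "J T x *v z = D T x z"
proof -
  have "\<phi> T differentiable (at x)" using flow_has_derivative[OF assms] by (rule differentiableI)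
  then have "(\<phi> T has_derivative (\<lambda>h. J T x *v h)) (at x)" by (simp only: jacobian_works)
  from frechet_derivative_at[OF this] show ?thesis by (rule fun_cong)
qed

lemma J_bounds:
  assumes "0 \<le> T" "x \<in> X"
  shows "norm (J T x *v z) \<le> exp (L * T) * norm z" "exp (- L * T) * norm z \<le> norm (J T x *v z)"
  using D_bounds[OF assms, of z] by (simp_all add: J_apply[OF assms])

lemma J_inj:
  assumes "0 \<le> T" "x \<in> X"
  shows "inj ((*v) (J T x))"
proof -
  have "z = 0" if "J T x *v z = 0" for z
    using J_bounds(2)[OF assms, of z] that by (simp add: mult_le_0_iff)
  then show ?thesis using linear_injective_0[OF matrix_vector_mul_linear[of "J T x"]] by blast
qed

lemma J_cocycle:
  assumes "0 \<le> s" "0 \<le> t" "x \<in> X"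
  shows "J (s + t) x = J t (\<phi> s x) ** J s x"
proof -
  have "J (s + t) x *v z = (J t (\<phi> s x) ** J s x) *v z" for z
  proof -
    have "J (s + t) x *v z = D (s + t) x z" using assms by (intro J_apply) auto
    also have "\<dots> = D t (\<phi> s x) (D s x z)" by (simp add: D_cocycle[OF assms])
    also have "\<dots> = J t (\<phi> s x) *v (J s x *v z)"
      by (simp only: J_apply[OF assms(2) flow_in_X[OF assms(3,1)]] J_apply[OF assms(1,3)])
    finally show ?thesis by (simp only: matrix_vector_mul_assoc)
  qed
  then show ?thesis by (simp add: matrix_eq)
qed

abbreviation \<omega> :: "real \<Rightarrow> real^'n \<Rightarrow> real" where "\<omega> T x \<equiv> omega d (J T x)"

lemma \<omega>_pos: "0 \<le> T \<Longrightarrow> x \<in> X \<Longrightarrow> 0 < \<omega> T x"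
  by (rule omega_pos[OF d J_inj])

lemma \<omega>_le: "0 \<le> T \<Longrightarrow> x \<in> X \<Longrightarrow> \<omega> T x \<le> exp (L * T) powr d"
  by (rule omega_le[OF d J_inj J_bounds(1)])

text \<open>At least one, so that a bound for \<open>cocycle_const * \<omega> T x\<close> is also a bound for \<open>\<omega> T x\<close>.\<close>

definition cocycle_const :: real where "cocycle_const = max 1 (submult_const d CARD('n))"

lemma cocycle_const_ge_1: "1 \<le> cocycle_const" by (simp add: cocycle_const_def)

lemma \<omega>_cocycle:
  assumes "0 \<le> s" "0 \<le> t" "x \<in> X"
  shows "\<omega> (s + t) x \<le> cocycle_const * \<omega> t (\<phi> s x) * \<omega> s x"
proof -
  have y: "\<phi> s x \<in> X" using flow_in_X assms by blast
  have "\<omega> (s + t) x \<le> submult_const d CARD('n) * \<omega> t (\<phi> s x) * \<omega> s x"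
    unfolding J_cocycle[OF assms] by (rule omega_submultiplicative[OF d J_inj[OF assms(2) y] J_inj[OF assms(1,3)]])
  also have "\<dots> \<le> cocycle_const * \<omega> t (\<phi> s x) * \<omega> s x"
    using \<omega>_pos[OF assms(2) y] \<omega>_pos[OF assms(1,3)] by (intro mult_right_mono) (auto simp: cocycle_const_def)
  finally show ?thesis .
qed

lemma \<omega>_near:
  assumes T: "0 \<le> T"
  obtains \<delta> where "0 < \<delta>" "\<And>x y. \<lbrakk>x \<in> X; y \<in> X; norm (y - x) < \<delta>\<rbrakk> \<Longrightarrow> \<omega> T y \<le> cocycle_const * 2 powr d * \<omega> T x"
proof -
  obtain \<delta> where \<delta>: "0 < \<delta>"
    "\<And>a b v. \<lbrakk>a \<in> X; b \<in> X; norm (b - a) < \<delta>\<rbrakk> \<Longrightarrow> norm (D T b v - D T a v) \<le> exp (- L * T) * norm v"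
    using D_uniformly_continuous[OF T exp_gt_zero] by metis
  show ?thesis
  proof (rule that[OF \<delta>(1)])
    fix x y assume x: "x \<in> X" and y: "y \<in> X" and xy: "norm (y - x) < \<delta>"
    have "\<omega> T y \<le> submult_const d CARD('n) * 2 powr d * \<omega> T x"
      by (rule omega_perturbation[OF d exp_gt_zero J_bounds(2)[OF T x] J_inj[OF T y]])
         (use \<delta>(2)[OF x y xy] in \<open>simp add: J_apply[OF T x] J_apply[OF T y]\<close>)
    also have "\<dots> \<le> cocycle_const * 2 powr d * \<omega> T x"
      using \<omega>_pos[OF T x] by (intro mult_right_mono) (auto simp: cocycle_const_def)
    finally show "\<omega> T y \<le> cocycle_const * 2 powr d * \<omega> T x" .
  qed
qed

lemma image_measure_le:
  assumes T: "0 \<le> T" and w: "0 < w" "\<And>x. x \<in> X \<Longrightarrow> \<omega> T x \<le> w" and K: "K \<subseteq> X"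
  shows "hausdorff_measure d (\<phi> T ` K) \<le> ennreal (ellipsoid_const d CARD('n) * w) * hausdorff_measure d K"
proof (rule hausdorff_measure_image_le[OF d _ _ w(1), where A = "J T"])
  show "exp (- L * T) * norm z \<le> norm (J T x *v z)" "norm (J T x *v z) \<le> exp (L * T) * norm z"
    "\<omega> T x \<le> w" if "x \<in> K" for x z
    using J_bounds[OF T] w(2) that K by auto
  obtain \<delta> where \<delta>: "0 < \<delta>"
    "\<forall>a\<in>X. \<forall>h. norm h < \<delta> \<longrightarrow> norm (\<phi> T (a + h) - \<phi> T a - D T a h) \<le> exp (- L * T) * norm h"
    using flow_uniform_expansion[OF T exp_gt_zero] by blast
  have "norm (\<phi> T y - \<phi> T x - J T x *v (y - x)) \<le> exp (- L * T) * norm (y - x)"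
    if "x \<in> K" "norm (y - x) < \<delta>" for x y
    using \<delta>(2)[rule_format, of x "y - x"] that K by (simp add: J_apply[OF T] subset_iff)
  with \<delta>(1) show "\<exists>\<delta>>0. \<forall>x\<in>K. \<forall>y\<in>K. norm (y - x) < \<delta> \<longrightarrow>
      norm (\<phi> T y - \<phi> T x - J T x *v (y - x)) \<le> exp (- L * T) * norm (y - x)" by blast
qed auto

definition contraction_const :: real where
  "contraction_const = test_set_const d CARD('n) * expansion_const d CARD('n) * 2 powr d"

lemma contraction_const_pos: "0 < contraction_const"
  unfolding contraction_const_def by (intro mult_pos_pos consts_pos) auto

text \<open>A small copy \<open>x + \<delta> *\<^sub>R K\<close> of the test set of \<open>J T x\<close> lies in \<open>X\<close>, and on it \<open>\<phi> T\<close> expands distances at least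
half as much as \<open>J T x\<close> does. Its measure and that of its image are both proportional to \<open>\<delta> powr d\<close>, so
\<open>\<delta>\<close> cancels.\<close>

lemma \<omega>_le_at_interior:
  assumes T: "0 \<le> T" and \<epsilon>: "0 < \<epsilon>" and x: "x \<in> interior X"
    and contr: "\<And>K. compact K \<Longrightarrow> K \<subseteq> X \<Longrightarrow> hausdorff_measure d K < \<infinity> \<Longrightarrow>
        hausdorff_measure d (\<phi> T ` K) \<le> ennreal \<epsilon> * hausdorff_measure d K"
  shows "\<omega> T x \<le> contraction_const * \<epsilon>"
proof -
  let ?n = "CARD('n)" and ?A = "J T x"
  have xX: "x \<in> X" using x interior_subset by blast
  define \<kappa> where "\<kappa> = exp (- L * T)"
  have \<kappa>: "0 < \<kappa> / 4" by (simp add: \<kappa>_def)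
  obtain r where r: "0 < r" "ball x r \<subseteq> X" using x by (auto simp: mem_interior)
  obtain \<delta>1 where \<delta>1: "0 < \<delta>1"
    "\<forall>a\<in>X. \<forall>h. norm h < \<delta>1 \<longrightarrow> norm (\<phi> T (a + h) - \<phi> T a - D T a h) \<le> \<kappa> / 4 * norm h"
    using flow_uniform_expansion[OF T \<kappa>] by blast
  obtain \<delta>2 where \<delta>2: "0 < \<delta>2"
    "\<And>a b v. \<lbrakk>a \<in> X; b \<in> X; norm (b - a) < \<delta>2\<rbrakk> \<Longrightarrow> norm (D T b v - D T a v) \<le> \<kappa> / 4 * norm v"
    using D_uniformly_continuous[OF T \<kappa>] by metis
  define b where "b = min r (min (\<delta>1 / 2) \<delta>2)"
  have b: "0 < b" "b \<le> r" "b \<le> \<delta>1 / 2" "b \<le> \<delta>2" using r(1) \<delta>1(1) \<delta>2(1) by (auto simp: b_def)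
  define \<delta> where "\<delta> = b / (2 * real ?n)"
  have \<delta>: "0 < \<delta>" using b(1) by (simp add: \<delta>_def)
  obtain K where K: "compact K" "K \<subseteq> cball 0 (real ?n)"
    and up: "\<forall>x0 \<delta>. 0 < \<delta> \<longrightarrow> hausdorff_measure d ((\<lambda>y. x0 + \<delta> *\<^sub>R y) ` K) \<le> ennreal (test_set_const d ?n * \<delta> powr d)"
    and low: "\<forall>(G :: real^'n \<Rightarrow> real^'n) \<rho>. 0 < \<rho> \<longrightarrow>
      (\<forall>y\<in>K. \<forall>z\<in>K. \<rho> * norm (?A *v (y - z)) \<le> dist (G y) (G z)) \<longrightarrow>
      ennreal (\<rho> powr d * omega d ?A / expansion_const d ?n) \<le> hausdorff_measure d (G ` K)"
    by (rule expanding_test_set[OF d J_inj[OF T xX]])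
  let ?h = "\<lambda>y. x + \<delta> *\<^sub>R y"
  have near: "norm (\<delta> *\<^sub>R y) < b" if "y \<in> K" for y
  proof -
    have "norm y \<le> real ?n" using K(2) that by auto
    then have "\<delta> * norm y \<le> \<delta> * real ?n" using \<delta> by (intro mult_left_mono) auto
    also have "\<dots> = b / 2" by (simp add: \<delta>_def)
    finally show ?thesis using \<delta> b(1) by simp
  qed
  have KX: "?h ` K \<subseteq> X"
  proof (rule image_subsetI)
    fix y assume "y \<in> K"
    then have "?h y \<in> ball x r" using near[of y] b(2) by (simp add: dist_norm)
    then show "?h y \<in> X" using r(2) by blast
  qed
  have expand: "\<delta> / 2 * norm (?A *v (y - z)) \<le> dist (\<phi> T (?h y)) (\<phi> T (?h z))" if y: "y \<in> K" and z: "z \<in> K" for y z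
  proof -
    define h where "h = \<delta> *\<^sub>R (y - z)"
    have zX: "?h z \<in> X" using KX z by blast
    have "norm h \<le> norm (\<delta> *\<^sub>R y) + norm (\<delta> *\<^sub>R z)"
      unfolding h_def scaleR_right_diff_distrib by (rule norm_triangle_ineq4)
    then have "norm h < \<delta>1" using near[OF y] near[OF z] b(3) by linarith
    then have "norm (\<phi> T (?h z + h) - \<phi> T (?h z) - D T (?h z) h) \<le> \<kappa> / 4 * norm h"
      using \<delta>1(2) zX by blast
    moreover have "?h z + h = ?h y" by (simp add: h_def algebra_simps)
    moreover have "norm (D T (?h z) h - D T x h) \<le> \<kappa> / 4 * norm h"
      using near[OF z] b(4) by (intro \<delta>2(2) xX zX) simp
    moreover have "\<kappa> * norm h \<le> norm (D T x h)" using D_bounds(2)[OF T xX, of h] by (simp add: \<kappa>_def)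
    moreover have "norm (D T x h) \<le> norm (\<phi> T (?h y) - \<phi> T (?h z)) +
        norm (\<phi> T (?h y) - \<phi> T (?h z) - D T (?h z) h) + norm (D T (?h z) h - D T x h)"
    proof -
      have *: "norm p \<le> norm q + norm (q - p') + norm (p' - p)" for p p' q :: "real^'n"
        using norm_triangle_ineq4[of q "q - p'"] norm_triangle_ineq4[of p' "p' - p"] by simp
      show ?thesis by (rule *)
    qed
    ultimately have "norm (D T x h) / 2 \<le> norm (\<phi> T (?h y) - \<phi> T (?h z))" by simp
    moreover have "norm (D T x h) = \<delta> * norm (?A *v (y - z))"
      using \<delta> by (simp add: J_apply[OF T xX, symmetric] h_def matrix_vector_mult_scaleR)
    ultimately show ?thesis by (simp add: dist_norm)
  qed
  have "ennreal ((\<delta> / 2) powr d * \<omega> T x / expansion_const d ?n) \<le> hausdorff_measure d ((\<lambda>y. \<phi> T (?h y)) ` K)"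
    using low[rule_format, of "\<delta> / 2" "\<lambda>y. \<phi> T (?h y)"] expand \<delta> by simp
  also have "\<dots> = hausdorff_measure d (\<phi> T ` ?h ` K)" by (simp only: image_image)
  also have "\<dots> \<le> ennreal \<epsilon> * hausdorff_measure d (?h ` K)"
  proof (rule contr[OF _ KX])
    show "compact (?h ` K)" by (intro compact_continuous_image continuous_intros K)
    show "hausdorff_measure d (?h ` K) < \<infinity>"
      using up[rule_format, OF \<delta>, of x] by (simp add: le_less_trans ennreal_less_top)
  qed
  also have "\<dots> \<le> ennreal \<epsilon> * ennreal (test_set_const d ?n * \<delta> powr d)"
    by (intro mult_left_mono up[rule_format, OF \<delta>]) simp
  also have "\<dots> = ennreal (\<epsilon> * (test_set_const d ?n * \<delta> powr d))"
    using \<epsilon> consts_pos(1)[of ?n d] by (simp add: ennreal_mult[symmetric] less_imp_le)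
  finally have "(\<delta> / 2) powr d * \<omega> T x / expansion_const d ?n \<le> \<epsilon> * (test_set_const d ?n * \<delta> powr d)"
    using \<epsilon> consts_pos(1)[of ?n d] by (subst (asm) ennreal_le_iff) (auto intro!: mult_nonneg_nonneg)
  moreover have "(\<delta> / 2) powr d = \<delta> powr d / 2 powr d" using \<delta> by (simp add: powr_divide)
  moreover have "0 < \<delta> powr d" "0 < expansion_const d ?n" using \<delta> consts_pos(2)[of d ?n] by auto
  ultimately show ?thesis by (simp add: contraction_const_def field_simps)
qed

lemma contractive_imp_\<omega>_le:
  assumes T: "0 \<le> T" and \<epsilon>: "0 < \<epsilon>" and dense: "X = closure (interior X)" and x: "x \<in> X"
    and contr: "\<And>K. compact K \<Longrightarrow> K \<subseteq> X \<Longrightarrow> hausdorff_measure d K < \<infinity> \<Longrightarrow>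
        hausdorff_measure d (\<phi> T ` K) \<le> ennreal \<epsilon> * hausdorff_measure d K"
  shows "\<omega> T x \<le> cocycle_const * 2 powr d * (contraction_const * \<epsilon>)"
proof -
  obtain \<delta> where \<delta>: "0 < \<delta>" "\<And>x y. \<lbrakk>x \<in> X; y \<in> X; norm (y - x) < \<delta>\<rbrakk> \<Longrightarrow> \<omega> T y \<le> cocycle_const * 2 powr d * \<omega> T x"
    using \<omega>_near[OF T] by blast
  have "x \<in> closure (interior X)" using x dense by simp
  then obtain y where y: "y \<in> interior X" "dist y x < \<delta>" using \<delta>(1) unfolding closure_approachable by blast
  then have yX: "y \<in> X" using interior_subset by blast
  have "\<omega> T x \<le> cocycle_const * 2 powr d * \<omega> T y" using y(2) by (intro \<delta>(2) yX x) (simp add: dist_norm norm_minus_commute)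
  also have "\<dots> \<le> cocycle_const * 2 powr d * (contraction_const * \<epsilon>)"
    using \<omega>_le_at_interior[OF T \<epsilon> y(1) contr] cocycle_const_ge_1 by (intro mult_left_mono) auto
  finally show ?thesis .
qed

section \<open>Contraction and exponential decay\<close>

lemma \<omega>_iterate:
  assumes T: "0 \<le> T" and half: "\<And>x. x \<in> X \<Longrightarrow> cocycle_const * \<omega> T x \<le> 1 / 2" and x: "x \<in> X"
  shows "cocycle_const * \<omega> (real (Suc k) * T) x \<le> (1 / 2) ^ Suc k"
  using x
proof (induction k arbitrary: x)
  case (Suc k)
  let ?y = "\<phi> T x" and ?t = "real (Suc k) * T"
  have y: "?y \<in> X" using flow_in_X[OF Suc.prems T] .
  have t: "0 \<le> ?t" using T by simp
  have C0: "0 \<le> cocycle_const" using cocycle_const_ge_1 by simp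
  have "T + ?t = real (Suc (Suc k)) * T" by (simp add: algebra_simps)
  then have "cocycle_const * \<omega> (real (Suc (Suc k)) * T) x \<le> cocycle_const * (cocycle_const * \<omega> ?t ?y * \<omega> T x)"
    using \<omega>_cocycle[OF T t Suc.prems] C0 by (intro mult_left_mono) auto
  also have "\<dots> = (cocycle_const * \<omega> ?t ?y) * (cocycle_const * \<omega> T x)" by (simp only: mult_ac)
  also have "\<dots> \<le> (1 / 2) ^ Suc k * (1 / 2)"
    using Suc.IH[OF y] half[OF Suc.prems] C0 \<omega>_pos[OF T Suc.prems]
    by (intro mult_mono) (auto simp del: of_nat_Suc power_Suc)
  finally show ?case by (simp only: power_Suc2)
qed (use half in simp)

text \<open>A time \<open>t \<ge> T0\<close> is \<open>Suc k\<close> times some \<open>T \<ge> T0\<close>, where \<open>Suc k\<close> is the integer part of \<open>t / T0\<close> and thus at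
least \<open>t / (2 * T0)\<close>. Since \<open>\<omega>\<close> is at most one half, up to the constant, at every such \<open>T\<close> and not just at
\<open>T0\<close>, the division by \<open>Suc k\<close> leaves no remainder to estimate.\<close>

lemma contractive_imp_Sigma_negative:
  assumes uc: "uniformly_contractive d f X" and dense: "X = closure (interior X)"
  shows "Sigma_exponent d f X < 0"
proof -
  define c where "c = cocycle_const * (cocycle_const * 2 powr d * contraction_const)"
  have c: "0 < c" using cocycle_const_ge_1 contraction_const_pos by (simp add: c_def)
  define \<epsilon> where "\<epsilon> = min (1 / 2) (1 / (2 * c))"
  have \<epsilon>: "0 < \<epsilon>" "\<epsilon> < 1" using c by (auto simp: \<epsilon>_def)
  then obtain T0 where T0: "0 < T0" and contr: "\<And>K T. \<lbrakk>T0 \<le> T; compact K; K \<subseteq> X; hausdorff_measure d K < \<infinity>\<rbrakk> \<Longrightarrow>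
      hausdorff_measure d (\<phi> T ` K) \<le> ennreal \<epsilon> * hausdorff_measure d K"
    using uc unfolding uniformly_contractive_def by (metis greaterThanLessThan_iff)
  have half: "cocycle_const * \<omega> T x \<le> 1 / 2" if T: "T0 \<le> T" and x: "x \<in> X" for T x
  proof -
    have "\<omega> T x \<le> cocycle_const * 2 powr d * (contraction_const * \<epsilon>)"
      using T T0 by (intro contractive_imp_\<omega>_le[OF _ \<epsilon>(1) dense x] contr) auto
    then have "cocycle_const * \<omega> T x \<le> cocycle_const * (cocycle_const * 2 powr d * (contraction_const * \<epsilon>))" using cocycle_const_ge_1 by (intro mult_left_mono) auto
    also have "\<dots> = c * \<epsilon>" by (simp only: c_def mult_ac)
    also have "\<dots> \<le> c * (1 / (2 * c))" using c by (intro mult_left_mono) (auto simp: \<epsilon>_def)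
    also have "\<dots> = 1 / 2" using c by simp
    finally show ?thesis .
  qed
  have decay: "1 / t * ln (\<omega> t x) \<le> - (ln 2 / (2 * T0))" if t: "T0 \<le> t" and x: "x \<in> X" for t x
  proof -
    define k where "k = nat \<lfloor>t / T0\<rfloor> - 1"
    have "1 \<le> t / T0" using t T0 by simp
    then have fl: "1 \<le> \<lfloor>t / T0\<rfloor>" by simp
    then have k: "real (Suc k) = real_of_int \<lfloor>t / T0\<rfloor>" by (simp add: k_def of_nat_diff)
    have k1: "real (Suc k) \<le> t / T0" and k2: "t / T0 \<le> 2 * real (Suc k)"
      unfolding k using fl by linarith+
    define T where "T = t / real (Suc k)"
    have T: "T0 \<le> T" using k1 T0 by (simp add: T_def field_simps del: of_nat_Suc)
    have tT: "real (Suc k) * T = t" by (simp add: T_def del: of_nat_Suc)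
    have t0: "0 \<le> t" "0 < t" using t T0 by auto
    have w0: "0 < \<omega> t x" by (rule \<omega>_pos[OF t0(1) x])
    have "\<omega> t x \<le> cocycle_const * \<omega> t x" using cocycle_const_ge_1 w0 by simp
    also have "\<dots> \<le> (1 / 2) ^ Suc k"
      using \<omega>_iterate[of T x k] T T0 half[OF T] x unfolding tT by simp
    finally have "ln (\<omega> t x) \<le> ln ((1 / 2) ^ Suc k)" using w0 by simp
    also have "\<dots> = - (real (Suc k) * ln 2)" by (simp add: ln_realpow ln_div algebra_simps)
    also have "\<dots> \<le> - (t / T0 / 2 * ln 2)" using k2 by (intro le_imp_neg_le mult_right_mono) auto
    finally have "1 / t * ln (\<omega> t x) \<le> 1 / t * - (t / T0 / 2 * ln 2)"
      using t0 by (intro mult_left_mono) auto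
    also have "\<dots> = - (ln 2 / (2 * T0))" using t0 T0 by (simp add: field_simps)
    finally show ?thesis .
  qed
  have "Sigma_exponent d f X \<le> ereal (- (ln 2 / (2 * T0)))"
    unfolding Sigma_exponent_def
  proof (rule SUP_least, rule Limsup_bounded)
    fix x assume "x \<in> X"
    then show "\<forall>\<^sub>F t in at_top. ereal (1 / t * ln (\<omega> t x)) \<le> ereal (- (ln 2 / (2 * T0)))"
      using decay unfolding eventually_at_top_linorder by (intro exI[of _ T0]) (auto simp del: times_divide_eq_left)
  qed
  also have "\<dots> < 0" using T0 by simp
  finally show ?thesis .
qed

text \<open>The exponential decay at a single point beats all constants at some time, and \<open>\<omega>_near\<close> carries the resulting
bound to a neighbourhood; compactness leaves finitely many times.\<close>

lemma Sigma_negative_imp_uniform_return: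
  assumes S: "Sigma_exponent d f X < 0"
  obtains \<tau> where "1 \<le> \<tau>" "\<And>y. y \<in> X \<Longrightarrow> \<exists>t. 1 \<le> t \<and> t \<le> \<tau> \<and> cocycle_const * \<omega> t y \<le> 1 / 2"
proof -
  obtain z where z: "Sigma_exponent d f X < ereal z" "z < 0"
    using ereal_dense2[OF S] by auto
  define c where "c = cocycle_const * (cocycle_const * 2 powr d)"
  have c: "0 < c" using cocycle_const_ge_1 by (simp add: c_def)
  have near_x: "\<exists>t \<delta>. 1 \<le> t \<and> 0 < \<delta> \<and> (\<forall>y\<in>X. norm (y - x) < \<delta> \<longrightarrow> cocycle_const * \<omega> t y \<le> 1 / 2)" if x: "x \<in> X" for x
  proof -
    have "Limsup at_top (\<lambda>t. ereal (1 / t * ln (\<omega> t x))) \<le> Sigma_exponent d f X"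
      unfolding Sigma_exponent_def using x by (rule SUP_upper)
    then have "\<forall>\<^sub>F t in at_top. ereal (1 / t * ln (\<omega> t x)) < ereal z"
      using z(1) by (intro Limsup_lessD) (rule le_less_trans)
    then have "\<forall>\<^sub>F t in at_top. ereal (1 / t * ln (\<omega> t x)) < ereal z \<and> 1 \<le> t \<and> ln (2 * c) / (- z) \<le> t"
      by (intro eventually_conj eventually_ge_at_top)
    then obtain t where t: "1 / t * ln (\<omega> t x) < z" "1 \<le> t" "ln (2 * c) / (- z) \<le> t"
      using eventually_happens'[OF trivial_limit_at_top_linorder] by auto
    have t0: "0 \<le> t" using t(2) by simp
    have w0: "0 < \<omega> t x" by (rule \<omega>_pos[OF t0 x])
    have "ln (\<omega> t x) < z * t" using t(1,2) by (simp add: field_simps)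
    also have "z * t \<le> - ln (2 * c)" using t(3) z(2) by (simp add: field_simps)
    also have "- ln (2 * c) = ln (1 / (2 * c))" using c by (simp add: ln_div)
    finally have wc: "\<omega> t x < 1 / (2 * c)" using w0 c by simp
    obtain \<delta> where \<delta>: "0 < \<delta>" "\<And>x y. \<lbrakk>x \<in> X; y \<in> X; norm (y - x) < \<delta>\<rbrakk> \<Longrightarrow> \<omega> t y \<le> cocycle_const * 2 powr d * \<omega> t x"
      using \<omega>_near[OF t0] by blast
    have "cocycle_const * \<omega> t y \<le> 1 / 2" if "y \<in> X" "norm (y - x) < \<delta>" for y
    proof -
      have "cocycle_const * \<omega> t y \<le> cocycle_const * (cocycle_const * 2 powr d * \<omega> t x)"
        using \<delta>(2)[OF x that] cocycle_const_ge_1 by (intro mult_left_mono) auto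
      also have "\<dots> = c * \<omega> t x" by (simp only: c_def mult_ac)
      also have "\<dots> \<le> c * (1 / (2 * c))" using wc c by (intro mult_left_mono) auto
      also have "\<dots> = 1 / 2" using c by simp
      finally show ?thesis .
    qed
    with t(2) \<delta>(1) show ?thesis by blast
  qed
  then obtain t \<delta> where t: "\<And>x. x \<in> X \<Longrightarrow> 1 \<le> t x" and \<delta>: "\<And>x. x \<in> X \<Longrightarrow> 0 < \<delta> x"
    and half: "\<And>x y. \<lbrakk>x \<in> X; y \<in> X; norm (y - x) < \<delta> x\<rbrakk> \<Longrightarrow> cocycle_const * \<omega> (t x) y \<le> 1 / 2"
    by metis
  have "X \<subseteq> (\<Union>x\<in>X. ball x (\<delta> x))" using \<delta> by fastforce
  then obtain F where F: "F \<subseteq> X" "finite F" "X \<subseteq> (\<Union>x\<in>F. ball x (\<delta> x))"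
    by (rule compactE_image[OF compactX, rotated]) simp_all
  let ?\<tau> = "Max (insert 1 (t ` F))"
  show ?thesis
  proof (rule that[of ?\<tau>])
    show "1 \<le> ?\<tau>" using F(2) by simp
    fix y assume y: "y \<in> X"
    then obtain x where x: "x \<in> F" "y \<in> ball x (\<delta> x)" using F(3) by blast
    have "cocycle_const * \<omega> (t x) y \<le> 1 / 2"
      using x F(1) y by (intro half) (auto simp: dist_norm norm_minus_commute)
    moreover have "t x \<le> ?\<tau>" using F(2) x(1) by (intro Max_ge) auto
    moreover have "1 \<le> t x" using t x(1) F(1) by blast
    ultimately show "\<exists>s. 1 \<le> s \<and> s \<le> ?\<tau> \<and> cocycle_const * \<omega> s y \<le> 1 / 2" by blast
  qed
qed

text \<open>As long as \<open>T\<close> exceeds \<open>\<tau>\<close>, a return time \<open>t \<le> \<tau>\<close> can be split off, which gains a factor of one half. As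
\<open>t \<ge> 1\<close>, induction over an integer bound for \<open>T\<close> reaches times below \<open>\<tau>\<close>, where the Lipschitz bound applies.\<close>

lemma \<omega>_exponential_decay:
  assumes \<tau>: "1 \<le> \<tau>" and return: "\<And>y. y \<in> X \<Longrightarrow> \<exists>t. 1 \<le> t \<and> t \<le> \<tau> \<and> cocycle_const * \<omega> t y \<le> 1 / 2"
    and T: "0 \<le> T" "T \<le> real N" and y: "y \<in> X"
  shows "\<omega> T y \<le> exp (L * \<tau>) powr d * 2 powr (1 - T / \<tau>)"
  using T y
proof (induction N arbitrary: T y)
  case short: 0
  let ?B = "exp (L * \<tau>) powr d"
  have "\<omega> T y \<le> exp (L * T) powr d" by (rule \<omega>_le[OF short(1,3)])
  also have "\<dots> \<le> ?B" using short \<tau> L0 d(1) by (intro powr_mono2) (auto intro!: mult_left_mono)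
  also have "\<dots> \<le> ?B * 2 powr (1 - T / \<tau>)" using short by simp
  finally show ?case .
next
  case (Suc N)
  let ?B = "exp (L * \<tau>) powr d"
  show ?case
  proof (cases "T \<le> \<tau>")
    case True
    have "\<omega> T y \<le> exp (L * T) powr d" by (rule \<omega>_le[OF Suc.prems(1,3)])
    also have "\<dots> \<le> ?B * 1" using True Suc.prems(1) L0 d(1) by (auto intro!: powr_mono2 mult_left_mono)
    also have "\<dots> \<le> ?B * 2 powr (1 - T / \<tau>)"
      using True \<tau> by (intro mult_left_mono) (auto intro!: ge_one_powr_ge_zero)
    finally show ?thesis .
  next
    case False
    obtain t where t: "1 \<le> t" "t \<le> \<tau>" "cocycle_const * \<omega> t y \<le> 1 / 2" using return[OF Suc.prems(3)] by blast
    have t0: "0 \<le> t" "0 \<le> T - t" "T - t \<le> real N" using t False Suc.prems(2) by auto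
    have z: "\<phi> t y \<in> X" by (rule flow_in_X[OF Suc.prems(3) t0(1)])
    have "\<omega> T y \<le> cocycle_const * \<omega> (T - t) (\<phi> t y) * \<omega> t y"
      using \<omega>_cocycle[OF t0(1,2) Suc.prems(3)] by simp
    also have "\<dots> = \<omega> (T - t) (\<phi> t y) * (cocycle_const * \<omega> t y)" by (simp only: mult_ac)
    also have "\<dots> \<le> (?B * 2 powr (1 - (T - t) / \<tau>)) * (1 / 2)"
      using Suc.IH[OF t0(2,3) z] t(3) \<omega>_pos[OF t0(1) Suc.prems(3)] cocycle_const_ge_1
      by (intro mult_mono) auto
    also have "\<dots> = ?B * 2 powr (- (T - t) / \<tau>)"
    proof -
      have "1 - (T - t) / \<tau> = 1 + - (T - t) / \<tau>" by (simp add: diff_divide_distrib)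
      then show ?thesis by (simp only: powr_add) simp
    qed
    also have "\<dots> \<le> ?B * 2 powr (1 - T / \<tau>)"
      using t(2) \<tau> by (intro mult_left_mono powr_mono) (auto simp: field_simps)
    finally show ?thesis .
  qed
qed

lemma Sigma_negative_imp_contractive:
  assumes S: "Sigma_exponent d f X < 0"
  shows "uniformly_contractive d f X"
  unfolding uniformly_contractive_def
proof
  fix \<epsilon> :: real assume "\<epsilon> \<in> {0<..<1}"
  then have \<epsilon>: "0 < \<epsilon>" by simp
  obtain \<tau> where \<tau>: "1 \<le> \<tau>" "\<And>y. y \<in> X \<Longrightarrow> \<exists>t. 1 \<le> t \<and> t \<le> \<tau> \<and> cocycle_const * \<omega> t y \<le> 1 / 2"
    using Sigma_negative_imp_uniform_return[OF S] by blast
  define B where "B = ellipsoid_const d CARD('n) * exp (L * \<tau>) powr d"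
  have B: "0 < B" by (simp add: B_def ellipsoid_const_pos)
  define T0 where "T0 = max 1 (\<tau> * (1 + log 2 (B / \<epsilon>)))"
  have "hausdorff_measure d (\<phi> T ` K) \<le> ennreal \<epsilon> * hausdorff_measure d K"
    if K: "K \<subseteq> X" and T: "T0 \<le> T" for K T
  proof -
    have T1: "0 \<le> T" using T by (simp add: T0_def)
    obtain N where N: "T \<le> real N" using real_arch_simple by blast
    have "hausdorff_measure d (\<phi> T ` K) \<le>
        ennreal (ellipsoid_const d CARD('n) * (exp (L * \<tau>) powr d * 2 powr (1 - T / \<tau>))) * hausdorff_measure d K"
      by (rule image_measure_le[OF T1 _ \<omega>_exponential_decay[OF \<tau> T1 N] K]) simp_all
    also have "\<dots> \<le> ennreal \<epsilon> * hausdorff_measure d K"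
    proof (intro mult_right_mono ennreal_leI)
      have "\<tau> * (1 + log 2 (B / \<epsilon>)) \<le> T" using T by (simp add: T0_def)
      then have "1 + log 2 (B / \<epsilon>) \<le> T / \<tau>" using \<tau>(1) by (simp add: field_simps)
      then have "2 powr (1 - T / \<tau>) \<le> 2 powr (- log 2 (B / \<epsilon>))" by (intro powr_mono) auto
      also have "\<dots> = \<epsilon> / B" using B \<epsilon> by (simp add: powr_minus_divide)
      finally have "B * 2 powr (1 - T / \<tau>) \<le> B * (\<epsilon> / B)" using B by (intro mult_left_mono) auto
      also have "\<dots> = \<epsilon>" using B by simp
      finally show "ellipsoid_const d CARD('n) * (exp (L * \<tau>) powr d * 2 powr (1 - T / \<tau>)) \<le> \<epsilon>"
        by (simp only: B_def mult.assoc)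
    qed simp
    finally show ?thesis .
  qed
  then show "\<exists>T\<^sub>0>0. \<forall>K. compact K \<and> K \<subseteq> X \<and> hausdorff_measure d K < \<infinity> \<longrightarrow>
      (\<forall>T\<ge>T\<^sub>0. hausdorff_measure d (\<phi> T ` K) \<le> ennreal \<epsilon> * hausdorff_measure d K)"
    by (intro exI[of _ T0]) (auto simp: T0_def)
qed

end

section \<open>Dimension zero\<close>

lemma hausdorff_measure_empty: "hausdorff_measure d ({} :: 'a::metric_space set) = 0"
proof -
  have "hausdorff_pre d e ({} :: 'a set) \<le> 0" for e
    using hausdorff_pre_le[of "{}" e "{} :: 'a set" d] by (simp add: ball_covers_def)
  then show ?thesis by (simp add: hausdorff_measure_eq_SUP)
qed

lemma hausdorff_measure_0_singleton: "hausdorff_measure 0 {a} = 1"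
proof -
  have "hausdorff_pre 0 e {a} = 1" if e: "0 < e" for e
  proof (rule antisym)
    have "{(a, e)} \<in> ball_covers e {a}" using e by (simp add: ball_covers_def)
    then show "hausdorff_pre 0 e {a} \<le> 1" using hausdorff_pre_le[of "{(a, e)}" e "{a}" 0] e by simp
    show "1 \<le> hausdorff_pre 0 e {a}"
      unfolding hausdorff_pre_def
    proof (rule INF_greatest)
      fix C assume C: "C \<in> ball_covers e {a}"
      then have "finite C" "C \<noteq> {}" by (auto simp: ball_covers_def)
      then have "1 \<le> real (card C)" by (simp add: Suc_le_eq card_gt_0_iff)
      also have "real (card C) = (\<Sum>(c, r)\<in>C. 1)" by simp
      also have "\<dots> = cover_weight 0 C"
        using C by (intro sum.cong) (auto simp: ball_covers_def)
      finally have "ennreal 1 \<le> ennreal (cover_weight 0 C)" by (rule ennreal_leI)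
      then show "1 \<le> ennreal (cover_weight 0 C)" by simp
    qed
  qed
  then show ?thesis by (simp add: hausdorff_measure_eq_SUP)
qed

lemma contractive_0_iff:
  "uniformly_contractive 0 f X \<longleftrightarrow> X = {}"
proof
  assume uc: "uniformly_contractive 0 f X"
  show "X = {}"
  proof (rule ccontr)
    assume "X \<noteq> {}"
    then obtain a where a: "a \<in> X" by blast
    have "1 / 2 \<in> {0<..<1::real}" by simp
    then obtain T where T: "\<And>K. \<lbrakk>compact K; K \<subseteq> X; hausdorff_measure 0 K < \<infinity>\<rbrakk> \<Longrightarrow>
        hausdorff_measure 0 (flow f T ` K) \<le> ennreal (1 / 2) * hausdorff_measure 0 K"
      using uc unfolding uniformly_contractive_def by (meson order.refl)
    have "1 \<le> ennreal (1 / 2)"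
      using T[of "{a}"] a by (simp add: hausdorff_measure_0_singleton)
    then have "ennreal 1 \<le> ennreal (1 / 2)" by simp
    then show False by (subst (asm) ennreal_le_iff) auto
  qed
next
  assume "X = {}"
  then show "uniformly_contractive 0 f X"
    by (auto simp: uniformly_contractive_def hausdorff_measure_empty intro!: exI[of _ 1])
qed

lemma Sigma_exponent_0:
  fixes f :: "real^'n \<Rightarrow> real^'n"
  shows "Sigma_exponent 0 f X < 0 \<longleftrightarrow> X = {}"
proof -
  have "omega 0 A = 1" for A :: "real^'n^'n" by (simp add: omega_def)
  then have "Sigma_exponent 0 f X = (SUP x\<in>X. 0)"
    by (simp add: Sigma_exponent_def Limsup_const zero_ereal_def[symmetric])
  then show ?thesis by (cases "X = {}") (simp_all add: bot_ereal_def)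
qed

theorem mainTheorem2:
  fixes f :: "real^'n \<Rightarrow> real^'n" and X :: "(real^'n) set" and d :: real
  assumes d: "0 \<le> d" "d \<le> real CARD('n)"
    and f: "continuously_differentiable f"
    and A1: "forward_complete_near f X"
    and A2: "compact X" "X = closure (interior X)" "positively_invariant f X"
  shows "uniformly_contractive d f X \<longleftrightarrow> Sigma_exponent d f X < 0"
proof (cases "d = 0")
  case True
  then show ?thesis by (simp add: contractive_0_iff Sigma_exponent_0)
next
  case False
  obtain U where U: "open U" "X \<subseteq> U" "\<And>a t. a \<in> U \<Longrightarrow> 0 \<le> t \<Longrightarrow> \<exists>x. ivp_solution f a t x"
    using A1 unfolding forward_complete_near_def by blast
  obtain R where R: "\<And>x. x \<in> X \<Longrightarrow> norm x \<le> R - 1"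
  proof -
    obtain b where "\<forall>x\<in>X. norm x \<le> b" using compact_imp_bounded[OF A2(1)] unfolding bounded_iff by blast
    then show ?thesis by (intro that[of "b + 1"]) simp
  qed
  obtain L where L: "0 \<le> L" "\<And>x y. x \<in> cball 0 R \<Longrightarrow> y \<in> cball 0 R \<Longrightarrow> norm (f x - f y) \<le> L * norm (x - y)"
    using C1_lipschitz_on_ball[OF f] by metis
  interpret euclidean_flow f X U R L d
    using f U A2(1,3) R L d False by unfold_locales auto
  show ?thesis
    using contractive_imp_Sigma_negative[OF _ A2(2)] Sigma_negative_imp_contractive by blast
qed

end
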